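(* Let $(\mathcal V,d,\mu)$ be the weighted homogeneous tree and let $H^1(\mu)$ and $BMO(\mu)$ be the spaces defined in the context. Suppose that $1\le r_1<r<\infty$, $\theta\in(0,1)$ and $\frac1r=\frac{1-\theta}{r_1}$. Then $$[L^{r_1}(\mu),BMO(\mu)]_{\theta,r}=L^r(\mu).$$ Moreover, if $\frac1r=1-\theta$ with $\theta\in(0,1)$, then $$[H^1(\mu),BMO(\mu)]_{\theta,r}=L^r(\mu).$$
   Context: Tree. Let $m\ge 2$ be an integer and let $T=(\mathcal V,\mathcal E)$ be the infinite homogeneous tree of order $m+1$: a connected acyclic graph in which every vertex has exactly $m+1$ neighbours. Let $d(x,y)$ be the length of the shortest path between $x$ and $y$. Fix a doubly-infinite geodesic $g_0\subset\mathcal V$ (a connected subset such that each of its vertices has exactly two neighbours in it and the shortest path between any two of its vertices lies in it) and a map $N:g_0\to\mathbb Z$ with $|N(x)-N(y)|=d(x,y)$ for all $x,y\in g_0$. The level function is $\ell(x)=N(x')-d(x,x')$, where $x'$ is the vertex of $g_0$ closest to $x$. We say that $x$ lies below $y$ (and $y$ lies above $x$) if $\ell(x)=\ell(y)-d(x,y)$. The measure $\mu$ is defined by $\int_{\mathcal V} f\,\mathrm d\mu=\sum_{x\in\mathcal V}f(x)m^{\ell(x)}$. Functions are complex-valued. Calderón–Zygmund sets. A (nonempty) set $\tilde R\subset \mathcal V$ is a Calderón–Zygmund set if either it is a single vertex (degenerate case) or there are $x_R\in\mathcal V$ and an integer $h\ge 1$ such that $\tilde R=\{x: x\text{ lies below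 }x_R,\ h/2\le \ell(x_R)-\ell(x)<4h\}$. Let $\mathcal R$ be the family of all Calderón–Zygmund sets. Hardy space. A $(1,\infty)$-atom is a function $a$ supported in some $\tilde R\in\mathcal R$ with $\|a\|_{L^\infty}\le\mu(\tilde R)^{-1}$ and $\int_{\mathcal V} a\,\mathrm d\mu=0$. $H^1(\mu)$ is the space of $g\in L^1(\mu)$ of the form $g=\sum_{j\in\mathbb N}\lambda_ja_j$ with $a_j$ $(1,\infty)$-atoms, $\lambda_j\in\mathbb C$, $\sum_j|\lambda_j|<\infty$, normed by the infimum of $\sum_j|\lambda_j|$ over all such decompositions. BMO. $BMO(\mu)$ is the quotient by constant functions of the space of functions $f:\mathcal V\to\mathbb C$ with $\|f\|_{BMO}=\sup_{\tilde R\in\mathcal R}\frac1{\mu(\tilde R)}\int_{\tilde R}|f-f_{\tilde R}|\,\mathrm d\mu<\infty$, where $f_{\tilde R}=\mu(\tilde R)^{-1}\int_{\tilde R}f\,\mathrm d\mu$. Interpolation. $[X_0,X_1]_{\theta,q}$ denotes the real interpolation space of parameters $\theta,q$ of the compatible couple $(X_0,X_1)$. All spaces are viewed inside the space of functions on $\mathcal V$ modulo constants (nonzero constants do not belong to $L^s(\mu)$, $s<\infty$, nor to $H^1(\mu)$, so these spaces embed), and equality of spaces is with equivalent norms. *)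

theory Defs
  imports "HOL-Analysis.Analysis"
begin

text \<open>Graphs are given by an adjacency relation on a type; the vertex set is the whole type.\<close>

definition walk_betw :: "('v \<Rightarrow> 'v \<Rightarrow> bool) \<Rightarrow> 'v \<Rightarrow> 'v list \<Rightarrow> 'v \<Rightarrow> bool" where
  "walk_betw E x p y \<longleftrightarrow> p \<noteq> [] \<and> hd p = x \<and> last p = y \<and> successively E p"

definition connected_subset :: "('v \<Rightarrow> 'v \<Rightarrow> bool) \<Rightarrow> 'v set \<Rightarrow> bool" where
  "connected_subset E S \<longleftrightarrow>
     S \<noteq> {} \<and> (\<forall>x\<in>S. \<forall>y\<in>S. \<exists>p. walk_betw E x p y \<and> set p \<subseteq> S)"

definition acyclic_graph :: "('v \<Rightarrow> 'v \<Rightarrow> bool) \<Rightarrow> bool" where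
  "acyclic_graph E \<longleftrightarrow>
     \<not> (\<exists>p. length p \<ge> 3 \<and> distinct p \<and> successively E p \<and> E (last p) (hd p))"

text \<open>Infiniteness of the tree follows from acyclicity and the degree condition.\<close>

definition homogeneous_tree :: "nat \<Rightarrow> ('v \<Rightarrow> 'v \<Rightarrow> bool) \<Rightarrow> bool" where
  "homogeneous_tree m E \<longleftrightarrow>
     symp E \<and> irreflp E \<and> connected_subset E UNIV \<and> acyclic_graph E \<and>
     (\<forall>x. card {y. E x y} = m + 1)"

definition graph_dist :: "('v \<Rightarrow> 'v \<Rightarrow> bool) \<Rightarrow> 'v \<Rightarrow> 'v \<Rightarrow> nat" where
  "graph_dist E x y = (LEAST n. \<exists>p. walk_betw E x p y \<and> length p = Suc n)"

definition infinite_geodesic :: "('v \<Rightarrow> 'v \<Rightarrow> bool) \<Rightarrow> 'v set \<Rightarrow> bool" where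
  "infinite_geodesic E g \<longleftrightarrow>
     connected_subset E g \<and>
     (\<forall>x\<in>g. card {y \<in> g. E x y} = 2) \<and>
     (\<forall>x\<in>g. \<forall>y\<in>g. \<forall>p. walk_betw E x p y \<and> length p = Suc (graph_dist E x y)
        \<longrightarrow> set p \<subseteq> g)"

text \<open>Only the values of \<open>N\<close> on \<open>g\<close> matter below.\<close>

definition geodesic_labelling ::
    "('v \<Rightarrow> 'v \<Rightarrow> bool) \<Rightarrow> 'v set \<Rightarrow> ('v \<Rightarrow> int) \<Rightarrow> bool" where
  "geodesic_labelling E g N \<longleftrightarrow>
     (\<forall>x\<in>g. \<forall>y\<in>g. \<bar>N x - N y\<bar> = int (graph_dist E x y))"

definition closest_in :: "('v \<Rightarrow> 'v \<Rightarrow> bool) \<Rightarrow> 'v set \<Rightarrow> 'v \<Rightarrow> 'v" where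
  "closest_in E g x = arg_min (graph_dist E x) (\<lambda>y. y \<in> g)"

definition level :: "('v \<Rightarrow> 'v \<Rightarrow> bool) \<Rightarrow> 'v set \<Rightarrow> ('v \<Rightarrow> int) \<Rightarrow> 'v \<Rightarrow> int" where
  "level E g N x = N (closest_in E g x) - int (graph_dist E x (closest_in E g x))"

definition lies_below ::
    "('v \<Rightarrow> 'v \<Rightarrow> bool) \<Rightarrow> 'v set \<Rightarrow> ('v \<Rightarrow> int) \<Rightarrow> 'v \<Rightarrow> 'v \<Rightarrow> bool" where
  "lies_below E g N x y \<longleftrightarrow> level E g N x = level E g N y - int (graph_dist E x y)"

definition tree_measure ::
    "nat \<Rightarrow> ('v \<Rightarrow> 'v \<Rightarrow> bool) \<Rightarrow> 'v set \<Rightarrow> ('v \<Rightarrow> int) \<Rightarrow> 'v measure" where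
  "tree_measure m E g N = point_measure UNIV (\<lambda>x. ennreal (real m powi level E g N x))"

definition CZ_sets ::
    "('v \<Rightarrow> 'v \<Rightarrow> bool) \<Rightarrow> 'v set \<Rightarrow> ('v \<Rightarrow> int) \<Rightarrow> 'v set set" where
  "CZ_sets E g N = {R. R \<noteq> {} \<and>
     ((\<exists>x. R = {x}) \<or>
      (\<exists>x\<^sub>R (h::int). h \<ge> 1 \<and>
         R = {x. lies_below E g N x x\<^sub>R \<and>
                 real_of_int h / 2 \<le> real_of_int (level E g N x\<^sub>R - level E g N x) \<and>
                 level E g N x\<^sub>R - level E g N x < 4 * h}))}"

text \<open>
  A space \<open>X\<close> of functions (or of classes of functions) is represented by its norm, extended by
  \<open>\<infinity>\<close> off \<open>X\<close>; thus \<open>X\<close> is the set of elements of finite extended norm. The measures \<open>M\<close> below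
  are meant to have every function measurable, as is the case for \<open>tree_measure\<close>.
\<close>

definition space_of :: "('b \<Rightarrow> ennreal) \<Rightarrow> 'b set" where
  "space_of N = {F. N F < \<infinity>}"

text \<open>The power \<open>x\<^sup>p\<close> of an extended nonnegative real, for exponents \<open>p > 0\<close>.\<close>

definition ennpowr :: "ennreal \<Rightarrow> real \<Rightarrow> ennreal" where
  "ennpowr x p = (if x = \<infinity> then \<infinity> else ennreal (enn2real x powr p))"

definition Lp_norm :: "'v measure \<Rightarrow> real \<Rightarrow> ('v \<Rightarrow> complex) \<Rightarrow> ennreal" where
  "Lp_norm M p f = ennpowr (\<integral>\<^sup>+x. ennreal (cmod (f x) powr p) \<partial>M) (1 / p)"

definition atom :: "'v measure \<Rightarrow> 'v set set \<Rightarrow> ('v \<Rightarrow> complex) \<Rightarrow> bool" where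
  "atom M \<R> a \<longleftrightarrow> (\<exists>R\<in>\<R>.
     (\<forall>x. x \<notin> R \<longrightarrow> a x = 0) \<and>
     (AE x in M. cmod (a x) \<le> 1 / measure M R) \<and>
     (\<integral>x. a x \<partial>M) = 0)"

text \<open>
  The series \<open>\<Sum>j. \<lambda>\<^sub>j a\<^sub>j\<close> is taken to converge in \<open>L\<^sup>1\<close>; since the coefficients are summable and
  atoms have \<open>L\<^sup>1\<close>-norm at most one, it converges absolutely there.
\<close>

definition atomic_decompositions ::
    "'v measure \<Rightarrow> 'v set set \<Rightarrow> ('v \<Rightarrow> complex) \<Rightarrow> ((nat \<Rightarrow> complex) \<times> (nat \<Rightarrow> 'v \<Rightarrow> complex)) set"
where
  "atomic_decompositions M \<R> f = {(c, a).
     (\<forall>j. atom M \<R> (a j)) \<and> summable (\<lambda>j. cmod (c j)) \<and>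
     (\<lambda>n. Lp_norm M 1 (\<lambda>x. f x - (\<Sum>j<n. c j * a j x))) \<longlonglongrightarrow> 0}"

definition H1_norm :: "'v measure \<Rightarrow> 'v set set \<Rightarrow> ('v \<Rightarrow> complex) \<Rightarrow> ennreal" where
  "H1_norm M \<R> f =
     (if f \<in> space_of (Lp_norm M 1)
      then (INF (c, a) \<in> atomic_decompositions M \<R> f. \<Sum>j. ennreal (cmod (c j)))
      else \<infinity>)"

definition mean_on :: "'v measure \<Rightarrow> 'v set \<Rightarrow> ('v \<Rightarrow> complex) \<Rightarrow> complex" where
  "mean_on M R f = (LINT x:R|M. f x) / of_real (measure M R)"

definition BMO_norm :: "'v measure \<Rightarrow> 'v set set \<Rightarrow> ('v \<Rightarrow> complex) \<Rightarrow> ennreal" where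
  "BMO_norm M \<R> f =
     (SUP R\<in>\<R>. (\<integral>\<^sup>+x\<in>R. ennreal (cmod (f x - mean_on M R f)) \<partial>M) / emeasure M R)"

quotient_type 'v fun_mod_const = "'v \<Rightarrow> complex" / "\<lambda>f g. \<exists>c. \<forall>x. f x = g x + c"
proof (rule equivpI)
  show "reflp (\<lambda>f g :: 'v \<Rightarrow> complex. \<exists>c. \<forall>x. f x = g x + c)"
    by (rule reflpI) (rule exI[of _ 0], simp)
  show "symp (\<lambda>f g :: 'v \<Rightarrow> complex. \<exists>c. \<forall>x. f x = g x + c)"
  proof (rule sympI)
    fix f g :: "'v \<Rightarrow> complex"
    assume "\<exists>c. \<forall>x. f x = g x + c"
    then obtain c where "\<forall>x. f x = g x + c" ..
    then have "\<forall>x. g x = f x + (- c)" by simp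
    then show "\<exists>c. \<forall>x. g x = f x + c" ..
  qed
  show "transp (\<lambda>f g :: 'v \<Rightarrow> complex. \<exists>c. \<forall>x. f x = g x + c)"
  proof (rule transpI)
    fix f g h :: "'v \<Rightarrow> complex"
    assume "\<exists>c. \<forall>x. f x = g x + c" "\<exists>c. \<forall>x. g x = h x + c"
    then obtain c d where "\<forall>x. f x = g x + c" "\<forall>x. g x = h x + d" by blast
    then have "\<forall>x. f x = h x + (d + c)" by simp
    then show "\<exists>c. \<forall>x. f x = h x + c" ..
  qed
qed

instantiation fun_mod_const :: (type) ab_group_add
begin

lift_definition zero_fun_mod_const :: "'v fun_mod_const" is "\<lambda>_. 0" .

lift_definition plus_fun_mod_const ::
    "'v fun_mod_const \<Rightarrow> 'v fun_mod_const \<Rightarrow> 'v fun_mod_const"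
  is "\<lambda>f g x. f x + g x"
proof -
  fix f f' g g' :: "'v \<Rightarrow> complex"
  assume "\<exists>c. \<forall>x. f x = f' x + c" "\<exists>c. \<forall>x. g x = g' x + c"
  then obtain c d where "\<forall>x. f x = f' x + c" "\<forall>x. g x = g' x + d" by blast
  then have "\<forall>x. f x + g x = f' x + g' x + (c + d)" by simp
  then show "\<exists>c. \<forall>x. f x + g x = f' x + g' x + c" ..
qed

lift_definition uminus_fun_mod_const :: "'v fun_mod_const \<Rightarrow> 'v fun_mod_const"
  is "\<lambda>f x. - f x"
proof -
  fix f g :: "'v \<Rightarrow> complex"
  assume "\<exists>c. \<forall>x. f x = g x + c"
  then obtain c where "\<forall>x. f x = g x + c" ..
  then have "\<forall>x. - f x = - g x + (- c)" by simp
  then show "\<exists>c. \<forall>x. - f x = - g x + c" ..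
qed

lift_definition minus_fun_mod_const ::
    "'v fun_mod_const \<Rightarrow> 'v fun_mod_const \<Rightarrow> 'v fun_mod_const"
  is "\<lambda>f g x. f x - g x"
proof -
  fix f f' g g' :: "'v \<Rightarrow> complex"
  assume "\<exists>c. \<forall>x. f x = f' x + c" "\<exists>c. \<forall>x. g x = g' x + c"
  then obtain c d where "\<forall>x. f x = f' x + c" "\<forall>x. g x = g' x + d" by blast
  then have "\<forall>x. f x - g x = f' x - g' x + (c - d)" by simp
  then show "\<exists>c. \<forall>x. f x - g x = f' x - g' x + c" ..
qed

instance
  by intro_classes (transfer; rule exI[of _ 0]; simp)+

end

text \<open>
  The norm that a space of functions induces on classes. For spaces meeting the constants only in
  \<open>0\<close>, such as \<open>L\<^sup>p\<close> and \<open>H\<^sup>1\<close> for a measure of infinite mass, a class has at most one representative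
  of finite norm, so this is the image norm under the embedding; the \<open>BMO\<close> seminorm is
  constant on classes, so there it is the norm of the quotient by the constants.
\<close>

definition mod_const :: "(('v \<Rightarrow> complex) \<Rightarrow> ennreal) \<Rightarrow> 'v fun_mod_const \<Rightarrow> ennreal" where
  "mod_const N F = (INF f\<in>{f. abs_fun_mod_const f = F}. N f)"

definition K_functional ::
    "('b::ab_group_add \<Rightarrow> ennreal) \<Rightarrow> ('b \<Rightarrow> ennreal) \<Rightarrow> real \<Rightarrow> 'b \<Rightarrow> ennreal" where
  "K_functional N0 N1 t F =
     (INF (F0, F1) \<in> {(F0, F1). F = F0 + F1}. N0 F0 + ennreal t * N1 F1)"

text \<open>The norm of \<open>[X\<^sub>0, X\<^sub>1]\<^sub>\<theta>\<^sub>,\<^sub>q\<close> for finite \<open>q\<close>.\<close>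

definition interpolation_norm ::
    "('b::ab_group_add \<Rightarrow> ennreal) \<Rightarrow> ('b \<Rightarrow> ennreal) \<Rightarrow> real \<Rightarrow> real \<Rightarrow> 'b \<Rightarrow> ennreal" where
  "interpolation_norm N0 N1 \<theta> q F =
     ennpowr
       (\<integral>\<^sup>+t\<in>{0<..}.
          ennpowr (ennreal (t powr - \<theta>) * K_functional N0 N1 t F) q / ennreal t \<partial>lborel)
       (1 / q)"

definition equal_with_equivalent_norms :: "('b \<Rightarrow> ennreal) \<Rightarrow> ('b \<Rightarrow> ennreal) \<Rightarrow> bool" where
  "equal_with_equivalent_norms N N' \<longleftrightarrow>
     space_of N = space_of N' \<and>
     (\<exists>A>0. \<exists>B>0. \<forall>F\<in>space_of N. N F \<le> ennreal A * N' F \<and> N' F \<le> ennreal B * N F)"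

end

theory Submission
  imports Defs
begin

text \<open>
  The theorem reduces to two inequalities, with constants independent of the class \<open>F\<close>.

  \<^bold>\<open>Geometry.\<close> The level function turns the tree into one with a root at infinity: every vertex
  has one parent, which lies one level higher, and \<open>m\<close> children, so that the generations of
  descendants of a vertex all have the same mass as the vertex. This makes it possible to construct a
  dyadic filtration, an increasing sequence of partitions into sets \<open>Q t v\<close>, each of which fills a
  comparable portion of some Calderon-Zygmund set and grows only by a bounded factor in each step
  (\<open>dyadic_filtration_tree\<close>). The measure is not doubling, but with respect to this filtration the
  usual stopping-time argument works. For a height \<open>l\<close> the good part \<open>good_part f l\<close> is the average
  of \<open>f\<close> over the last \<open>Q t v\<close> on which the mean of \<open>|f|\<close> exceeds \<open>l\<close>. It is bounded by a
  multiple of \<open>l\<close>, and the difference of the good parts at the heights \<open>l\<close> and \<open>2 l\<close>, called a layer,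
  has integral zero on each stopping class. A layer is thus a sum of multiples of atoms, whose
  coefficients add up to a multiple of \<open>l\<close> times the mass of the set where some mean exceeds \<open>l\<close>, and
  that mass is at most \<open>(2 / l) \<integral> |f|\<close> over the set where \<open>|f| > l / 2\<close>.

  \<^bold>\<open>From \<open>L\<^sup>r\<close> to the interpolation space.\<close> For \<open>H\<^sup>1\<close>, the function \<open>f \<in> L\<^sup>r\<close> is split at every height
  \<open>l\<close> into its good part and the sum of all higher layers; for \<open>L\<^bsup>r\<^sub>1\<^esup>\<close> plain truncation suffices. Both
  times the first norm is controlled by an integral over \<open>{2 |f| > l}\<close>, from which
  \<open>interpolation_norm_upper\<close> deduces the estimate by an exchange of integrations.

  \<^bold>\<open>From the interpolation space to \<open>L\<^sup>r\<close>.\<close> By duality it is enough to pair \<open>f\<close> with finitely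
  supported functions \<open>\<phi>\<close> of integral zero. Such a function is a finite sum of layers. A layer can be
  paired with a summand in \<open>L\<^bsup>r\<^sub>1\<^esup>\<close>, because it is bounded and lives on a set of controlled mass, and
  with a summand in BMO, because it is composed of atoms. So it sees exactly the \<open>K\<close>-functional of \<open>f\<close>
  at one point (\<open>layer_pairing\<close>), and adding up the layers yields the interpolation norm of \<open>f\<close> and the
  norm of \<open>\<phi>\<close> in the dual exponent (\<open>pairing_estimate\<close>). Functions of integral zero do not detect
  constants; the right constant is found as a limit of values of \<open>f\<close> at vertices of large mass. As the
  \<open>H\<^sup>1\<close> norm dominates the \<open>L\<^sup>1\<close> norm, the case of \<open>H\<^sup>1\<close> is contained in that of \<open>r\<^sub>1 = 1\<close>.
\<close>

section \<open>The order structure of the tree\<close>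

lemma distinct_walk:
  assumes "walk_betw E x p y" "set p \<subseteq> S"
  shows "\<exists>q. walk_betw E x q y \<and> set q \<subseteq> S \<and> distinct q"
  using assms
proof (induction "length p" arbitrary: p rule: less_induct)
  case less
  show ?case
  proof (cases "distinct p")
    case True
    then show ?thesis using less.prems by blast
  next
    case False
    then obtain as z bs cs where p: "p = as @ [z] @ bs @ [z] @ cs"
      using not_distinct_decomp by blast
    have "walk_betw E x (as @ [z] @ cs) y"
    proof -
      have w: "hd p = x" "last p = y" "successively E p"
        using less.prems(1) unfolding walk_betw_def by auto
      have "hd (as @ [z] @ cs) = x" using w(1) unfolding p by (cases as) auto
      moreover have "last (as @ [z] @ cs) = y" using w(2) unfolding p by (cases cs) auto
      moreover have "successively E (as @ [z])" "successively E ([z] @ cs)"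
        using w(3) successively_append_iff[of E "as @ [z]" "bs @ [z] @ cs"]
          successively_append_iff[of E "as @ [z] @ bs" "[z] @ cs"] unfolding p by auto
      ultimately show ?thesis unfolding walk_betw_def by (auto simp: successively_append_iff)
    qed
    moreover have "set (as @ [z] @ cs) \<subseteq> S" using less.prems(2) p by auto
    ultimately show ?thesis using less.hyps[of "as @ [z] @ cs"] p by auto
  qed
qed

text \<open>Two edges from \<open>v\<close> into \<open>U\<close> would close up, through a path inside \<open>U\<close>, to a cycle.\<close>

lemma unique_neighbour_in_connected:
  assumes "symp E" "acyclic_graph E" "connected_subset E U" "v \<notin> U"
    and "E v a" "E v b" "a \<in> U" "b \<in> U"
  shows "a = b"
proof (rule ccontr)
  assume ab: "a \<noteq> b"
  obtain p where p: "walk_betw E a p b" "set p \<subseteq> U"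
    using assms unfolding connected_subset_def by blast
  obtain q where q: "walk_betw E a q b" "set q \<subseteq> U" "distinct q"
    using distinct_walk[OF p] by blast
  have len: "length q \<ge> 2"
    using q(1) ab unfolding walk_betw_def by (cases q rule: list.exhaust; cases "tl q") auto
  have "length (v # q) \<ge> 3" "distinct (v # q)" "successively E (v # q)"
    "E (last (v # q)) (hd (v # q))"
    using len q assms(1,4,5,6) unfolding walk_betw_def
    by (auto simp: successively_Cons symp_def)
  then show False using assms(2) unfolding acyclic_graph_def by blast
qed

lemma graph_dist_walk:
  assumes "connected_subset E UNIV"
  shows "\<exists>p. walk_betw E x p y \<and> length p = Suc (graph_dist E x y)"
proof -
  obtain p where p: "walk_betw E x p y" using assms unfolding connected_subset_def by blast
  then have "length p = Suc (length p - 1)" unfolding walk_betw_def by (cases p) auto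
  then have "\<exists>n p. walk_betw E x p y \<and> length p = Suc n" using p by blast
  then show ?thesis unfolding graph_dist_def by (rule LeastI_ex)
qed

lemma graph_dist_le: "walk_betw E x p y \<Longrightarrow> length p = Suc n \<Longrightarrow> graph_dist E x y \<le> n"
  unfolding graph_dist_def by (rule Least_le) blast

lemma walk_betw_Cons: "E x y \<Longrightarrow> walk_betw E y p z \<Longrightarrow> walk_betw E x (x # p) z"
  unfolding walk_betw_def by (auto simp: successively_Cons)

lemma walk_betw_append:
  "walk_betw E x p y \<Longrightarrow> walk_betw E y q z \<Longrightarrow> walk_betw E x (p @ tl q) z"
  unfolding walk_betw_def
  by (cases q; cases "tl q") (auto simp: successively_append_iff successively_Cons)

lemma walk_betw_rev: "symp E \<Longrightarrow> walk_betw E x p y \<Longrightarrow> walk_betw E y (rev p) x"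
  unfolding walk_betw_def
  by (auto simp: hd_rev last_rev symp_def elim: successively_mono)

lemma graph_dist_self [simp]: "graph_dist E x x = 0"
  using graph_dist_le[of E x "[x]" x 0] by (simp add: walk_betw_def)

lemma graph_dist_eq_0:
  assumes "connected_subset E UNIV" "graph_dist E x y = 0" shows "x = y"
proof -
  obtain p where "walk_betw E x p y" "length p = Suc 0"
    using graph_dist_walk[OF assms(1), of x y] assms(2) by auto
  then show ?thesis unfolding walk_betw_def by (cases p) auto
qed

lemma graph_dist_step:
  assumes "connected_subset E UNIV" "E x y" shows "graph_dist E x z \<le> Suc (graph_dist E y z)"
proof -
  obtain p where "walk_betw E y p z" "length p = Suc (graph_dist E y z)"
    using graph_dist_walk[OF assms(1)] by blast
  then show ?thesis using graph_dist_le[OF walk_betw_Cons[of E x y, OF assms(2)]] by fastforce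
qed

lemma graph_dist_next:
  assumes "connected_subset E UNIV" "graph_dist E x z = Suc n"
  shows "\<exists>y. E x y \<and> graph_dist E y z = n"
proof -
  obtain p where p: "walk_betw E x p z" "length p = Suc (Suc n)"
    using graph_dist_walk[OF assms(1), of x z] assms(2) by auto
  then obtain y q where pq: "p = x # y # q"
    unfolding walk_betw_def by (cases p; cases "tl p") auto
  then have "E x y" "walk_betw E y (y # q) z" using p unfolding walk_betw_def by auto
  moreover have "graph_dist E y z \<le> n" using graph_dist_le[OF calculation(2)] p pq by auto
  moreover have "Suc n \<le> Suc (graph_dist E y z)"
    using graph_dist_step[OF assms(1) calculation(1)] assms(2) by metis
  ultimately show ?thesis by force
qed

text \<open>
  The features of the tree on which the analysis rests. The level function puts the root at infinity,
  in the direction in which the labels of the geodesic increase.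
\<close>

locale level_tree =
  fixes m :: nat and parent :: "'v \<Rightarrow> 'v" and lev :: "'v \<Rightarrow> int"
  assumes m2: "m \<ge> 2"
    and lev_parent: "lev (parent x) = lev x + 1"
    and card_children: "card {y. parent y = x} = m"
    and common_ancestor: "\<exists>i j. (parent ^^ i) x = (parent ^^ j) y"

locale labelled_tree =
  fixes m :: nat and E :: "'v \<Rightarrow> 'v \<Rightarrow> bool" and g :: "'v set" and N :: "'v \<Rightarrow> int"
  assumes m2: "m \<ge> 2" and tree: "homogeneous_tree m E"
    and geo: "infinite_geodesic E g" and lab: "geodesic_labelling E g N"
begin

lemma symE: "E x y \<Longrightarrow> E y x" and irreflE: "\<not> E x x"
  and conn: "connected_subset E UNIV" and acyc: "acyclic_graph E" and sympE: "symp E"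
  and degree: "card {y. E x y} = m + 1"
  using tree unfolding homogeneous_tree_def by (auto simp: symp_def irreflp_def)

abbreviation "cl \<equiv> closest_in E g"
abbreviation "lv \<equiv> level E g N"

definition height :: "'v \<Rightarrow> nat" where "height x = graph_dist E x (cl x)"

lemma cl_in: "cl x \<in> g" and cl_le: "y \<in> g \<Longrightarrow> graph_dist E x (cl x) \<le> graph_dist E x y"
proof -
  obtain z where z: "z \<in> g" using geo unfolding infinite_geodesic_def connected_subset_def by blast
  show "cl x \<in> g" unfolding closest_in_def by (rule arg_min_natI[of "\<lambda>y. y \<in> g"]) (rule z)
  show "y \<in> g \<Longrightarrow> graph_dist E x (cl x) \<le> graph_dist E x y"
    unfolding closest_in_def by (rule arg_min_nat_le)
qed

lemma height_0_iff: "height x = 0 \<longleftrightarrow> x \<in> g"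
  using graph_dist_eq_0[OF conn, of x "cl x"] cl_in[of x] cl_le[of x x]
  unfolding height_def by auto

lemma height_step: "E x y \<Longrightarrow> height x \<le> Suc (height y)"
  using cl_le[OF cl_in[of y], of x] graph_dist_step[OF conn, of x y "cl y"] cl_in[of y]
  unfolding height_def by linarith

lemma height_next:
  assumes "height x = Suc n" shows "\<exists>y. E x y \<and> height y = n"
proof -
  obtain y where y: "E x y" "graph_dist E y (cl x) = n"
    using graph_dist_next[OF conn] assms unfolding height_def by blast
  then have "height y \<le> n" using cl_le[OF cl_in[of x], of y] unfolding height_def by simp
  then show ?thesis using height_step[OF y(1)] assms y(1) by (intro exI[of _ y]) auto
qed

lemma walk_to_geodesic:
  "\<exists>p y. y \<in> g \<and> walk_betw E x p y \<and> (\<forall>z\<in>set p. height z \<le> height x)"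
proof (induction "height x" arbitrary: x)
  case 0
  then have "x \<in> g" "walk_betw E x [x] x" using height_0_iff by (auto simp: walk_betw_def)
  then show ?case by (intro exI[of _ "[x]"] exI[of _ x]) auto
next
  case (Suc n)
  then obtain y where y: "E x y" "height y = n" using height_next by metis
  obtain p z where "z \<in> g" "walk_betw E y p z" "\<forall>u\<in>set p. height u \<le> height y"
    using Suc(1)[of y] y(2) by blast
  then show ?case using walk_betw_Cons[of E x y, OF y(1)] y(2) Suc(2)
    by (intro exI[of _ "x # p"] exI[of _ z]) auto
qed

lemma connected_neighbourhood: "connected_subset E {x. height x \<le> n}"
  unfolding connected_subset_def
proof (intro conjI ballI)
  show "{x. height x \<le> n} \<noteq> {}" proof -
    have "cl undefined \<in> {x. height x \<le> n}" using cl_in[of undefined] height_0_iff[of "cl undefined"] by simp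
    then show ?thesis by blast
  qed
  fix x y assume xy: "x \<in> {x. height x \<le> n}" "y \<in> {x. height x \<le> n}"
  obtain p u where p: "u \<in> g" "walk_betw E x p u" "\<forall>z\<in>set p. height z \<le> height x"
    using walk_to_geodesic by blast
  obtain q w where q: "w \<in> g" "walk_betw E y q w" "\<forall>z\<in>set q. height z \<le> height y"
    using walk_to_geodesic by blast
  obtain r where r: "walk_betw E u r w" "set r \<subseteq> g"
    using geo p(1) q(1) unfolding infinite_geodesic_def connected_subset_def by blast
  have "walk_betw E x ((p @ tl r) @ tl (rev q)) y"
    using walk_betw_append[OF walk_betw_append[OF p(2) r(1)] walk_betw_rev[OF sympE q(2)]] .
  moreover have "set ((p @ tl r) @ tl (rev q)) \<subseteq> {x. height x \<le> n}"
  proof -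
    have "set (tl r) \<subseteq> g" using r(2) by (cases r) auto
    moreover have "set (tl (rev q)) \<subseteq> set q" by (metis list.set_sel(2) set_rev subsetI tl_Nil)
    ultimately have "set ((p @ tl r) @ tl (rev q)) \<subseteq> set p \<union> g \<union> set q" by auto
    moreover have "set p \<subseteq> {x. height x \<le> n}" "set q \<subseteq> {x. height x \<le> n}"
      using p(3) q(3) xy by auto
    moreover have "g \<subseteq> {x. height x \<le> n}"
    proof
      fix x assume "x \<in> g"
      then show "x \<in> {x. height x \<le> n}" using height_0_iff[of x] by simp
    qed
    ultimately show ?thesis by blast
  qed
  ultimately show "\<exists>p. walk_betw E x p y \<and> set p \<subseteq> {x. height x \<le> n}" by blast
qed

lemma lower_neighbour_unique:
  assumes "E x a" "E x b" "height a < height x" "height b < height x"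
  shows "a = b"
  using unique_neighbour_in_connected[OF sympE acyc
      connected_neighbourhood[of "height x - 1"], of x a b] assms by auto

text \<open>
  If both ends were off the geodesic at distance \<open>n + 1\<close>, then the \<open>n\<close>-neighbourhood together with
  \<open>y\<close> would be a connected set in which \<open>x\<close> has two neighbours.
\<close>

lemma equal_height_not_adjacent:
  assumes "E x y" "height x = height y" shows "height x = 0"
proof (rule ccontr)
  assume "height x \<noteq> 0"
  then obtain n where n: "height x = Suc n" by (cases "height x") auto
  obtain a where a: "E x a" "height a = n" using height_next[OF n] by blast
  obtain b where b: "E y b" "height b = n" using height_next assms(2) n by metis
  let ?B = "{x. height x \<le> n}"
  have B: "\<exists>p. walk_betw E u p z \<and> set p \<subseteq> ?B" if "u \<in> ?B" "z \<in> ?B" for u z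
    using connected_neighbourhood[of n] that unfolding connected_subset_def by blast
  have yB: "\<exists>p. walk_betw E y p z \<and> set p \<subseteq> insert y ?B" if "z \<in> ?B" for z
  proof -
    obtain p where p: "walk_betw E b p z" "set p \<subseteq> ?B" using B[of b z] \<open>z \<in> ?B\<close> b(2) by blast
    show ?thesis
      by (rule exI[of _ "y # p"]) (use walk_betw_Cons[of E y b, OF b(1) p(1)] p(2) in auto)
  qed
  have By: "\<exists>p. walk_betw E z p y \<and> set p \<subseteq> insert y ?B" if "z \<in> ?B" for z
  proof -
    obtain p where p: "walk_betw E y p z" "set p \<subseteq> insert y ?B" using yB[OF \<open>z \<in> ?B\<close>] by blast
    show ?thesis by (rule exI[of _ "rev p"]) (use walk_betw_rev[OF sympE p(1)] p(2) in auto)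
  qed
  have yy: "\<exists>p. walk_betw E y p y \<and> set p \<subseteq> insert y ?B"
    by (rule exI[of _ "[y]"]) (auto simp: walk_betw_def)
  have "connected_subset E (insert y ?B)"
    unfolding connected_subset_def
  proof (intro conjI ballI)
    fix u z assume "u \<in> insert y ?B" "z \<in> insert y ?B"
    then consider "u = y" "z = y" | "u = y" "z \<in> ?B" | "u \<in> ?B" "z = y" | "u \<in> ?B" "z \<in> ?B"
      by blast
    then show "\<exists>p. walk_betw E u p z \<and> set p \<subseteq> insert y ?B"
    proof cases
      case 1 then show ?thesis using yy by simp
    next
      case 2 then show ?thesis using yB by simp
    next
      case 3 then show ?thesis using By by simp
    next
      case 4
      then obtain p where "walk_betw E u p z" "set p \<subseteq> ?B" using B[of u z] by auto
      then show ?thesis by (intro exI[of _ p]) auto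
    qed
  qed simp
  from unique_neighbour_in_connected[OF sympE acyc this, of x y a]
  have "y = a" using assms a n irreflE by auto
  then show False using a n assms by simp
qed

lemma N_inj: "x \<in> g \<Longrightarrow> y \<in> g \<Longrightarrow> N x = N y \<Longrightarrow> x = y"
  using lab graph_dist_eq_0[OF conn, of x y] unfolding geodesic_labelling_def by fastforce

lemma N_adjacent:
  assumes "x \<in> g" "y \<in> g" "E x y" shows "\<bar>N x - N y\<bar> = 1"
proof -
  have "graph_dist E x y \<le> Suc (graph_dist E y y)" by (rule graph_dist_step[OF conn assms(3)])
  moreover have "graph_dist E x y \<noteq> 0" using graph_dist_eq_0[OF conn] assms(3) irreflE by blast
  ultimately have "graph_dist E x y = 1" by simp
  then show ?thesis using lab assms unfolding geodesic_labelling_def by auto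
qed

lemma geodesic_next:
  assumes "x \<in> g" shows "\<exists>y\<in>g. E x y \<and> N y = N x + 1"
proof -
  have "card {y \<in> g. E x y} = 2" using geo assms unfolding infinite_geodesic_def by blast
  then obtain a b where ab: "{y \<in> g. E x y} = {a, b}" "a \<noteq> b" by (meson card_2_iff)
  then have "a \<in> g" "b \<in> g" "E x a" "E x b" by auto
  moreover have "N a \<noteq> N b" using N_inj calculation ab(2) by blast
  moreover have "N a = N x + 1 \<or> N b = N x + 1"
    using N_adjacent[of x a] N_adjacent[of x b] assms calculation by linarith
  ultimately show ?thesis by blast
qed

definition parent :: "'v \<Rightarrow> 'v" where
  "parent x = (if x \<in> g then SOME y. y \<in> g \<and> E x y \<and> N y = N x + 1
               else SOME y. E x y \<and> Suc (height y) = height x)"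

lemma parent_geodesic:
  assumes "x \<in> g" shows "parent x \<in> g \<and> E x (parent x) \<and> N (parent x) = N x + 1"
  unfolding parent_def using assms geodesic_next[OF assms]
  by (simp, intro someI_ex[of "\<lambda>y. y \<in> g \<and> E x y \<and> N y = N x + 1"]) blast

lemma parent_off_geodesic:
  assumes "x \<notin> g" shows "E x (parent x) \<and> Suc (height (parent x)) = height x"
proof -
  obtain n where "height x = Suc n" using height_0_iff assms by (cases "height x") auto
  then have "\<exists>y. E x y \<and> Suc (height y) = height x" using height_next by metis
  then show ?thesis unfolding parent_def using assms
    by (simp, intro someI_ex[of "\<lambda>y. E x y \<and> Suc (height y) = height x"])
qed

lemma parent_adjacent: "E x (parent x)"
  using parent_geodesic parent_off_geodesic by blast

text \<open>
  An edge inside the geodesic changes the label by one. Any other edge changes the height, and then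
  its lower end is the only neighbour of the higher end that is closer to the geodesic.
\<close>

lemma adjacent_iff: "E x y \<longleftrightarrow> y = parent x \<or> x = parent y"
proof
  have down: "b = parent a" if "E a b" "height b < height a" for a b
  proof -
    have "a \<notin> g" using that(2) height_0_iff by force
    then show ?thesis
      using lower_neighbour_unique[of a b "parent a"] parent_off_geodesic[of a] that by auto
  qed
  assume E: "E x y"
  show "y = parent x \<or> x = parent y"
  proof (cases "height x = height y")
    case True
    then have "x \<in> g" "y \<in> g" using equal_height_not_adjacent[OF E] height_0_iff[of x] height_0_iff[of y] by auto
    then show ?thesis
      using N_adjacent[OF _ _ E] parent_geodesic[of x] parent_geodesic[of y]
        N_inj[of y "parent x"] N_inj[of x "parent y"] by force
  next
    case False
    then show ?thesis using down[OF E] down[OF symE[OF E]] by linarith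
  qed
next
  show "y = parent x \<or> x = parent y \<Longrightarrow> E x y" using parent_adjacent symE by metis
qed

text \<open>
  The height drops by at most one along an edge, so a shortest path to the geodesic has to follow
  the parents. In particular the closest point of the geodesic is unique.
\<close>

lemma dist_geodesic_ancestor:
  "y \<in> g \<Longrightarrow> graph_dist E x y = height x \<Longrightarrow> y = (parent ^^ height x) x"
proof (induction "height x" arbitrary: x)
  case 0
  then show ?case using graph_dist_eq_0[OF conn, of x y] by simp
next
  case (Suc n)
  then obtain z where z: "E x z" "graph_dist E z y = n"
    using graph_dist_next[OF conn, of x y n] by auto
  have "height z \<le> n" using cl_le[OF Suc(3), of z] z(2) unfolding height_def by simp
  then have hz: "height z = n" using height_step[OF z(1)] Suc(2) by linarith
  moreover have "x \<notin> g" using Suc(2) height_0_iff by force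
  ultimately have "z = parent x"
    using lower_neighbour_unique[OF z(1), of "parent x"] parent_off_geodesic[of x] Suc(2) by auto
  then show ?case using Suc(1)[of z] hz z(2) Suc(2,3) by (simp add: funpow_swap1 flip: Suc(2))
qed

lemma level_eq: "lv x = N ((parent ^^ height x) x) - int (height x)"
  using dist_geodesic_ancestor[OF cl_in, of x x] unfolding level_def height_def by simp

lemma level_parent: "lv (parent x) = lv x + 1"
proof (cases "x \<in> g")
  case True
  then have "height x = 0" "height (parent x) = 0"
    using height_0_iff parent_geodesic by auto
  then show ?thesis using level_eq[of x] level_eq[of "parent x"] parent_geodesic[OF True] by simp
next
  case False
  then have h: "height x = Suc (height (parent x))" using parent_off_geodesic by simp
  then show ?thesis using level_eq[of x] level_eq[of "parent x"]
    by (simp add: h funpow_swap1 del: funpow.simps) (simp add: funpow_swap1)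
qed

lemma neighbours: "{y. E x y} = insert (parent x) {y. parent y = x}"
  using adjacent_iff by auto

sublocale level_tree m parent lv
proof
  show "m \<ge> 2" by (rule m2)
  show "lv (parent x) = lv x + 1" for x by (rule level_parent)
  show "card {y. parent y = x} = m" for x
  proof -
    have "finite {y. E x y}" using degree[of x] by (metis Suc_eq_plus1 card.infinite nat.distinct(1))
    moreover have "parent x \<notin> {y. parent y = x}"
      using level_parent[of "parent x"] level_parent[of x] by auto
    ultimately show ?thesis using degree[of x] unfolding neighbours by auto
  qed
  show "\<exists>i j. (parent ^^ i) x = (parent ^^ j) y" for x y
  proof -
    obtain p where "walk_betw E x p y" using conn unfolding connected_subset_def by blast
    then show ?thesis
    proof (induction p arbitrary: x)
      case Nil
      then show ?case by (simp add: walk_betw_def)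
    next
      case (Cons a p)
      show ?case
      proof (cases p)
        case Nil
        then show ?thesis using Cons(2) unfolding walk_betw_def
          by (intro exI[of _ 0] exI[of _ 0]) auto
      next
        case (Cons b q)
        then have ab: "x = a" "E a b" "walk_betw E b p y"
          using Cons.prems unfolding walk_betw_def by auto
        obtain i j where ij: "(parent ^^ i) b = (parent ^^ j) y" using Cons.IH[OF ab(3)] by blast
        consider "b = parent a" | "a = parent b" using ab(2) adjacent_iff by blast
        then show ?thesis
        proof cases
          case 1
          then have "(parent ^^ Suc i) x = (parent ^^ j) y" using ij ab(1) by (simp add: funpow_swap1)
          then show ?thesis by blast
        next
          case 2
          have "parent ((parent ^^ i) b) = parent ((parent ^^ j) y)" using ij by simp
          then have "(parent ^^ i) x = (parent ^^ Suc j) y" using 2 ab(1) by (simp add: funpow_swap1)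
          then show ?thesis by blast
        qed
      qed
    qed
  qed
qed

lemma level_adjacent: "E x y \<Longrightarrow> \<bar>lv x - lv y\<bar> = 1"
  using adjacent_iff level_parent by (metis abs_minus_commute abs_one add_diff_cancel_left')

lemma level_dist: "lv y - lv x \<le> int (graph_dist E x y)"
proof (induction "graph_dist E x y" arbitrary: x)
  case 0
  then show ?case using graph_dist_eq_0[OF conn, of x y] by auto
next
  case (Suc n)
  then obtain z where "E x z" "graph_dist E z y = n" using graph_dist_next[OF conn] by metis
  then show ?case using Suc(1)[of z] level_adjacent[of x z] Suc(2) by simp
qed

text \<open>A path that gains a level in every step consists of parents.\<close>

lemma lies_below_iff: "lies_below E g N x y \<longleftrightarrow> (\<exists>k. (parent ^^ k) x = y)"
proof
  assume "lies_below E g N x y"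
  then have "lv y = lv x + int (graph_dist E x y)" unfolding lies_below_def by simp
  then have "(parent ^^ graph_dist E x y) x = y"
  proof (induction "graph_dist E x y" arbitrary: x)
    case 0
    then show ?case using graph_dist_eq_0[OF conn, of x y] by simp
  next
    case (Suc n)
    then obtain z where z: "E x z" "graph_dist E z y = n" using graph_dist_next[OF conn] by metis
    have lz: "lv z = lv x + 1" "lv y = lv z + int (graph_dist E z y)"
      using level_adjacent[OF z(1)] level_dist[of y z] Suc(2,3) z(2) by auto
    then have "z = parent x" using z(1) adjacent_iff[of x z] level_parent[of z] by auto
    then show ?case using Suc(1)[of z] lz(2) z(2) Suc(2)
      by (simp add: funpow_swap1 flip: Suc(2))
  qed
  then show "\<exists>k. (parent ^^ k) x = y" by blast
next
  assume "\<exists>k. (parent ^^ k) x = y"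
  then obtain k where k: "(parent ^^ k) x = y" ..
  have anc: "graph_dist E x ((parent ^^ k) x) \<le> k \<and> lv ((parent ^^ k) x) = lv x + int k" for x
  proof (induction k arbitrary: x)
    case (Suc k)
    then show ?case using graph_dist_step[OF conn parent_adjacent, of x] level_parent[of x]
      by (simp add: funpow_swap1) (metis Suc_le_mono le_trans)
  qed simp
  then show "lies_below E g N x y"
    using k level_dist[of y x] anc[of x] unfolding lies_below_def by auto
qed

end

section \<open>A dyadic filtration of the tree by Calderon-Zygmund-like sets\<close>

locale weighted_sets =
  fixes w :: "'v \<Rightarrow> real" and \<R> :: "'v set set"
  assumes w_pos: "0 < w x" and countable_vertices: "countable (UNIV :: 'v set)"
    and finite_sets: "R \<in> \<R> \<Longrightarrow> finite R" and nonempty_sets: "R \<in> \<R> \<Longrightarrow> R \<noteq> {}"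

text \<open>
  The same constant bounds the growth of a class in one step and the loss when a class is replaced
  by a member of the given family. Later estimates depend on the filtration through it only.
\<close>

locale dyadic_filtration = weighted_sets w \<R>
  for w :: "'v \<Rightarrow> real" and \<R> :: "'v set set" +
  fixes Q :: "nat \<Rightarrow> 'v \<Rightarrow> 'v set" and C :: real
  assumes finite_Q: "finite (Q t v)" and Q_self: "v \<in> Q t v" and Q_0: "Q 0 v = {v}"
    and Q_eq: "u \<in> Q t v \<Longrightarrow> Q t u = Q t v"
    and Q_Suc: "Q t v \<subseteq> Q (Suc t) v"
    and Q_doubling: "sum w (Q (Suc t) v) \<le> C * sum w (Q t v)"
    and Q_unbounded: "filterlim (\<lambda>t. sum w (Q t v)) at_top sequentially"
    and Q_enlarge: "\<exists>R\<in>\<R>. Q t v \<subseteq> R \<and> sum w R \<le> C * sum w (Q t v)"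

text \<open>The largest power of two not exceeding \<open>t\<close>, except that the value at \<open>0\<close> is \<open>1\<close>.\<close>

primrec pow2_below :: "nat \<Rightarrow> nat" where
  "pow2_below 0 = 1"
| "pow2_below (Suc t) = (if Suc t = 2 * pow2_below t then Suc t else pow2_below t)"

lemma pow2_below_bounds: "t \<ge> 1 \<Longrightarrow> pow2_below t \<le> t \<and> t < 2 * pow2_below t"
  by (induction t) (auto simp: le_Suc_eq)

lemma pow2_below_pos: "pow2_below t \<ge> 1"
  by (induction t) auto

lemma pow2_below_pow2: "pow2_below (2 ^ n) = 2 ^ n"
proof (induction n)
  case 0
  then show ?case by simp
next
  case (Suc n)
  have stay: "pow2_below (2 ^ n + i) = 2 ^ n" if "i < 2 ^ n" for i
    using that by (induction i) (use Suc in auto)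
  have *: "pow2_below (2 ^ n + (2 ^ n - 1)) = 2 ^ n" by (rule stay) simp
  have "2 ^ Suc n = Suc (2 ^ n + (2 ^ n - 1))" by simp
  then show ?case using * by (metis pow2_below.simps(2) power_Suc)
qed

text \<open>
  This is \<open>\<lceil>l / h\<rceil>\<close>: the band with number \<open>q\<close> consists of the levels \<open>l\<close> with \<open>q h - h < l \<le> q h\<close>.
\<close>

definition band :: "nat \<Rightarrow> int \<Rightarrow> int" where
  "band h l = - ((- l) div int h)"

text \<open>
  At time \<open>t\<close> the levels are cut into bands of length \<open>h\<close>, the largest power of two not
  exceeding \<open>t\<close>, and two vertices of a band are equivalent if they have the same ancestor at level
  \<open>roof t l\<close>. When \<open>h\<close> doubles, a band with odd number merges with the next higher one. Its roof
  is \<open>h\<close> lower when \<open>t = h\<close>, so it rises at double speed in order that both roofs agree at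
  the time of the merger. This way the mass of a class grows by a bounded factor in every step.
\<close>

definition roof :: "nat \<Rightarrow> int \<Rightarrow> int" where
  "roof t l = (if t = 0 then l
     else let h = int (pow2_below t); q = band (pow2_below t) l
          in if even q then q * h + int t else q * h + 2 * int t - h)"

lemma band_iff:
  assumes "h \<ge> 1" shows "band h l = q \<longleftrightarrow> q * int h - int h < l \<and> l \<le> q * int h"
proof -
  have "band h l = q \<longleftrightarrow> (- l) div int h = - q" unfolding band_def by auto
  also have "\<dots> \<longleftrightarrow> - q * int h \<le> - l \<and> - l < (- q + 1) * int h"
  proof
    assume *: "- l div int h = - q"
    have "- l = int h * (- q) + (- l) mod int h" using * by (metis mult_div_mod_eq)
    moreover have "0 \<le> (- l) mod int h" "(- l) mod int h < int h" using assms by auto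
    ultimately show "- q * int h \<le> - l \<and> - l < (- q + 1) * int h" by (auto simp: algebra_simps)
  next
    assume *: "- q * int h \<le> - l \<and> - l < (- q + 1) * int h"
    show "- l div int h = - q"
      by (rule int_div_pos_eq[of _ _ _ "- l + q * int h"]) (use * in \<open>auto simp: algebra_simps\<close>)
  qed
  finally show ?thesis by (auto simp: algebra_simps)
qed

lemma band_double: "band (2 * h) l = - ((- band h l) div 2)"
  using zdiv_zmult2_eq[of "2" "- l" "int h"] unfolding band_def by (simp add: mult.commute)

lemma roof_0: "roof 0 l = l" by (simp add: roof_def)

lemma roof_step: "roof t l + 1 \<le> roof (Suc t) l \<and> roof (Suc t) l \<le> roof t l + 2"
proof (cases "t = 0")
  case True
  have "band 1 l = l" by (simp add: band_def)
  then show ?thesis using True by (simp add: roof_def)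
next
  case False
  define h where "h = pow2_below t"
  define q where "q = band h l"
  show ?thesis
  proof (cases "Suc t = 2 * h")
    case True
    then have h': "pow2_below (Suc t) = 2 * h" unfolding h_def by (metis pow2_below.simps(2))
    have t: "int t = 2 * int h - 1" using True by linarith
    define q' where "q' = band (2 * h) l"
    have q': "q' = - ((- q) div 2)" unfolding q'_def q_def by (rule band_double)
    have new: "roof (Suc t) l = q' * (2 * int h) + 2 * int h"
      unfolding roof_def h' Let_def using True t by (simp add: q'_def)
    show ?thesis
    proof (cases "even q")
      case True
      then have "q = 2 * q'" unfolding q' by auto
      moreover have "roof t l = q * int h + int t"
        using False True by (simp add: roof_def h_def q_def Let_def)
      ultimately show ?thesis using new t by (simp add: algebra_simps)
    next
      case odd: False
      then have "q = 2 * q' - 1" unfolding q' by presburger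
      then have "q * int h = q' * (2 * int h) - int h"
        by (rule ssubst) (simp add: algebra_simps)
      moreover have "roof t l = q * int h + 2 * int t - int h"
        using False odd by (simp add: roof_def h_def q_def Let_def)
      ultimately show ?thesis using new t by (simp add: algebra_simps)
    qed
  next
    case stay: False
    then show ?thesis using False by (simp add: roof_def h_def Let_def)
  qed
qed

lemma roof_ge: "roof t l \<ge> l + int t"
proof (induction t)
  case (Suc t)
  then show ?case using roof_step[of t l] by simp
qed (simp add: roof_0)

lemma roof_band_cong: "band (pow2_below t) l = band (pow2_below t) l' \<Longrightarrow> roof t l = roof t l'"
  by (cases "t = 0") (auto simp: roof_def Let_def band_def)

lemma band_Suc_cong:
  "band (pow2_below t) l = band (pow2_below t) l' \<Longrightarrow>
   band (pow2_below (Suc t)) l = band (pow2_below (Suc t)) l'"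
  by (auto simp: band_double)

lemma roof_band_bounds:
  assumes "t \<ge> 1"
  defines "h \<equiv> int (pow2_below t)"
  shows "h \<le> roof t l - band (pow2_below t) l * h \<and> roof t l - band (pow2_below t) l * h < 3 * h"
  using pow2_below_bounds[OF assms(1)] assms by (auto simp: roof_def Let_def)

context level_tree
begin

definition weight :: "'v \<Rightarrow> real" where "weight x = real m powi lev x"

lemma weight_pos: "0 < weight x" using m2 unfolding weight_def by simp

lemma le_power_m: "real n \<le> real m ^ n"
proof -
  have "n < 2 ^ n" by (rule less_exp)
  also have "\<dots> \<le> m ^ n" by (rule power_mono) (use m2 in auto)
  finally show ?thesis by (metis less_imp_le of_nat_le_iff of_nat_power)
qed

definition descendants :: "'v \<Rightarrow> nat \<Rightarrow> 'v set" where
  "descendants x k = {y. (parent ^^ k) y = x}"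

lemma lev_ancestor: "lev ((parent ^^ k) x) = lev x + int k"
  by (induction k) (auto simp: lev_parent)

lemma descendants_Suc: "descendants x (Suc k) = (\<Union>y\<in>{y. parent y = x}. descendants y k)"
  by (auto simp: descendants_def)

lemma finite_children: "finite {y. parent y = x}"
  using card_children[of x] m2 by (metis card.infinite not_numeral_le_zero)

lemma finite_descendants: "finite (descendants x k)"
proof (induction k arbitrary: x)
  case 0
  then show ?case by (simp add: descendants_def)
next
  case (Suc k)
  then show ?case unfolding descendants_Suc using finite_children by blast
qed

text \<open>The weight \<open>m\<^sup>l\<close> of a vertex is exactly the mass of any one generation of its descendants.\<close>

lemma weight_descendants: "sum weight (descendants x k) = weight x"
proof (induction k arbitrary: x)
  case 0
  then show ?case by (simp add: descendants_def)
next
  case (Suc k)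
  have "sum weight (descendants x (Suc k)) = (\<Sum>y\<in>{y. parent y = x}. sum weight (descendants y k))"
    unfolding descendants_Suc
    by (rule sum.UNION_disjoint) (use finite_children finite_descendants in \<open>auto simp: descendants_def\<close>)
  also have "\<dots> = (\<Sum>y\<in>{y. parent y = x}. weight x / real m)"
  proof (rule sum.cong)
    fix y assume "y \<in> {y. parent y = x}"
    then have "lev x = lev y + 1" using lev_parent[of y] by simp
    then show "sum weight (descendants y k) = weight x / real m"
      using Suc m2 by (simp add: weight_def power_int_add)
  qed simp
  also have "\<dots> = weight x" using card_children m2 by simp
  finally show ?case .
qed

lemma descendants_disjoint: "k \<noteq> k' \<Longrightarrow> descendants x k \<inter> descendants x k' = {}"
  unfolding descendants_def by (auto, metis lev_ancestor add_left_cancel of_nat_eq_iff)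

lemma weight_generations:
  "finite K \<Longrightarrow> sum weight (\<Union>k\<in>K. descendants x k) = real (card K) * weight x"
  by (subst sum.UNION_disjoint)
     (use finite_descendants descendants_disjoint in \<open>auto simp: weight_descendants\<close>)

definition ancestor_at :: "'v \<Rightarrow> int \<Rightarrow> 'v" where
  "ancestor_at x l = (parent ^^ nat (l - lev x)) x"

lemma ancestor_at_lev: "ancestor_at x (lev x) = x"
  by (simp add: ancestor_at_def)

lemma lev_ancestor_at: "lev x \<le> l \<Longrightarrow> lev (ancestor_at x l) = l"
  by (simp add: ancestor_at_def lev_ancestor)

lemma ancestor_at_trans: "lev x \<le> l \<Longrightarrow> l \<le> l' \<Longrightarrow> ancestor_at x l' = ancestor_at (ancestor_at x l) l'"
proof -
  assume a: "lev x \<le> l" "l \<le> l'"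
  then have "nat (l' - lev x) = nat (l' - l) + nat (l - lev x)" by linarith
  then show ?thesis using lev_ancestor_at[OF a(1)]
    unfolding ancestor_at_def by (simp add: funpow_add)
qed

lemma ancestor_at_iff: "lev x \<le> l \<Longrightarrow> ancestor_at x l = y \<longleftrightarrow> lev y = l \<and> (\<exists>k. (parent ^^ k) x = y)"
  using lev_ancestor lev_ancestor_at[of x l] unfolding ancestor_at_def
  by (metis add_diff_cancel_left' nat_int)

text \<open>
  The offset \<open>s\<close> shifts the bands. For a fixed offset the classes never cross one particular level,
  so it has to be adapted when a given finite set is to be covered by a single class.
\<close>

definition dyadic :: "int \<Rightarrow> nat \<Rightarrow> 'v \<Rightarrow> 'v set" where
  "dyadic s t v = {u. band (pow2_below t) (lev u - s) = band (pow2_below t) (lev v - s) \<and>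
     ancestor_at u (roof t (lev u - s) + s) = ancestor_at v (roof t (lev v - s) + s)}"

text \<open>
  A class is a block of \<open>h\<close> consecutive generations of descendants of one vertex at the level of the
  roof. Its mass is therefore \<open>h\<close> times the weight of that vertex.
\<close>

lemma dyadic_generations:
  fixes s :: int and t :: nat and v :: 'v
  defines "h \<equiv> int (pow2_below t)"
  defines "a \<equiv> roof t (lev v - s) - band (pow2_below t) (lev v - s) * h"
  defines "x \<equiv> ancestor_at v (roof t (lev v - s) + s)"
  shows "dyadic s t v = (\<Union>k\<in>nat ` {a..<a + h}. descendants x k)" "a \<ge> 0"
proof -
  let ?q = "band (pow2_below t) (lev v - s)"
  have h1: "pow2_below t \<ge> 1" by (rule pow2_below_pos)
  show a0: "a \<ge> 0"
  proof (cases "t = 0")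
    case True
    then show ?thesis by (simp add: a_def h_def roof_def band_def)
  next
    case False
    then show ?thesis using roof_band_bounds[of t "lev v - s"] h1 unfolding a_def h_def by linarith
  qed
  have lx: "lev x = roof t (lev v - s) + s"
    unfolding x_def by (rule lev_ancestor_at) (use roof_ge[where t=t and l="lev v - s"] in linarith)
  show "dyadic s t v = (\<Union>k\<in>nat ` {a..<a + h}. descendants x k)"
  proof (intro set_eqI iffI)
    fix u assume "u \<in> dyadic s t v"
    then have u: "band (pow2_below t) (lev u - s) = ?q"
      "ancestor_at u (roof t (lev u - s) + s) = x" by (auto simp: dyadic_def x_def)
    have r: "roof t (lev u - s) = roof t (lev v - s)" by (rule roof_band_cong[OF u(1)])
    have "lev u - s \<le> roof t (lev u - s)" using roof_ge[where t=t and l="lev u - s"] by linarith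
    then obtain k where k: "(parent ^^ k) u = x"
      using u(2) ancestor_at_iff[of u "roof t (lev u - s) + s" x] by auto
    have "lev x = lev u + int k" using k lev_ancestor by metis
    moreover have "?q * h - h < lev u - s \<and> lev u - s \<le> ?q * h"
      using u(1) band_iff[OF h1] unfolding h_def by blast
    ultimately have "int k \<in> {a..<a + h}" using lx unfolding a_def by auto
    then have "k \<in> nat ` {a..<a + h}" by force
    then show "u \<in> (\<Union>k\<in>nat ` {a..<a + h}. descendants x k)"
      using k by (auto simp: descendants_def)
  next
    fix u assume "u \<in> (\<Union>k\<in>nat ` {a..<a + h}. descendants x k)"
    then obtain i where i: "a \<le> i" "i < a + h" "(parent ^^ nat i) u = x"
      by (auto simp: descendants_def)
    have l: "lev x = lev u + i" using i a0 lev_ancestor[of "nat i" u] by simp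
    have "?q * h - h < lev u - s \<and> lev u - s \<le> ?q * h" using l lx i unfolding a_def by linarith
    then have b: "band (pow2_below t) (lev u - s) = ?q" using band_iff[OF h1] unfolding h_def by blast
    have r: "roof t (lev u - s) = roof t (lev v - s)" by (rule roof_band_cong[OF b])
    have "ancestor_at u (roof t (lev v - s) + s) = x"
      using ancestor_at_iff[of u "roof t (lev v - s) + s" x] i l lx a0 by auto
    then show "u \<in> dyadic s t v" using b r by (simp add: dyadic_def x_def)
  qed
qed

lemma weight_dyadic:
  "sum weight (dyadic s t v) =
     real (pow2_below t) * weight (ancestor_at v (roof t (lev v - s) + s))"
proof -
  let ?h = "int (pow2_below t)"
  let ?a = "roof t (lev v - s) - band (pow2_below t) (lev v - s) * ?h"
  have "card (nat ` {?a..<?a + ?h}) = pow2_below t"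
    by (subst card_image) (use dyadic_generations(2)[where s=s and t=t and v=v] in \<open>auto simp: inj_on_def\<close>)
  then show ?thesis
    unfolding dyadic_generations(1)[where s=s and t=t and v=v]
    by (subst weight_generations[of "nat ` {?a..<?a + ?h}"]) auto
qed

lemma weight_roof:
  "weight (ancestor_at v (roof t (lev v - s) + s)) = real m powi (roof t (lev v - s) + s)"
  using lev_ancestor_at[of v "roof t (lev v - s) + s"] roof_ge[where t=t and l="lev v - s"]
  by (simp add: weight_def)

lemma countable_tree: "countable (UNIV :: 'v set)"
proof -
  fix o' :: 'v
  have "UNIV = (\<Union>i j. descendants ((parent ^^ j) o') i)"
    using common_ancestor by (fastforce simp: descendants_def)
  moreover have "countable (\<Union>i j. descendants ((parent ^^ j) o') i)"
    by (intro countable_UN countableI_type countable_finite finite_descendants)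
  ultimately show ?thesis by simp
qed

text \<open>The Calderon-Zygmund sets that are not single vertices, as unions of generations.\<close>

definition trapezoid :: "'v \<Rightarrow> int \<Rightarrow> 'v set" where
  "trapezoid x h = (\<Union>k\<in>{k. real_of_int h / 2 \<le> real k \<and> int k < 4 * h}. descendants x k)"

lemma trapezoid_generations: "{k. real_of_int h / 2 \<le> real k \<and> int k < 4 * h} \<subseteq> {..<nat (4 * h)}"
  by auto

lemma finite_trapezoid: "finite (trapezoid x h)"
  unfolding trapezoid_def using finite_subset[OF trapezoid_generations] finite_descendants by blast

lemma weight_trapezoid: "h \<ge> 0 \<Longrightarrow> sum weight (trapezoid x h) \<le> 4 * of_int h * weight x"
proof -
  assume "h \<ge> 0"
  let ?K = "{k. real_of_int h / 2 \<le> real k \<and> int k < 4 * h}"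
  have "finite ?K" by (rule finite_subset[OF trapezoid_generations]) simp
  then have "sum weight (trapezoid x h) = real (card ?K) * weight x"
    unfolding trapezoid_def by (rule weight_generations)
  moreover have "card ?K \<le> nat (4 * h)"
    using card_mono[OF _ trapezoid_generations[of h]] by simp
  ultimately show ?thesis using \<open>h \<ge> 0\<close> weight_pos[of x]
    by (simp add: mult_right_mono nat_le_iff)
qed

text \<open>
  By \<open>roof_band_bounds\<close> the generations of a class lie between \<open>h\<close> and \<open>4 h\<close>, so a single
  trapezoid of parameter \<open>h\<close> contains it; it has fewer than \<open>4 h\<close> generations instead of \<open>h\<close>.
\<close>

lemma dyadic_subset_trapezoid:
  assumes "t \<ge> 1"
  shows "dyadic s t v \<subseteq> trapezoid (ancestor_at v (roof t (lev v - s) + s)) (int (pow2_below t))"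
proof -
  let ?h = "int (pow2_below t)"
  let ?a = "roof t (lev v - s) - band (pow2_below t) (lev v - s) * ?h"
  have b: "?h \<le> ?a" "?a < 3 * ?h" using roof_band_bounds[OF assms] by auto
  have "nat ` {?a..<?a + ?h} \<subseteq> {k. real_of_int ?h / 2 \<le> real k \<and> int k < 4 * ?h}"
    using b pow2_below_pos[of t] by auto
  then show ?thesis
    unfolding dyadic_generations(1)[where s=s and t=t and v=v] trapezoid_def by blast
qed

lemma dyadic_self: "v \<in> dyadic s t v" by (simp add: dyadic_def)

text \<open>
  In one step the roof rises by at most two levels and the length of the bands at most doubles,
  which gives the constant \<open>2 m\<^sup>2\<close>.
\<close>

lemma dyadic_filtration_tree:
  assumes "\<And>x. {x} \<in> \<R>" "\<And>x h. h \<ge> 1 \<Longrightarrow> trapezoid x h \<in> \<R>"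
    and "\<And>R. R \<in> \<R> \<Longrightarrow> finite R" "\<And>R. R \<in> \<R> \<Longrightarrow> R \<noteq> {}"
  shows "dyadic_filtration weight \<R> (dyadic s) (2 * real m ^ 2)"
proof
  fix t u v x
  show "0 < weight x" by (rule weight_pos)
  show "countable (UNIV :: 'v set)" by (rule countable_tree)
  show "finite (dyadic s t v)"
    unfolding dyadic_generations(1)[where s=s and t=t and v=v] using finite_descendants by blast
  show "v \<in> dyadic s t v" by (rule dyadic_self)
  show dyadic_0: "dyadic s 0 v = {v}" for v
    by (auto simp: dyadic_def roof_0 ancestor_at_lev)
  show "u \<in> dyadic s t v \<Longrightarrow> dyadic s t u = dyadic s t v"
    by (auto simp: dyadic_def)
  show "dyadic s t v \<subseteq> dyadic s (Suc t) v"
  proof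
    fix u assume "u \<in> dyadic s t v"
    then have u: "band (pow2_below t) (lev u - s) = band (pow2_below t) (lev v - s)"
      "ancestor_at u (roof t (lev u - s) + s) = ancestor_at v (roof t (lev v - s) + s)"
      by (auto simp: dyadic_def)
    have b: "band (pow2_below (Suc t)) (lev u - s) = band (pow2_below (Suc t)) (lev v - s)"
      by (rule band_Suc_cong[OF u(1)])
    have up: "ancestor_at y (roof (Suc t) (lev y - s) + s) =
        ancestor_at (ancestor_at y (roof t (lev y - s) + s)) (roof (Suc t) (lev y - s) + s)" for y
      by (rule ancestor_at_trans)
         (use roof_ge[where t=t and l="lev y - s"] roof_step[of t "lev y - s"] in linarith)+
    show "u \<in> dyadic s (Suc t) v"
      using b up[of u] up[of v] u(2) roof_band_cong[OF b] by (simp add: dyadic_def)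
  qed
  have mm: "real m \<ge> 1" using m2 by simp
  show "sum weight (dyadic s (Suc t) v) \<le> 2 * (real m)\<^sup>2 * sum weight (dyadic s t v)"
  proof -
    let ?r = "roof t (lev v - s) + s"
    have "real m powi (roof (Suc t) (lev v - s) + s) \<le> real m powi (?r + 2)"
      by (rule power_int_increasing) (use roof_step[of t "lev v - s"] mm in auto)
    also have "\<dots> = real m ^ 2 * real m powi ?r"
      using m2 by (subst power_int_add) auto
    finally have "real (pow2_below (Suc t)) * real m powi (roof (Suc t) (lev v - s) + s)
        \<le> (2 * real (pow2_below t)) * (real m ^ 2 * real m powi ?r)"
      by (intro mult_mono) auto
    then show ?thesis unfolding weight_dyadic weight_roof by (simp add: mult_ac)
  qed
  show "filterlim (\<lambda>t. sum weight (dyadic s t v)) at_top sequentially"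
  proof (rule filterlim_at_top_mono)
    show "filterlim (\<lambda>t. weight v * real t) at_top sequentially"
      by (rule filterlim_tendsto_pos_mult_at_top[OF tendsto_const weight_pos filterlim_real_sequentially])
    have "weight v * real t \<le> sum weight (dyadic s t v)" for t
    proof -
      have "weight v * real t \<le> weight v * real m ^ t"
        by (intro mult_left_mono le_power_m) (use weight_pos[of v] in auto)
      also have "\<dots> = real m powi (lev v + int t)" using m2 by (simp add: weight_def power_int_add)
      also have "\<dots> \<le> real m powi (roof t (lev v - s) + s)"
        by (rule power_int_increasing) (use roof_ge[where t=t and l="lev v - s"] mm in auto)
      also have "\<dots> \<le> real (pow2_below t) * real m powi (roof t (lev v - s) + s)"
        using pow2_below_pos[of t] mult_right_mono[of 1 "real (pow2_below t)" "real m powi (roof t (lev v - s) + s)"] by simp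
      finally show ?thesis unfolding weight_dyadic weight_roof .
    qed
    then show "eventually (\<lambda>t. weight v * real t \<le> sum weight (dyadic s t v)) sequentially" by simp
  qed
  show "\<exists>R\<in>\<R>. dyadic s t v \<subseteq> R \<and> sum weight R \<le> 2 * (real m)\<^sup>2 * sum weight (dyadic s t v)"
  proof (cases "t = 0")
    case True
    have "1 \<le> 2 * (real m)\<^sup>2" using one_le_power[OF mm, of 2] by linarith
    then show ?thesis using True assms(1)[of v] weight_pos[of v]
      by (intro bexI[of _ "{v}"]) (auto simp: dyadic_0 mult_le_cancel_right1)
  next
    case False
    let ?x = "ancestor_at v (roof t (lev v - s) + s)"
    have "4 \<le> 2 * (real m)\<^sup>2" using power_mono[of 2 "real m" 2] m2 by simp
    then have "sum weight (trapezoid ?x (int (pow2_below t))) \<le> 2 * (real m)\<^sup>2 * sum weight (dyadic s t v)"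
      unfolding weight_dyadic using weight_pos[of ?x]
      by (intro order_trans[OF weight_trapezoid]) (auto simp: mult_right_mono mult.assoc[symmetric])
    then show ?thesis using False dyadic_subset_trapezoid[of t s v] pow2_below_pos[of t]
      by (intro bexI[of _ "trapezoid ?x (int (pow2_below t))"] conjI assms(2)) auto
  qed
qed (use assms in auto)

lemma common_ancestor_finite:
  assumes "finite F" shows "\<exists>n x. \<forall>u\<in>F. lev u \<le> n \<and> ancestor_at u n = x"
  using assms
proof induction
  case empty
  then show ?case by simp
next
  case (insert v F)
  then obtain n x where nx: "\<forall>u\<in>F. lev u \<le> n \<and> ancestor_at u n = x" by blast
  obtain i j where ij: "(parent ^^ i) v = (parent ^^ j) x" using common_ancestor by blast
  define y where "y = (parent ^^ j) x"
  have "lev u \<le> lev y \<and> ancestor_at u (lev y) = y" if "u \<in> insert v F" for u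
  proof -
    have "\<exists>k. (parent ^^ k) u = y"
    proof (cases "u = v")
      case True then show ?thesis using ij y_def by blast
    next
      case False
      then have "lev u \<le> n" "ancestor_at u n = x" using nx that by auto
      then obtain k where "(parent ^^ k) u = x" using ancestor_at_iff by blast
      then have "(parent ^^ (j + k)) u = y" by (simp add: funpow_add y_def)
      then show ?thesis by blast
    qed
    then show ?thesis using ancestor_at_iff[of u "lev y" y] lev_ancestor by force
  qed
  then show ?case by blast
qed

text \<open>
  The offset is the top level \<open>s\<close> of the set, so that a long enough band with number \<open>0\<close>, that is
  the levels in \<open>(s - h, s]\<close>, contains it.
\<close>

lemma finite_subset_dyadic:
  assumes "finite F" shows "\<exists>s t v. F \<subseteq> dyadic s t v"
proof (cases "F = {}")
  case False
  obtain n x where nx: "\<forall>u\<in>F. lev u \<le> n \<and> ancestor_at u n = x"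
    using common_ancestor_finite[OF assms] by blast
  define s where "s = Max (lev ` F)"
  define p where "p = Min (lev ` F)"
  have lev: "p \<le> lev u" "lev u \<le> s" if "u \<in> F" for u
    using that assms unfolding s_def p_def by auto
  obtain k :: nat where k: "nat (max (s - p) (n - s)) < 2 ^ k"
    using less_exp by blast
  have big: "s - p < int (2 ^ k)" "n - s < int (2 ^ k)" using k by (simp_all add: nat_less_iff)
  have b: "band (2 ^ k) (lev u - s) = 0" if "u \<in> F" for u
    using band_iff[of "2 ^ k" "lev u - s" 0] lev[OF that] big by auto
  have r: "roof (2 ^ k) (lev u - s) = int (2 ^ k)" if "u \<in> F" for u
    using b[OF that] by (simp add: roof_def pow2_below_pow2)
  have a: "ancestor_at u (int (2 ^ k) + s) = ancestor_at x (int (2 ^ k) + s)" if "u \<in> F" for u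
    using ancestor_at_trans[of u n "int (2 ^ k) + s"] nx that big by simp
  obtain v where "v \<in> F" using False by blast
  then have "F \<subseteq> dyadic s (2 ^ k) v"
    using b r a by (auto simp: dyadic_def pow2_below_pow2)
  then show ?thesis by blast
qed auto

lemma large_weights: "filterlim (\<lambda>n. weight ((parent ^^ n) x)) at_top sequentially"
proof (rule filterlim_at_top_mono)
  show "filterlim (\<lambda>n. weight x * real n) at_top sequentially"
    by (rule filterlim_tendsto_pos_mult_at_top[OF tendsto_const weight_pos filterlim_real_sequentially])
  have "weight x * real n \<le> weight ((parent ^^ n) x)" for n
  proof -
    have "weight x * real n \<le> weight x * real m ^ n"
      by (intro mult_left_mono le_power_m) (use weight_pos[of x] in auto)
    also have "\<dots> = weight ((parent ^^ n) x)"
      using m2 by (simp add: weight_def lev_ancestor power_int_add)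
    finally show ?thesis .
  qed
  then show "eventually (\<lambda>n. weight x * real n \<le> weight ((parent ^^ n) x)) sequentially" by simp
qed

end

context labelled_tree
begin

lemma trapezoid_eq:
  "trapezoid x h = {y. lies_below E g N y x \<and> real_of_int h / 2 \<le> real_of_int (lv x - lv y) \<and>
     lv x - lv y < 4 * h}"
proof (intro set_eqI iffI)
  fix y assume "y \<in> trapezoid x h"
  then obtain k where "real_of_int h / 2 \<le> real k" "int k < 4 * h" "(parent ^^ k) y = x"
    by (auto simp: trapezoid_def descendants_def)
  then show "y \<in> {y. lies_below E g N y x \<and> real_of_int h / 2 \<le> real_of_int (lv x - lv y) \<and>
     lv x - lv y < 4 * h}"
    using lev_ancestor[of k y] lies_below_iff[of y x] by auto
next
  fix y assume y: "y \<in> {y. lies_below E g N y x \<and> real_of_int h / 2 \<le> real_of_int (lv x - lv y) \<and>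
     lv x - lv y < 4 * h}"
  then obtain k where "(parent ^^ k) y = x" using lies_below_iff by blast
  then show "y \<in> trapezoid x h"
    using y lev_ancestor[of k y] by (auto simp: trapezoid_def descendants_def)
qed

lemma CZ_sets_eq: "CZ_sets E g N = {R. R \<noteq> {} \<and> ((\<exists>x. R = {x}) \<or> (\<exists>x h. h \<ge> 1 \<and> R = trapezoid x h))}"
  unfolding CZ_sets_def trapezoid_eq ..

lemma trapezoid_nonempty:
  assumes "h \<ge> 1" shows "trapezoid x h \<noteq> {}"
proof -
  have "descendants x (nat h) \<noteq> {}"
    using weight_descendants[of x "nat h"] weight_pos[of x] by auto
  moreover have "nat h \<in> {k. real_of_int h / 2 \<le> real k \<and> int k < 4 * h}" using assms by auto
  ultimately show ?thesis unfolding trapezoid_def by blast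
qed

lemma dyadic_filtration_CZ: "dyadic_filtration weight (CZ_sets E g N) (dyadic s) (2 * real m ^ 2)"
  by (rule dyadic_filtration_tree)
     (use trapezoid_nonempty finite_trapezoid in \<open>auto simp: CZ_sets_eq\<close>)

lemma tree_measure_eq: "tree_measure m E g N = point_measure UNIV (\<lambda>x. ennreal (weight x))"
  by (simp add: tree_measure_def weight_def)

end

section \<open>Real interpolation\<close>

lemma ennpowr_ennreal: "0 \<le> x \<Longrightarrow> ennpowr (ennreal x) p = ennreal (x powr p)"
  by (simp add: ennpowr_def)

lemma ennpowr_top [simp]: "ennpowr top p = top"
  by (simp add: ennpowr_def)

lemma ennpowr_mono: "0 \<le> p \<Longrightarrow> x \<le> y \<Longrightarrow> ennpowr x p \<le> ennpowr y p"
  by (cases x; cases y) (auto simp: ennpowr_def powr_mono2 top_unique)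

lemma ennpowr_mult:
  assumes "0 \<le> c" "0 < p" shows "ennpowr (ennreal c * x) p = ennreal (c powr p) * ennpowr x p"
proof (cases x)
  case (real y)
  then show ?thesis using assms
    by (simp add: ennreal_mult[symmetric] ennpowr_ennreal powr_mult)
next
  case top
  then show ?thesis using assms ennpowr_ennreal[of 0 p]
    by (cases "c = 0") (auto simp: ennreal_mult_top)
qed

lemma ennpowr_inverse: "0 < p \<Longrightarrow> ennpowr (ennpowr x p) (1 / p) = x"
  by (cases x) (auto simp: ennpowr_def powr_powr)

lemma ennpowr_inverse': "0 < p \<Longrightarrow> ennpowr (ennpowr x (1 / p)) p = x"
  using ennpowr_inverse[of "1 / p" x] by simp

lemma ennpowr_borel_measurable [measurable]:
  assumes [measurable]: "f \<in> borel_measurable M" shows "(\<lambda>x. ennpowr (f x) p) \<in> borel_measurable M"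
  unfolding ennpowr_def infinity_ennreal_def by measurable

lemma nn_integral_powr_Ioo:
  fixes a Y :: real
  assumes "0 < a" "0 \<le> Y"
  shows "(\<integral>\<^sup>+t\<in>{0<..<Y}. ennreal (t powr (a - 1)) \<partial>lborel) = ennreal (Y powr a / a)"
proof -
  have "((\<lambda>t. t powr (a - 1)) has_integral (Y powr (a - 1 + 1) / (a - 1 + 1))) {0..Y}"
    by (rule has_integral_powr_from_0) (use assms in auto)
  then have "((\<lambda>t. t powr (a - 1)) has_integral (Y powr a / a)) {0<..<Y}"
    by (simp add: has_integral_Icc_iff_Ioo)
  then show ?thesis by (intro nn_integral_has_integral_lebesgue') auto
qed

lemma geometric_sum_powr:
  fixes a x :: real
  assumes "0 < a" "0 \<le> x" "finite S" "S \<noteq> {}"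
  shows "(\<Sum>i\<in>S. (x * 2 ^ i) powr a) \<le> (x * 2 ^ Max S) powr a / (1 - 2 powr - a)"
proof -
  let ?b = "2 powr a :: real"
  define c where "c = 1 / (1 - 2 powr - a :: real)"
  have b1: "2 powr - a < (1 :: real)" using assms powr_less_mono[of "- a" 0 2] by simp
  then have "c = 1 + c * 2 powr - a" unfolding c_def using b1 assms(1) by (simp add: divide_simps)
  then have c: "c = 1 + c / ?b" by (simp add: powr_minus divide_inverse)
  have "c \<ge> 0" using b1 unfolding c_def by simp
  then have c1: "c \<ge> 1" using c divide_nonneg_nonneg[of c ?b] powr_ge_zero[of 2 a] by linarith
  have "(\<Sum>i\<le>n. (x * 2 ^ i) powr a) \<le> (x * 2 ^ n) powr a * c" for n
  proof (induction n)
    case 0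
    show ?case using c1 by (simp add: mult_le_cancel_left1)
  next
    case (Suc n)
    have "(x * 2 ^ Suc n) powr a = (x * 2 ^ n) powr a * ?b"
      using assms by (simp add: powr_mult mult_ac)
    moreover have "(x * 2 ^ n) powr a * ?b * c = (x * 2 ^ n) powr a * ?b + (x * 2 ^ n) powr a * c"
      by (subst c(1)) (simp add: field_simps)
    ultimately show ?case using Suc by simp
  qed
  then have "(\<Sum>i\<le>Max S. (x * 2 ^ i) powr a) \<le> (x * 2 ^ Max S) powr a * c" .
  moreover have "(\<Sum>i\<in>S. (x * 2 ^ i) powr a) \<le> (\<Sum>i\<le>Max S. (x * 2 ^ i) powr a)"
    by (rule sum_mono2) (use assms in auto)
  ultimately show ?thesis unfolding c_def by simp
qed

lemma K_functional_le: "F = F0 + F1 \<Longrightarrow> K_functional N0 N1 t F \<le> N0 F0 + ennreal t * N1 F1"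
  unfolding K_functional_def by (rule INF_lower2[of "(F0, F1)"]) auto

lemma K_functional_mono: "s \<le> t \<Longrightarrow> K_functional N0 N1 s F \<le> K_functional N0 N1 t F"
  unfolding K_functional_def
  by (rule INF_superset_mono) (auto intro!: add_left_mono mult_right_mono ennreal_leI)

lemma K_functional_measurable [measurable]: "(\<lambda>t. K_functional N0 N1 t F) \<in> borel_measurable borel"
proof (rule borel_measurableI_greater)
  fix y
  have "is_interval {t. y < K_functional N0 N1 t F}"
    unfolding is_interval_1 by (auto intro: less_le_trans[OF _ K_functional_mono])
  then have "{t. y < K_functional N0 N1 t F} \<in> sets borel" by (rule real_interval_borel_measurable)
  then show "{t \<in> space borel. y < K_functional N0 N1 t F} \<in> sets borel" by simp
qed

lemma K_functional_over_antimono: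
  assumes "0 < s" "s \<le> t"
  shows "ennreal (1 / t) * K_functional N0 N1 t F \<le> ennreal (1 / s) * K_functional N0 N1 s F"
proof -
  have "ennreal (s / t) * K_functional N0 N1 t F \<le> N0 F0 + ennreal s * N1 F1" if "F = F0 + F1" for F0 F1
  proof -
    have "ennreal (s / t) * K_functional N0 N1 t F \<le> ennreal (s / t) * (N0 F0 + ennreal t * N1 F1)"
      by (intro mult_left_mono K_functional_le that) auto
    also have "\<dots> = ennreal (s / t) * N0 F0 + ennreal s * N1 F1"
      using assms by (simp add: distrib_left mult.assoc[symmetric] ennreal_mult[symmetric])
    also have "ennreal (s / t) * N0 F0 \<le> 1 * N0 F0"
      using assms by (intro mult_right_mono) auto
    finally show ?thesis by simp
  qed
  then have "ennreal (s / t) * K_functional N0 N1 t F \<le> K_functional N0 N1 s F"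
    unfolding K_functional_def[of _ _ s] by (auto intro!: INF_greatest)
  then have "ennreal (1 / s) * (ennreal (s / t) * K_functional N0 N1 t F)
      \<le> ennreal (1 / s) * K_functional N0 N1 s F" by (rule mult_left_mono) simp
  then show ?thesis using assms by (simp add: mult.assoc[symmetric] ennreal_mult[symmetric])
qed

abbreviation interpolation_integral ::
    "('b::ab_group_add \<Rightarrow> ennreal) \<Rightarrow> ('b \<Rightarrow> ennreal) \<Rightarrow> real \<Rightarrow> real \<Rightarrow> 'b \<Rightarrow> ennreal" where
  "interpolation_integral N0 N1 \<theta> r F \<equiv> \<integral>\<^sup>+t\<in>{0<..}.
     ennpowr (ennreal (t powr - \<theta>) * K_functional N0 N1 t F) r / ennreal t \<partial>lborel"

lemma interpolation_integrand:
  assumes "0 < t" "0 < r" "r\<^sub>1 = r * (1 - \<theta>)" "0 \<le> k"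
  shows "ennpowr (ennreal (t powr - \<theta>) * ennreal k) r / ennreal t
    = ennreal (t powr (r\<^sub>1 - 1) * (k / t) powr r)"
proof -
  have "ennpowr (ennreal (t powr - \<theta>) * ennreal k) r / ennreal t
      = ennreal ((t powr - \<theta> * k) powr r / t)"
    using assms by (simp add: ennreal_mult[symmetric] ennpowr_ennreal divide_ennreal)
  also have "(t powr - \<theta> * k) powr r / t = t powr (- \<theta> * r - 1) * k powr r"
    using assms by (simp add: powr_mult powr_powr powr_diff)
  also have "- \<theta> * r - 1 = (r\<^sub>1 - 1) - r" using assms by (simp add: algebra_simps)
  also have "t powr (r\<^sub>1 - 1 - r) * k powr r = t powr (r\<^sub>1 - 1) * (k / t) powr r"
    using assms by (simp add: powr_diff powr_divide)
  finally show ?thesis .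
qed

text \<open>
  If \<open>\<Phi> \<lambda> \<le> (t \<lambda>)\<^bsup>r\<^sub>1\<^esup>\<close>, then the decomposition at height \<open>\<lambda>\<close> gives \<open>K(t, F) \<le> (C + 1) t \<lambda>\<close>. The
  \<open>r\<close>-th power of \<open>K(t, F) / t\<close> is thus bounded by an integral over the remaining heights, those
  with \<open>t\<^bsup>r\<^sub>1\<^esup> < \<Phi> \<lambda> / \<lambda>\<^bsup>r\<^sub>1\<^esup>\<close>, and the integral over \<open>t\<close> can be evaluated first.
\<close>

lemma interpolation_norm_upper:
  fixes N0 N1 :: "'b :: ab_group_add \<Rightarrow> ennreal"
  assumes r: "0 < r\<^sub>1" "0 < r" "r\<^sub>1 = r * (1 - \<theta>)" and C: "0 \<le> C"
    and \<Phi> [measurable]: "\<Phi> \<in> borel_measurable borel" and \<Phi>_finite: "\<And>l. 0 < l \<Longrightarrow> \<Phi> l < \<infinity>"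
    and decomp: "\<And>l. 0 < l \<Longrightarrow>
      \<exists>F0 F1. F = F0 + F1 \<and> N0 F0 \<le> ennpowr (\<Phi> l) (1 / r\<^sub>1) \<and> N1 F1 \<le> ennreal (C * l)"
  shows "interpolation_norm N0 N1 \<theta> r F \<le> ennpowr (ennreal ((C + 1) powr r * r / r\<^sub>1) *
     (\<integral>\<^sup>+l\<in>{0<..}. ennreal (l powr (r - 1 - r\<^sub>1)) * \<Phi> l \<partial>lborel)) (1 / r)"
proof -
  define H where "H = (\<lambda>p::real \<times> real. ennreal (fst p powr (r\<^sub>1 - 1) * snd p powr (r - 1)) *
    indicator {p. 0 < fst p \<and> 0 < snd p \<and> ennreal ((fst p * snd p) powr r\<^sub>1) < \<Phi> (snd p)} p)"
  have H_meas: "H \<in> borel_measurable (lborel \<Otimes>\<^sub>M lborel)"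
    unfolding H_def by measurable
  define B where "B = (C + 1) powr r * r"
  have B: "B \<ge> 0" using r unfolding B_def by simp
  have K_le: "K_functional N0 N1 t F \<le> ennreal ((C + 1) * (t * l))"
    if "0 < t" "0 < l" "\<Phi> l \<le> ennreal ((t * l) powr r\<^sub>1)" for t l
  proof -
    obtain F0 F1 where F: "F = F0 + F1" "N0 F0 \<le> ennpowr (\<Phi> l) (1 / r\<^sub>1)" "N1 F1 \<le> ennreal (C * l)"
      using decomp[OF \<open>0 < l\<close>] by blast
    have "ennpowr (\<Phi> l) (1 / r\<^sub>1) \<le> ennpowr (ennreal ((t * l) powr r\<^sub>1)) (1 / r\<^sub>1)"
      by (rule ennpowr_mono) (use r that in auto)
    also have "\<dots> = ennreal (t * l)" using that r(1) by (simp add: ennpowr_ennreal powr_powr)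
    finally have "N0 F0 \<le> ennreal (t * l)" using F(2) by (rule order_trans[rotated])
    moreover have "ennreal t * N1 F1 \<le> ennreal t * ennreal (C * l)" by (rule mult_left_mono[OF F(3)]) simp
    ultimately have "K_functional N0 N1 t F \<le> ennreal (t * l) + ennreal t * ennreal (C * l)"
      using K_functional_le[OF F(1)] by (meson add_mono order_trans)
    also have "\<dots> = ennreal ((C + 1) * (t * l))"
      using that C by (simp add: ennreal_mult[symmetric] ennreal_plus[symmetric] algebra_simps
          del: ennreal_plus)
    finally show ?thesis .
  qed
  have K_fin: "K_functional N0 N1 t F < \<infinity>" if "0 < t" for t
  proof -
    obtain F0 F1 where F: "F = F0 + F1" "N0 F0 \<le> ennpowr (\<Phi> 1) (1 / r\<^sub>1)" "N1 F1 \<le> ennreal (C * 1)"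
      using decomp[of 1] by auto
    have "ennpowr (\<Phi> 1) (1 / r\<^sub>1) < \<infinity>" using \<Phi>_finite[of 1] by (auto simp: ennpowr_def)
    then have "N0 F0 < \<infinity>" "N1 F1 < \<infinity>" using F by (auto intro: le_less_trans)
    then have "N0 F0 + ennreal t * N1 F1 < \<infinity>" by (simp add: ennreal_mult_less_top)
    then show ?thesis using K_functional_le[OF F(1), of N0 N1 t] by (rule le_less_trans[rotated])
  qed
  have point: "ennpowr (ennreal (t powr - \<theta>) * K_functional N0 N1 t F) r / ennreal t
      \<le> ennreal B * (\<integral>\<^sup>+l. H (t, l) \<partial>lborel)" if t: "0 < t" for t
  proof -
    obtain k where k: "K_functional N0 N1 t F = ennreal k" "0 \<le> k"
      using K_fin[OF t] by (cases "K_functional N0 N1 t F") auto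
    define Y where "Y = k / t / (C + 1)"
    have Y: "0 \<le> Y" "k / t = (C + 1) * Y" using k t C by (auto simp: Y_def)
    have ind: "indicator {0<..<Y} l * ennreal (l powr (r - 1)) * ennreal (t powr (r\<^sub>1 - 1)) \<le> H (t, l)" for l
    proof (cases "0 < l \<and> l < Y")
      case True
      have "\<not> \<Phi> l \<le> ennreal ((t * l) powr r\<^sub>1)"
      proof
        assume "\<Phi> l \<le> ennreal ((t * l) powr r\<^sub>1)"
        then have "ennreal k \<le> ennreal ((C + 1) * (t * l))" using K_le[OF t, of l] True k by simp
        then have "k \<le> (C + 1) * (t * l)" using t True C by simp
        moreover have "t * (C + 1) * l < t * (C + 1) * Y" using t C True by simp
        moreover have "k = t * (C + 1) * Y" using Y(2) t by (simp add: field_simps)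
        ultimately show False by (simp add: mult_ac)
      qed
      then show ?thesis using True t
        by (simp add: H_def ennreal_mult[symmetric] mult_ac not_le)
    qed (auto simp: indicator_def)
    have "ennpowr (ennreal (t powr - \<theta>) * K_functional N0 N1 t F) r / ennreal t
        = ennreal (t powr (r\<^sub>1 - 1) * (k / t) powr r)"
      unfolding k(1) by (rule interpolation_integrand) (use t r k in auto)
    also have "\<dots> = ennreal B * (ennreal (Y powr r / r) * ennreal (t powr (r\<^sub>1 - 1)))"
      using Y C r by (simp add: B_def powr_mult ennreal_mult[symmetric] mult_ac)
    also have "ennreal (Y powr r / r) = (\<integral>\<^sup>+l\<in>{0<..<Y}. ennreal (l powr (r - 1)) \<partial>lborel)"
      by (rule nn_integral_powr_Ioo[symmetric]) (use r Y in auto)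
    also have "\<dots> * ennreal (t powr (r\<^sub>1 - 1)) =
        (\<integral>\<^sup>+l. indicator {0<..<Y} l * ennreal (l powr (r - 1)) * ennreal (t powr (r\<^sub>1 - 1)) \<partial>lborel)"
      by (subst nn_integral_multc[symmetric]) (auto simp: mult_ac)
    also have "\<dots> \<le> (\<integral>\<^sup>+l. H (t, l) \<partial>lborel)" by (rule nn_integral_mono) (rule ind)
    finally show ?thesis by (simp add: mult_left_mono)
  qed
  have inner: "(\<integral>\<^sup>+t. H (t, l) \<partial>lborel) =
      ennreal (1 / r\<^sub>1) * (ennreal (l powr (r - 1 - r\<^sub>1)) * \<Phi> l * indicator {0<..} l)" for l
  proof (cases "0 < l")
    case True
    then obtain y where y: "\<Phi> l = ennreal y" "0 \<le> y" using \<Phi>_finite[of l] by (cases "\<Phi> l") auto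
    have iff: "(t * l) powr r\<^sub>1 < y \<longleftrightarrow> t < y powr (1 / r\<^sub>1) / l" if "0 < t" for t
    proof -
      have "(t * l) powr r\<^sub>1 < y \<longleftrightarrow> (t * l) powr r\<^sub>1 < (y powr (1 / r\<^sub>1)) powr r\<^sub>1"
        using y r(1) by (simp add: powr_powr)
      also have "\<dots> \<longleftrightarrow> t * l < y powr (1 / r\<^sub>1)"
        using powr_less_mono2[of r\<^sub>1 "t * l" "y powr (1 / r\<^sub>1)"]
          powr_mono2[of r\<^sub>1 "y powr (1 / r\<^sub>1)" "t * l"]
          mult_pos_pos[OF that True] r(1) by (smt (verit) powr_ge_zero)
      finally show ?thesis using True by (simp add: field_simps)
    qed
    have "(\<integral>\<^sup>+t. H (t, l) \<partial>lborel) = (\<integral>\<^sup>+t. ennreal (l powr (r - 1)) *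
        (ennreal (t powr (r\<^sub>1 - 1)) * indicator {0<..<y powr (1 / r\<^sub>1) / l} t) \<partial>lborel)"
      by (rule nn_integral_cong)
         (use True iff y in \<open>auto simp: H_def indicator_def ennreal_mult ennreal_less_iff mult_ac\<close>)
    also have "\<dots> = ennreal (l powr (r - 1)) * ennreal ((y powr (1 / r\<^sub>1) / l) powr r\<^sub>1 / r\<^sub>1)"
      by (subst nn_integral_cmult) (use True r nn_integral_powr_Ioo in auto)
    also have "(y powr (1 / r\<^sub>1) / l) powr r\<^sub>1 = y / l powr r\<^sub>1"
      using y True r(1) by (simp add: powr_divide powr_powr)
    finally show ?thesis using True y r(1)
      by (simp add: ennreal_mult[symmetric] powr_diff powr_add field_simps)
  qed (auto simp: H_def)
  have "interpolation_integral N0 N1 \<theta> r F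
      \<le> (\<integral>\<^sup>+t. ennreal B * (\<integral>\<^sup>+l. H (t, l) \<partial>lborel) \<partial>lborel)"
    by (rule nn_integral_mono) (use point in \<open>auto simp: indicator_def\<close>)
  also have "\<dots> = ennreal B * (\<integral>\<^sup>+t. (\<integral>\<^sup>+l. H (t, l) \<partial>lborel) \<partial>lborel)"
    by (rule nn_integral_cmult) (use H_meas in measurable)
  also have "(\<integral>\<^sup>+t. (\<integral>\<^sup>+l. H (t, l) \<partial>lborel) \<partial>lborel) = (\<integral>\<^sup>+l. (\<integral>\<^sup>+t. H (t, l) \<partial>lborel) \<partial>lborel)"
    using lborel_pair.Fubini'[of "\<lambda>t l. H (t, l)"] H_meas by simp
  also have "\<dots> = ennreal (1 / r\<^sub>1) *
      (\<integral>\<^sup>+l\<in>{0<..}. ennreal (l powr (r - 1 - r\<^sub>1)) * \<Phi> l \<partial>lborel)"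
    unfolding inner by (rule nn_integral_cmult) measurable
  finally show ?thesis
    unfolding interpolation_norm_def B_def using r
    by (intro ennpowr_mono) (auto simp: mult.assoc[symmetric] ennreal_mult[symmetric])
qed

text \<open>
  Since \<open>s i\<close> is the integral of \<open>r\<^sub>1 t\<^bsup>r\<^sub>1 - 1\<^esup>\<close> over \<open>0 < t < s i powr (1 / r\<^sub>1)\<close>, where the decreasing
  function \<open>K(t, F) / t\<close> is at least its value at the right end point, each summand is at most an
  integral. At a fixed \<open>t\<close> the dyadic coefficients of the integrals that contain \<open>t\<close> add up to at
  most twice the largest of them. Hence Young's inequality may be applied to their sum, and the
  power \<open>r'\<close> of the largest is dominated by the sum of all powers.
\<close>

lemma dyadic_sum_K_functional:
  fixes N0 N1 :: "'b :: ab_group_add \<Rightarrow> ennreal" and s :: "nat \<Rightarrow> real"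
  assumes r: "0 < r\<^sub>1" "1 < r" "r\<^sub>1 = r * (1 - \<theta>)" and r': "1 / r + 1 / r' = 1"
    and s: "\<And>i. 0 \<le> s i" and x: "0 < x"
  shows "(\<Sum>i<n. ennreal (x * 2 ^ i * s i / s i powr (1 / r\<^sub>1)) * K_functional N0 N1 (s i powr (1 / r\<^sub>1)) F)
    \<le> ennreal r\<^sub>1 * interpolation_integral N0 N1 \<theta> r F
      + ennreal (2 powr r') * (\<Sum>i<n. ennreal ((x * 2 ^ i) powr r' * s i))"
proof -
  define K where "K = (\<lambda>t. K_functional N0 N1 t F)"
  have [measurable]: "K \<in> borel_measurable borel" unfolding K_def by measurable
  define T where "T = (\<lambda>i. s i powr (1 / r\<^sub>1))"
  let ?d = "\<lambda>t. ennreal (r\<^sub>1 * t powr (r\<^sub>1 - 1))"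
    and ?y = "\<lambda>i. ennreal (2 powr r' * (x * 2 ^ i) powr r')"
    and ?\<kappa> = "\<lambda>t. ennreal (1 / t) * K t"
  let ?G = "\<lambda>i t. ennreal (x * 2 ^ i) * ?d t * ?\<kappa> t * indicator {0<..<T i} t"
    and ?H = "\<lambda>i t. ?y i * (?d t * indicator {0<..<T i} t)"
  define J where "J = (\<lambda>t::real. ennpowr (ennreal (t powr - \<theta>) * K t) r / ennreal t)"
  have [measurable]: "J \<in> borel_measurable borel" unfolding J_def by measurable
  have r'1: "r' > 1"
  proof -
    have "0 < 1 / r" "1 / r < 1" using r by auto
    then have "1 / r' > 0" "1 / r' < 1" using r' by linarith+
    then show ?thesis by (smt (verit) divide_less_eq_1_pos zero_less_divide_1_iff less_divide_eq_1_pos)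
  qed
  have mass: "(\<integral>\<^sup>+t\<in>{0<..<T i}. ?d t \<partial>lborel) = ennreal (s i)" for i
  proof -
    have "(\<integral>\<^sup>+t\<in>{0<..<T i}. ?d t \<partial>lborel)
        = ennreal r\<^sub>1 * (\<integral>\<^sup>+t\<in>{0<..<T i}. ennreal (t powr (r\<^sub>1 - 1)) \<partial>lborel)"
      using r(1) by (subst nn_integral_cmult[symmetric]) (auto simp: ennreal_mult mult_ac)
    also have "\<dots> = ennreal r\<^sub>1 * ennreal (T i powr r\<^sub>1 / r\<^sub>1)"
      by (subst nn_integral_powr_Ioo) (use r(1) in \<open>auto simp: T_def\<close>)
    also have "\<dots> = ennreal (s i)"
      using r(1) s[of i] by (simp add: T_def powr_powr ennreal_mult[symmetric])
    finally show ?thesis .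
  qed
  have end_point: "ennreal (x * 2 ^ i * s i / T i) * K (T i) \<le>
     (\<integral>\<^sup>+t\<in>{0<..<T i}. ennreal (x * 2 ^ i) * ?d t * ?\<kappa> t \<partial>lborel)" for i
  proof (cases "s i = 0")
    case False
    then have si: "s i > 0" using s[of i] by simp
    have "ennreal (x * 2 ^ i * s i / T i) = ennreal (s i) * ennreal (x * 2 ^ i) * ennreal (1 / T i)"
      using x si by (simp add: T_def ennreal_mult[symmetric] mult_ac)
    then have "ennreal (x * 2 ^ i * s i / T i) * K (T i)
        = ennreal (s i) * (ennreal (x * 2 ^ i) * (ennreal (1 / T i) * K (T i)))"
      by (simp only: mult.assoc)
    also have "\<dots> = (\<integral>\<^sup>+t. ?d t * indicator {0<..<T i} t *
        (ennreal (x * 2 ^ i) * (ennreal (1 / T i) * K (T i))) \<partial>lborel)"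
      unfolding mass[symmetric] by (rule nn_integral_multc[symmetric]) measurable
    also have "\<dots> \<le> (\<integral>\<^sup>+t\<in>{0<..<T i}. ennreal (x * 2 ^ i) * ?d t * ?\<kappa> t \<partial>lborel)"
    proof (rule nn_integral_mono)
      fix t
      show "?d t * indicator {0<..<T i} t * (ennreal (x * 2 ^ i) * (ennreal (1 / T i) * K (T i)))
        \<le> ?G i t"
      proof (cases "t \<in> {0<..<T i}")
        case True
        then have "ennreal (1 / T i) * K (T i) \<le> ennreal (1 / t) * K t"
          unfolding K_def by (intro K_functional_over_antimono) auto
        then have "ennreal (x * 2 ^ i) * ?d t * (ennreal (1 / T i) * K (T i))
          \<le> ennreal (x * 2 ^ i) * ?d t * ?\<kappa> t"
          by (rule mult_left_mono) simp
        then show ?thesis using True by (simp add: mult_ac)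
      qed simp
    qed
    finally show ?thesis .
  qed simp
  have point: "(\<Sum>i<n. ?G i t)
    \<le> ennreal r\<^sub>1 * (J t * indicator {0<..} t) +
      (\<Sum>i<n. ?H i t)" for t
  proof (cases "0 < t \<and> K t \<noteq> \<infinity>")
    case True
    then obtain k where k: "K t = ennreal k" "0 \<le> k" by (cases "K t") auto
    define S where "S = {i \<in> {..<n}. t < T i}"
    have S: "finite S" unfolding S_def by simp
    have sum_S: "(\<Sum>i<n. g i * indicator {0<..<T i} t) = (\<Sum>i\<in>S. g i)" for g :: "nat \<Rightarrow> ennreal"
      unfolding S_def using True by (intro sum.mono_neutral_cong_right) auto
    have young: "(k / t) * (\<Sum>i\<in>S. x * 2 ^ i) \<le> (k / t) powr r + (\<Sum>i\<in>S. 2 powr r' * (x * 2 ^ i) powr r')"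
    proof (cases "S = {}")
      case False
      let ?M = "x * 2 ^ Max S"
      have "(\<Sum>i\<in>S. x * 2 ^ i) \<le> 2 * ?M"
        using geometric_sum_powr[of 1 x S] x S False by (simp add: powr_minus)
      then have "(k / t) * (\<Sum>i\<in>S. x * 2 ^ i) \<le> (k / t) * (2 * ?M)"
        using k True by (intro mult_left_mono) auto
      also have "\<dots> \<le> (k / t) powr r / r + (2 * ?M) powr r' / r'"
        by (rule Youngs_inequality) (use r r'1 r' k True x in auto)
      also have "(k / t) powr r / r \<le> (k / t) powr r"
        using r by (simp add: divide_le_eq mult_le_cancel_left1)
      also have "(2 * ?M) powr r' / r' \<le> (2 * ?M) powr r'"
        using r'1 by (simp add: divide_le_eq mult_le_cancel_left1)
      also have "(2 * ?M) powr r' = 2 powr r' * ?M powr r'" using x by (simp add: powr_mult)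
      also have "\<dots> \<le> (\<Sum>i\<in>S. 2 powr r' * (x * 2 ^ i) powr r')"
        by (rule member_le_sum[of "Max S" S "\<lambda>i. 2 powr r' * (x * 2 ^ i) powr r'"]) (use S False in auto)
      finally show ?thesis by simp
    qed simp
    have "(\<Sum>i<n. ?G i t)
      = (\<Sum>i\<in>S. ennreal ((r\<^sub>1 * t powr (r\<^sub>1 - 1)) * ((k / t) * (x * 2 ^ i))))"
      unfolding sum_S k(1) using x r(1) k True by (intro sum.cong) (auto simp: ennreal_mult[symmetric] mult_ac)
    also have "\<dots> = ennreal ((r\<^sub>1 * t powr (r\<^sub>1 - 1)) * ((k / t) * (\<Sum>i\<in>S. x * 2 ^ i)))"
      using x r k True by (subst sum_ennreal) (auto simp: sum_distrib_left)
    also have "\<dots> \<le> ennreal ((r\<^sub>1 * t powr (r\<^sub>1 - 1)) * ((k / t) powr r + (\<Sum>i\<in>S. 2 powr r' * (x * 2 ^ i) powr r')))"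
      by (intro ennreal_leI mult_left_mono young) (use r in auto)
    also have "\<dots> = ennreal (r\<^sub>1 * (t powr (r\<^sub>1 - 1) * (k / t) powr r)) +
        (\<Sum>i\<in>S. ?y i * ?d t)"
    proof -
      have "(r\<^sub>1 * t powr (r\<^sub>1 - 1)) * ((k / t) powr r + (\<Sum>i\<in>S. 2 powr r' * (x * 2 ^ i) powr r'))
        = r\<^sub>1 * (t powr (r\<^sub>1 - 1) * (k / t) powr r) +
          (\<Sum>i\<in>S. 2 powr r' * (x * 2 ^ i) powr r' * (r\<^sub>1 * t powr (r\<^sub>1 - 1)))"
        by (simp only: distrib_left sum_distrib_left mult_ac)
      moreover have "ennreal (\<Sum>i\<in>S. 2 powr r' * (x * 2 ^ i) powr r' * (r\<^sub>1 * t powr (r\<^sub>1 - 1)))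
        = (\<Sum>i\<in>S. ?y i * ?d t)"
        using r(1) by (subst sum_ennreal[symmetric]) (auto simp: ennreal_mult)
      ultimately show ?thesis
        using r(1) by (simp only:) (subst ennreal_plus, auto intro!: sum_nonneg)
    qed
    also have "ennreal (r\<^sub>1 * (t powr (r\<^sub>1 - 1) * (k / t) powr r)) = ennreal r\<^sub>1 * (J t * indicator {0<..} t)"
      using interpolation_integrand[of t r r\<^sub>1 \<theta> k] True r k by (simp add: J_def ennreal_mult)
    also have "(\<Sum>i\<in>S. ?y i * ?d t)
      = (\<Sum>i<n. ?H i t)"
      unfolding sum_S[symmetric] by (simp add: mult_ac)
    finally show ?thesis .
  next
    case False
    then consider "t \<le> 0" | "0 < t" "K t = \<infinity>" by force
    then show ?thesis
    proof cases
      case 1 then show ?thesis by simp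
    next
      case 2
      then have "J t = \<infinity>" by (simp add: J_def ennreal_mult_top ennpowr_def ennreal_divide_eq_top_iff ennreal_top_divide)
      then show ?thesis using 2 r by (simp add: ennreal_mult_top)
    qed
  qed
  have "(\<Sum>i<n. ennreal (x * 2 ^ i * s i / T i) * K (T i)) \<le>
     (\<Sum>i<n. \<integral>\<^sup>+t\<in>{0<..<T i}. ennreal (x * 2 ^ i) * ?d t * ?\<kappa> t \<partial>lborel)"
    by (rule sum_mono) (rule end_point)
  also have "\<dots> = (\<integral>\<^sup>+t. (\<Sum>i<n. ?G i t) \<partial>lborel)"
    by (rule nn_integral_sum[symmetric]) measurable
  also have "\<dots> \<le> (\<integral>\<^sup>+t. ennreal r\<^sub>1 * (J t * indicator {0<..} t) +
      (\<Sum>i<n. ?H i t) \<partial>lborel)"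
    by (rule nn_integral_mono) (rule point)
  also have "\<dots> = ennreal r\<^sub>1 * (\<integral>\<^sup>+t\<in>{0<..}. J t \<partial>lborel) +
      (\<Sum>i<n. ?y i * (\<integral>\<^sup>+t\<in>{0<..<T i}. ?d t \<partial>lborel))"
  proof -
    have "(\<integral>\<^sup>+t. (\<Sum>i<n. ?y i *
          (?d t * indicator {0<..<T i} t)) \<partial>lborel)
      = (\<Sum>i<n. ?y i * (\<integral>\<^sup>+t\<in>{0<..<T i}. ?d t \<partial>lborel))"
    proof (subst nn_integral_sum)
      show "(\<Sum>i<n. \<integral>\<^sup>+t. ?y i *
          (?d t * indicator {0<..<T i} t) \<partial>lborel)
        = (\<Sum>i<n. ?y i * (\<integral>\<^sup>+t\<in>{0<..<T i}. ?d t \<partial>lborel))"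
        by (rule sum.cong[OF refl], rule nn_integral_cmult) measurable
    qed measurable
    moreover have "(\<integral>\<^sup>+t. ennreal r\<^sub>1 * (J t * indicator {0<..} t) \<partial>lborel) = ennreal r\<^sub>1 * (\<integral>\<^sup>+t\<in>{0<..}. J t \<partial>lborel)"
      by (rule nn_integral_cmult) measurable
    moreover have "(\<integral>\<^sup>+t. ennreal r\<^sub>1 * (J t * indicator {0<..} t) +
        (\<Sum>i<n. ?H i t) \<partial>lborel)
      = (\<integral>\<^sup>+t. ennreal r\<^sub>1 * (J t * indicator {0<..} t) \<partial>lborel) +
        (\<integral>\<^sup>+t. (\<Sum>i<n. ?H i t) \<partial>lborel)"
      by (rule nn_integral_add) measurable
    ultimately show ?thesis by (simp only:)
  qed
  also have "(\<Sum>i<n. ?y i * (\<integral>\<^sup>+t\<in>{0<..<T i}. ?d t \<partial>lborel))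
    = ennreal (2 powr r') * (\<Sum>i<n. ennreal ((x * 2 ^ i) powr r' * s i))"
    unfolding mass sum_distrib_left using s
    by (intro sum.cong refl) (simp add: ennreal_mult[symmetric] mult_ac)
  finally show ?thesis unfolding T_def K_def J_def .
qed

section \<open>Lebesgue, Hardy and BMO norms of a discrete measure\<close>

context weighted_sets
begin

abbreviation "M \<equiv> point_measure UNIV (\<lambda>x. ennreal (w x))"

lemma w_nonneg: "0 \<le> w x" using w_pos[of x] by simp

lemma sum_w_pos: "finite A \<Longrightarrow> A \<noteq> {} \<Longrightarrow> 0 < sum w A"
  by (rule sum_pos) (use w_pos in auto)

lemma nn_integral_M: "(\<integral>\<^sup>+x. h x \<partial>M) = (\<integral>\<^sup>+x. ennreal (w x) * h x \<partial>count_space UNIV)"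
  unfolding point_measure_def by (rule nn_integral_density) auto

lemma nn_integral_M_finite:
  assumes "finite A" "\<And>x. x \<notin> A \<Longrightarrow> h x = 0"
  shows "(\<integral>\<^sup>+x. h x \<partial>M) = (\<Sum>x\<in>A. ennreal (w x) * h x)"
  unfolding nn_integral_M by (rule nn_integral_count_space'[OF assms(1)]) (use assms in auto)

lemma set_nn_integral_M_finite:
  assumes "finite A" shows "(\<integral>\<^sup>+x\<in>A. h x \<partial>M) = (\<Sum>x\<in>A. ennreal (w x) * h x)"
  by (subst nn_integral_M_finite[OF assms]) (auto intro!: sum.cong)

lemma emeasure_M: "finite A \<Longrightarrow> emeasure M A = ennreal (sum w A)"
  by (subst emeasure_point_measure_finite2) (auto simp: w_nonneg)

lemma measure_M: "finite A \<Longrightarrow> measure M A = sum w A"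
  unfolding measure_def by (simp add: emeasure_M sum_nonneg w_nonneg)

lemma AE_M: "(AE x in M. P x) \<longleftrightarrow> (\<forall>x. P x)"
  unfolding point_measure_def by (subst AE_density) (auto simp: AE_count_space w_pos)

lemma integral_M_finite:
  fixes f :: "'v \<Rightarrow> complex"
  assumes "finite A" "\<And>x. x \<notin> A \<Longrightarrow> f x = 0"
  shows "(\<integral>x. f x \<partial>M) = (\<Sum>x\<in>A. of_real (w x) * f x)"
proof -
  have "(\<integral>x. f x \<partial>M) = (\<integral>x. w x *\<^sub>R f x \<partial>count_space UNIV)"
    unfolding point_measure_def by (rule integral_density) (auto simp: w_nonneg)
  also have "\<dots> = (\<Sum>x | w x *\<^sub>R f x \<noteq> 0. w x *\<^sub>R f x)"
    using lebesgue_integral_count_space_finite_support[of UNIV "\<lambda>x. w x *\<^sub>R f x"]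
      finite_subset[OF _ assms(1), of "{x. w x *\<^sub>R f x \<noteq> 0}"] assms(2) by auto
  also have "\<dots> = (\<Sum>x\<in>A. w x *\<^sub>R f x)"
    by (rule sum.mono_neutral_left) (use assms in auto)
  finally show ?thesis by (simp add: scaleR_conv_of_real)
qed

lemma mean_on_M: "finite R \<Longrightarrow> mean_on M R f = (\<Sum>x\<in>R. of_real (w x) * f x) / of_real (sum w R)"
  unfolding mean_on_def set_lebesgue_integral_def
  by (subst integral_M_finite[of R]) (auto simp: measure_M intro!: sum.cong arg_cong2[of _ _ _ _ "(/)"])

lemma Lp_norm_1: "Lp_norm M 1 f = (\<integral>\<^sup>+x. ennreal (cmod (f x)) \<partial>M)"
proof -
  have "ennpowr x 1 = x" for x by (cases x) (auto simp: ennpowr_def)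
  then show ?thesis unfolding Lp_norm_def by simp
qed

lemma atom_norm_le:
  assumes "atom M \<R> a" shows "(\<integral>\<^sup>+x. ennreal (cmod (a x)) \<partial>M) \<le> 1"
proof -
  obtain R where R: "R \<in> \<R>" "\<And>x. x \<notin> R \<Longrightarrow> a x = 0" "\<And>x. cmod (a x) \<le> 1 / measure M R"
    using assms unfolding atom_def AE_M by blast
  have fin: "finite R" and pos: "0 < sum w R" using finite_sets sum_w_pos nonempty_sets R(1) by auto
  have "(\<integral>\<^sup>+x. ennreal (cmod (a x)) \<partial>M) = (\<Sum>x\<in>R. ennreal (w x) * ennreal (cmod (a x)))"
    by (rule nn_integral_M_finite[OF fin]) (simp add: R(2))
  also have "\<dots> \<le> (\<Sum>x\<in>R. ennreal (w x) * ennreal (1 / sum w R))"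
    using R(3) by (intro sum_mono mult_left_mono ennreal_leI) (auto simp: measure_M[OF fin])
  also have "\<dots> = 1"
    using pos by (simp add: w_nonneg ennreal_mult[symmetric] sum_divide_distrib[symmetric])
  finally show ?thesis .
qed

lemma L1_le_H1: "Lp_norm M 1 f \<le> H1_norm M \<R> f"
proof (cases "f \<in> space_of (Lp_norm M 1)")
  case True
  have "Lp_norm M 1 f \<le> (\<Sum>j. ennreal (cmod (c j)))"
    if ca: "(c, a) \<in> atomic_decompositions M \<R> f" for c a
  proof -
    let ?s = "\<lambda>n x. \<Sum>j<n. c j * a j x"
    have at: "\<And>j. atom M \<R> (a j)"
      and lim: "(\<lambda>n. Lp_norm M 1 (\<lambda>x. f x - ?s n x)) \<longlonglongrightarrow> 0"
      using ca unfolding atomic_decompositions_def by auto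
    have "Lp_norm M 1 f \<le> Lp_norm M 1 (\<lambda>x. f x - ?s n x) + (\<Sum>j. ennreal (cmod (c j)))" for n
    proof -
      have "(\<integral>\<^sup>+x. ennreal (cmod (f x)) \<partial>M) \<le> (\<integral>\<^sup>+x. ennreal (cmod (f x - ?s n x)) +
          (\<Sum>j<n. ennreal (cmod (c j)) * ennreal (cmod (a j x))) \<partial>M)"
      proof (rule nn_integral_mono)
        fix x
        have "cmod (f x) \<le> cmod (f x - ?s n x) + cmod (?s n x)"
          using norm_triangle_ineq[of "f x - ?s n x" "?s n x"] by simp
        also have "cmod (?s n x) \<le> (\<Sum>j<n. cmod (c j) * cmod (a j x))"
          by (rule sum_norm_le) (simp add: norm_mult)
        finally have "ennreal (cmod (f x)) \<le> ennreal (cmod (f x - ?s n x) + (\<Sum>j<n. cmod (c j) * cmod (a j x)))"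
          by (simp add: ennreal_leI)
        also have "\<dots> = ennreal (cmod (f x - ?s n x)) + (\<Sum>j<n. ennreal (cmod (c j)) * ennreal (cmod (a j x)))"
          by (subst ennreal_plus) (auto simp: sum_nonneg ennreal_mult[symmetric])
        finally show "ennreal (cmod (f x)) \<le> \<dots>" .
      qed
      also have "\<dots> = (\<integral>\<^sup>+x. ennreal (cmod (f x - ?s n x)) \<partial>M) +
          (\<Sum>j<n. ennreal (cmod (c j)) * (\<integral>\<^sup>+x. ennreal (cmod (a j x)) \<partial>M))"
        by (subst nn_integral_add, simp, simp, subst nn_integral_sum, simp, subst nn_integral_cmult) auto
      also have "\<dots> \<le> (\<integral>\<^sup>+x. ennreal (cmod (f x - ?s n x)) \<partial>M) + (\<Sum>j. ennreal (cmod (c j)))"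
      proof (rule add_left_mono)
        have "(\<Sum>j<n. ennreal (cmod (c j)) * (\<integral>\<^sup>+x. ennreal (cmod (a j x)) \<partial>M))
            \<le> (\<Sum>j<n. ennreal (cmod (c j)) * 1)"
          by (rule sum_mono, rule mult_left_mono[OF atom_norm_le[OF at]]) simp
        also have "\<dots> = (\<Sum>j<n. ennreal (cmod (c j)))" by (simp only: mult_1_right)
        also have "\<dots> \<le> (\<Sum>j. ennreal (cmod (c j)))" by (rule sum_le_suminf) auto
        finally show "(\<Sum>j<n. ennreal (cmod (c j)) * (\<integral>\<^sup>+x. ennreal (cmod (a j x)) \<partial>M))
            \<le> (\<Sum>j. ennreal (cmod (c j)))" .
      qed
      finally show ?thesis unfolding Lp_norm_1 .
    qed
    then have "Lp_norm M 1 f \<le> 0 + (\<Sum>j. ennreal (cmod (c j)))"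
      by (intro LIMSEQ_le_const[OF tendsto_add[OF lim tendsto_const]]) auto
    then show ?thesis by simp
  qed
  then show ?thesis unfolding H1_norm_def using True by (auto intro!: INF_greatest)
qed (simp add: H1_norm_def)

text \<open>
  Sums of atoms over any countable index set which are locally finite converge in \<open>L\<^sup>1\<close> in
  whatever order they are enumerated.
\<close>

lemma H1_norm_atomic_sum:
  fixes c :: "'i \<Rightarrow> real" and a :: "'i \<Rightarrow> 'v \<Rightarrow> complex"
  assumes I: "countable (UNIV :: 'i set)" "infinite (UNIV :: 'i set)"
    and at: "\<And>i. atom M \<R> (a i)" and c: "\<And>i. 0 \<le> c i"
    and S: "\<And>x. finite (S x)" "\<And>x i. i \<notin> S x \<Longrightarrow> c i = 0 \<or> a i x = 0"
    and b: "\<And>x. b x = (\<Sum>i\<in>S x. of_real (c i) * a i x)"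
  shows "H1_norm M \<R> b \<le> (\<integral>\<^sup>+i. ennreal (c i) \<partial>count_space UNIV)"
proof (cases "(\<integral>\<^sup>+i. ennreal (c i) \<partial>count_space UNIV) = \<infinity>")
  case False
  define e where "e = from_nat_into (UNIV :: 'i set)"
  have e: "bij e" unfolding e_def using I by (rule bij_betw_from_nat_into)
  let ?t = "\<lambda>j x. of_real (c (e j)) * a (e j) x"
  let ?u = "\<lambda>j x. ennreal (c (e j)) * ennreal (cmod (a (e j) x))"
  have total: "(\<Sum>j. ennreal (c (e j))) = (\<integral>\<^sup>+i. ennreal (c i) \<partial>count_space UNIV)"
    using nn_integral_bij_count_space[OF e, of "\<lambda>i. ennreal (c i)"] by (simp add: nn_integral_count_space_nat)
  have fin: "(\<Sum>j. ennreal (c (e j))) < \<infinity>" using False total by (simp add: less_top)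
  have summ: "summable (\<lambda>j. c (e j))"
    using fin by (intro summable_suminf_not_top) (auto simp: c)
  have tail: "Lp_norm M 1 (\<lambda>x. b x - (\<Sum>j<n. ?t j x)) \<le> (\<Sum>j. ennreal (c (e (j + n))))" for n
  proof -
    have "ennreal (cmod (b x - (\<Sum>j<n. ?t j x)))
      \<le> (\<Sum>j. ?u (j + n) x)" for x
    proof -
      have "finite (e -` S x)" using e S(1) by (simp add: bij_is_inj finite_vimageI)
      then obtain k0 where k0: "e -` S x \<subseteq> {..<k0}" using finite_nat_iff_bounded by blast
      define k where "k = max k0 n"
      have "b x = (\<Sum>j\<in>e -` S x. ?t j x)"
        unfolding b by (rule sum.reindex_bij_betw[symmetric], rule bij_betw_subset[OF e, of "e -` S x"])
          (use e in \<open>auto simp: bij_is_surj surj_image_vimage_eq\<close>)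
      also have "\<dots> = (\<Sum>j<k. ?t j x)"
        by (rule sum.mono_neutral_left) (use k0 S(2) in \<open>fastforce simp: k_def\<close>)+
      also have "\<dots> = (\<Sum>j<n. ?t j x) + (\<Sum>j<k-n. ?t (j + n) x)"
        using sum.atLeastLessThan_concat[of 0 n k "\<lambda>j. ?t j x"]
          sum.shift_bounds_nat_ivl[of "\<lambda>j. ?t j x" 0 n "k - n"]
        by (simp add: k_def atLeast0LessThan)
      finally have "cmod (b x - (\<Sum>j<n. ?t j x))
          = cmod (\<Sum>j<k-n. ?t (j + n) x)" by simp
      also have "\<dots> \<le> (\<Sum>j<k-n. c (e (j + n)) * cmod (a (e (j + n)) x))"
        by (rule sum_norm_le) (simp add: norm_mult c)
      finally have "ennreal (cmod (b x - (\<Sum>j<n. ?t j x)))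
          \<le> (\<Sum>j<k-n. ?u (j + n) x)"
        by (simp add: ennreal_leI c ennreal_mult[symmetric])
      also have "\<dots> \<le> (\<Sum>j. ?u (j + n) x)"
        by (rule sum_le_suminf) auto
      finally show ?thesis .
    qed
    then have "Lp_norm M 1 (\<lambda>x. b x - (\<Sum>j<n. ?t j x))
        \<le> (\<integral>\<^sup>+x. (\<Sum>j. ?u (j + n) x) \<partial>M)"
      unfolding Lp_norm_1 by (rule nn_integral_mono)
    also have "\<dots> = (\<Sum>j. ennreal (c (e (j + n))) * (\<integral>\<^sup>+x. ennreal (cmod (a (e (j + n)) x)) \<partial>M))"
      by (simp add: nn_integral_suminf nn_integral_cmult)
    also have "\<dots> \<le> (\<Sum>j. ennreal (c (e (j + n))) * 1)"
      by (rule suminf_le, rule mult_left_mono[OF atom_norm_le[OF at]]) auto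
    finally show ?thesis by simp
  qed
  have lim: "(\<lambda>n. (\<Sum>j. ennreal (c (e (j + n))))) \<longlonglongrightarrow> 0"
  proof -
    have "(\<Sum>j. ennreal (c (e (j + n)))) = ennreal (\<Sum>j. c (e (j + n)))" for n
      by (rule suminf_ennreal2) (use c summable_ignore_initial_segment[OF summ] in auto)
    moreover have "(\<lambda>n. ennreal (\<Sum>j. c (e (j + n)))) \<longlonglongrightarrow> ennreal 0"
      by (intro tendsto_ennrealI suminf_exist_split2 summ)
    ultimately show ?thesis by simp
  qed
  have conv: "(\<lambda>n. Lp_norm M 1 (\<lambda>x. b x - (\<Sum>j<n. ?t j x))) \<longlonglongrightarrow> 0"
    by (rule tendsto_sandwich[OF _ _ tendsto_const lim]) (auto simp: tail)
  have "((\<lambda>j. complex_of_real (c (e j))), (\<lambda>j. a (e j))) \<in> atomic_decompositions M \<R> b"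
    unfolding atomic_decompositions_def using at summ conv c by simp
  moreover have "Lp_norm M 1 b < \<infinity>" using tail[of 0] fin by (auto intro: le_less_trans)
  ultimately have "H1_norm M \<R> b \<le> (\<Sum>j. ennreal (cmod (complex_of_real (c (e j)))))"
    unfolding H1_norm_def space_of_def by (auto intro!: INF_lower2)
  then show ?thesis using total c by simp
qed simp

lemma BMO_norm_bounded:
  assumes "\<And>x. cmod (g x) \<le> B" shows "BMO_norm M \<R> g \<le> ennreal (2 * B)"
  unfolding BMO_norm_def
proof (rule SUP_least)
  fix R assume "R \<in> \<R>"
  then have fin: "finite R" and pos: "0 < sum w R" using finite_sets sum_w_pos nonempty_sets by auto
  have B: "0 \<le> B" using assms[of undefined] norm_ge_zero order_trans by blast
  have "cmod (\<Sum>x\<in>R. of_real (w x) * g x) \<le> (\<Sum>x\<in>R. w x * B)"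
    by (rule sum_norm_le) (auto simp: norm_mult w_nonneg intro!: mult_left_mono assms)
  also have "\<dots> = sum w R * B" by (rule sum_distrib_right[symmetric])
  finally have mean: "cmod (mean_on M R g) \<le> B"
    using pos by (simp add: mean_on_M[OF fin] norm_divide divide_le_eq mult.commute del: of_real_sum)
  have "cmod (g x - mean_on M R g) \<le> 2 * B" for x
    using norm_triangle_ineq4[of "g x" "mean_on M R g"] assms[of x] mean by linarith
  then have "(\<integral>\<^sup>+x\<in>R. ennreal (cmod (g x - mean_on M R g)) \<partial>M) \<le> (\<Sum>x\<in>R. ennreal (w x) * ennreal (2 * B))"
    unfolding set_nn_integral_M_finite[OF fin] by (intro sum_mono mult_left_mono ennreal_leI) auto
  also have "\<dots> = ennreal (2 * B) * emeasure M R"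
    by (simp add: emeasure_M[OF fin] sum_distrib_right[symmetric] sum_ennreal w_nonneg mult.commute)
  finally show "(\<integral>\<^sup>+x\<in>R. ennreal (cmod (g x - mean_on M R g)) \<partial>M) / emeasure M R \<le> ennreal (2 * B)"
    using pos by (intro divide_le_posI_ennreal) (auto simp: emeasure_M[OF fin] mult.commute)
qed

lemma BMO_norm_oscillation:
  assumes "R \<in> \<R>" "BMO_norm M \<R> f \<le> ennreal \<beta>" "0 \<le> \<beta>"
  shows "(\<Sum>x\<in>R. w x * cmod (f x - mean_on M R f)) \<le> \<beta> * sum w R"
proof -
  have fin: "finite R" and pos: "0 < sum w R" using assms(1) finite_sets sum_w_pos nonempty_sets by auto
  have "(\<integral>\<^sup>+x\<in>R. ennreal (cmod (f x - mean_on M R f)) \<partial>M) / emeasure M R \<le> ennreal \<beta>"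
    using assms(1,2) unfolding BMO_norm_def by (meson SUP_upper order_trans)
  then have "ennreal (\<Sum>x\<in>R. w x * cmod (f x - mean_on M R f)) / ennreal (sum w R) \<le> ennreal \<beta>"
    unfolding set_nn_integral_M_finite[OF fin] emeasure_M[OF fin]
    by (simp add: ennreal_mult[symmetric] w_nonneg)
  then have "(\<Sum>x\<in>R. w x * cmod (f x - mean_on M R f)) / sum w R \<le> \<beta>"
    using pos assms(3) by (subst (asm) divide_ennreal) (auto intro!: sum_nonneg simp: w_nonneg)
  then show ?thesis using pos by (simp add: divide_le_eq)
qed

end

section \<open>Calderon-Zygmund decompositions\<close>

text \<open>
  After an exchange of the summations, \<open>G x\<close> is counted by the vertices \<open>v\<close> of the class of \<open>x\<close>,
  whose relative weights add up to \<open>1\<close>.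
\<close>

lemma sum_partition_average:
  fixes G :: "'v \<Rightarrow> complex" and w :: "'v \<Rightarrow> real"
  assumes "finite A" "\<And>v. v \<in> A \<Longrightarrow> P v \<subseteq> A" "\<And>v. v \<in> A \<Longrightarrow> v \<in> P v"
    "\<And>u v. v \<in> A \<Longrightarrow> u \<in> P v \<Longrightarrow> P u = P v" "\<And>v. v \<in> A \<Longrightarrow> sum w (P v) \<noteq> 0"
  shows "(\<Sum>v\<in>A. of_real (w v) * (sum G (P v) / of_real (sum w (P v)))) = sum G A"
proof -
  have fin: "finite (P v)" if "v \<in> A" for v using assms(1,2) that by (meson finite_subset)
  let ?k = "\<lambda>v x. if x \<in> P v then of_real (w v / sum w (P v)) * G x else 0"
  have "(\<Sum>v\<in>A. of_real (w v) * (sum G (P v) / of_real (sum w (P v))))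
      = (\<Sum>v\<in>A. \<Sum>x\<in>A. ?k v x)"
  proof (rule sum.cong[OF refl])
    fix v assume v: "v \<in> A"
    have "(\<Sum>x\<in>A. ?k v x)
        = (\<Sum>x\<in>P v. of_real (w v / sum w (P v)) * G x)"
      using assms(1) assms(2)[OF v] by (simp add: sum.inter_restrict[symmetric] Int_absorb1)
    then show "of_real (w v) * (sum G (P v) / of_real (sum w (P v)))
        = (\<Sum>x\<in>A. ?k v x)"
      by (simp add: sum_distrib_left sum_divide_distrib del: of_real_sum)
  qed
  also have "\<dots> = (\<Sum>x\<in>A. \<Sum>v\<in>A. ?k v x)"
    by (rule sum.swap)
  also have "\<dots> = (\<Sum>x\<in>A. G x)"
  proof (rule sum.cong[OF refl])
    fix x assume x: "x \<in> A"
    have iff: "x \<in> P v \<longleftrightarrow> v \<in> P x" if "v \<in> A" for v using assms(3,4) x that by metis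
    have "(\<Sum>v\<in>A. ?k v x)
        = (\<Sum>v\<in>A. if v \<in> P x then of_real (w v / sum w (P x)) * G x else 0)"
      by (rule sum.cong[OF refl]) (use iff assms(4)[OF x] in auto)
    also have "\<dots> = (\<Sum>v\<in>P x. of_real (w v / sum w (P x)) * G x)"
      using assms(1) assms(2)[OF x] by (simp add: sum.inter_restrict[symmetric] Int_absorb1)
    also have "\<dots> = of_real (sum w (P x) / sum w (P x)) * G x"
      by (simp only: sum_distrib_right[symmetric] of_real_sum[symmetric] sum_divide_distrib[symmetric])
    finally show "(\<Sum>v\<in>A. ?k v x) = G x"
      using assms(5)[OF x] by simp
  qed
  finally show ?thesis .
qed

context dyadic_filtration
begin

lemma Q_pos: "0 < sum w (Q t v)"
  by (rule sum_w_pos) (use finite_Q Q_self[of v t] in blast)+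

lemma C_ge_1: "1 \<le> C"
proof -
  fix v :: 'v
  have "sum w (Q 0 v) \<le> sum w (Q (Suc 0) v)"
    by (rule sum_mono2) (use finite_Q Q_Suc w_nonneg in auto)
  also have "\<dots> \<le> C * sum w (Q 0 v)" by (rule Q_doubling)
  finally show ?thesis using Q_pos[of 0 v] by simp
qed

lemma Q_mono: "t \<le> t' \<Longrightarrow> Q t v \<subseteq> Q t' v"
  by (rule lift_Suc_mono_le[of "\<lambda>t. Q t v"]) (use Q_Suc in auto)

lemma Q_eq_later: "u \<in> Q t v \<Longrightarrow> t \<le> t' \<Longrightarrow> Q t' u = Q t' v"
  using Q_mono Q_eq by blast

definition mean_abs :: "('v \<Rightarrow> complex) \<Rightarrow> nat \<Rightarrow> 'v \<Rightarrow> real" where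
  "mean_abs f t v = (\<Sum>u\<in>Q t v. w u * cmod (f u)) / sum w (Q t v)"

definition vanishing :: "('v \<Rightarrow> complex) \<Rightarrow> bool" where
  "vanishing f \<longleftrightarrow> (\<forall>v. (\<lambda>t. mean_abs f t v) \<longlonglongrightarrow> 0)"

text \<open>
  The set of times at which the mean exceeds \<open>l\<close> may be empty. The convention that the stopping time
  is \<open>0\<close> then makes the stopping class a single vertex, on which averaging does nothing.
\<close>

definition stopping_time :: "('v \<Rightarrow> complex) \<Rightarrow> real \<Rightarrow> 'v \<Rightarrow> nat" where
  "stopping_time f l v = Max (insert 0 {t. l < mean_abs f t v})"

definition stopping_class :: "('v \<Rightarrow> complex) \<Rightarrow> real \<Rightarrow> 'v \<Rightarrow> 'v set" where
  "stopping_class f l v = Q (stopping_time f l v) v"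

definition exceedance :: "('v \<Rightarrow> complex) \<Rightarrow> real \<Rightarrow> 'v set" where
  "exceedance f l = {v. \<exists>t. l < mean_abs f t v}"

definition good_part :: "('v \<Rightarrow> complex) \<Rightarrow> real \<Rightarrow> 'v \<Rightarrow> complex" where
  "good_part f l v = (\<Sum>u\<in>stopping_class f l v. of_real (w u) * f u) / of_real (sum w (stopping_class f l v))"

definition layer :: "('v \<Rightarrow> complex) \<Rightarrow> real \<Rightarrow> 'v \<Rightarrow> complex" where
  "layer f l v = good_part f (2 * l) v - good_part f l v"

lemma finite_stopping_class: "finite (stopping_class f l v)"
  and stopping_class_self: "v \<in> stopping_class f l v"
  and stopping_class_pos: "0 < sum w (stopping_class f l v)"
  unfolding stopping_class_def using finite_Q Q_self Q_pos by auto

lemma mean_abs_cong: "u \<in> Q t v \<Longrightarrow> t \<le> t' \<Longrightarrow> mean_abs f t' u = mean_abs f t' v"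
  unfolding mean_abs_def by (simp add: Q_eq_later)

lemma finite_exceeding_times:
  assumes "vanishing f" "0 < l" shows "finite {t. l < mean_abs f t v}"
proof -
  have "eventually (\<lambda>t. mean_abs f t v < l) sequentially"
    using assms unfolding vanishing_def by (intro order_tendstoD(2)[of _ 0]) auto
  then obtain t0 where "\<And>t. t \<ge> t0 \<Longrightarrow> mean_abs f t v < l" by (auto simp: eventually_sequentially)
  then have "{t. l < mean_abs f t v} \<subseteq> {..<t0}" by (auto simp: not_less[symmetric] dest: less_asym)
  then show ?thesis by (rule finite_subset) simp
qed

lemma le_stopping_time:
  "vanishing f \<Longrightarrow> 0 < l \<Longrightarrow> l < mean_abs f t v \<Longrightarrow> t \<le> stopping_time f l v"
  unfolding stopping_time_def using finite_exceeding_times by (intro Max_ge) auto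

lemma mean_abs_later:
  "vanishing f \<Longrightarrow> 0 < l \<Longrightarrow> stopping_time f l v < t \<Longrightarrow> mean_abs f t v \<le> l"
  using le_stopping_time[of f l t v] by force

lemma stopping_time_cases:
  assumes "vanishing f" "0 < l"
  shows "stopping_time f l v = 0 \<or> l < mean_abs f (stopping_time f l v) v"
  unfolding stopping_time_def
  using Max_in[of "insert 0 {t. l < mean_abs f t v}"] finite_exceeding_times[OF assms, of v] by auto

lemma exceedance_iff:
  assumes "vanishing f" "0 < l"
  shows "v \<in> exceedance f l \<longleftrightarrow> l < mean_abs f (stopping_time f l v) v"
proof
  assume "v \<in> exceedance f l"
  then obtain t where t: "l < mean_abs f t v" by (auto simp: exceedance_def)
  then have "stopping_time f l v = 0 \<Longrightarrow> t = 0" using le_stopping_time[OF assms t] by simp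
  then show "l < mean_abs f (stopping_time f l v) v" using stopping_time_cases[OF assms, of v] t by auto
qed (auto simp: exceedance_def)

lemma stopping_time_outside: "v \<notin> exceedance f l \<Longrightarrow> stopping_time f l v = 0"
  by (simp add: exceedance_def stopping_time_def)

lemma stopping_time_cong:
  assumes "vanishing f" "0 < l" "u \<in> stopping_class f l v"
  shows "stopping_time f l u = stopping_time f l v"
proof -
  let ?T = "stopping_time f l v"
  have later: "mean_abs f t u = mean_abs f t v" if "?T \<le> t" for t
    using assms(3) that mean_abs_cong unfolding stopping_class_def by blast
  have "stopping_time f l u \<le> ?T"
  proof (rule ccontr)
    assume "\<not> ?thesis"
    then have *: "?T < stopping_time f l u" by simp
    then have "l < mean_abs f (stopping_time f l u) u" using stopping_time_cases[OF assms(1,2), of u] by auto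
    then show False using later[of "stopping_time f l u"] mean_abs_later[OF assms(1,2) *] * by auto
  qed
  moreover have "?T \<le> stopping_time f l u"
    using stopping_time_cases[OF assms(1,2), of v] later[of ?T] le_stopping_time[OF assms(1,2)] by fastforce
  ultimately show ?thesis by simp
qed

lemma stopping_class_eq:
  assumes "vanishing f" "0 < l" "u \<in> stopping_class f l v"
  shows "stopping_class f l u = stopping_class f l v"
  using stopping_time_cong[OF assms] assms(3) Q_eq unfolding stopping_class_def by auto

lemma exceedance_stopping_class:
  assumes "vanishing f" "0 < l" "u \<in> stopping_class f l v"
  shows "u \<in> exceedance f l \<longleftrightarrow> v \<in> exceedance f l"
proof -
  have "mean_abs f (stopping_time f l v) u = mean_abs f (stopping_time f l v) v"
    using assms(3) mean_abs_cong unfolding stopping_class_def by blast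
  then show ?thesis
    by (simp add: exceedance_iff[OF assms(1,2)] stopping_time_cong[OF assms])
qed

lemma stopping_class_antimono:
  assumes "vanishing f" "0 < l" "l \<le> l'"
  shows "stopping_class f l' v \<subseteq> stopping_class f l v"
proof -
  have "stopping_time f l' v \<le> stopping_time f l v"
    unfolding stopping_time_def
    by (rule Max_mono) (use finite_exceeding_times[OF assms(1,2)] assms in auto)
  then show ?thesis unfolding stopping_class_def by (rule Q_mono)
qed

lemma good_part_le: "cmod (good_part f l v) \<le> mean_abs f (stopping_time f l v) v"
proof -
  have "cmod (\<Sum>u\<in>stopping_class f l v. of_real (w u) * f u) \<le> (\<Sum>u\<in>stopping_class f l v. w u * cmod (f u))"
    by (rule sum_norm_le) (simp add: norm_mult w_nonneg)
  then show ?thesis using stopping_class_pos[of f l v]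
    unfolding good_part_def mean_abs_def stopping_class_def[symmetric]
    by (simp add: norm_divide divide_right_mono del: of_real_sum)
qed

text \<open>The class of the next time already has mean at most \<open>l\<close> and is at most \<open>C\<close> times as large.\<close>

lemma good_part_bound:
  assumes "vanishing f" "0 < l" shows "cmod (good_part f l v) \<le> C * l"
proof -
  let ?T = "stopping_time f l v"
  have "(\<Sum>u\<in>Q ?T v. w u * cmod (f u)) \<le> (\<Sum>u\<in>Q (Suc ?T) v. w u * cmod (f u))"
    by (rule sum_mono2) (use finite_Q Q_Suc w_nonneg in auto)
  also have "\<dots> \<le> l * sum w (Q (Suc ?T) v)"
    using mean_abs_later[OF assms, of v "Suc ?T"] Q_pos[of "Suc ?T" v] by (simp add: mean_abs_def divide_le_eq)
  also have "\<dots> \<le> l * (C * sum w (Q ?T v))"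
    by (rule mult_left_mono[OF Q_doubling]) (use assms in auto)
  finally have "mean_abs f ?T v \<le> C * l"
    using Q_pos[of ?T v] by (simp add: mean_abs_def divide_le_eq mult_ac)
  then show ?thesis using good_part_le order_trans by blast
qed

lemma good_part_stop_0: "stopping_time f l v = 0 \<Longrightarrow> good_part f l v = f v"
  using w_pos[of v] by (simp add: good_part_def stopping_class_def Q_0)

lemma layer_bound:
  assumes "vanishing f" "0 < l" shows "cmod (layer f l v) \<le> 3 * C * l"
  using norm_triangle_ineq4[of "good_part f (2 * l) v" "good_part f l v"]
    good_part_bound[OF assms, of v] good_part_bound[OF assms(1), of "2 * l" v] assms(2)
  unfolding layer_def by simp

lemma layer_outside:
  assumes "0 < l" "v \<notin> exceedance f l" shows "layer f l v = 0"
proof -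
  have "v \<notin> exceedance f (2 * l)" using assms unfolding exceedance_def by (smt (verit) mem_Collect_eq)
  then show ?thesis using assms(2) by (simp add: layer_def good_part_stop_0 stopping_time_outside)
qed

lemma sum_good_part:
  assumes "vanishing f" "0 < l" "l \<le> l'"
  shows "(\<Sum>u\<in>stopping_class f l v. of_real (w u) * good_part f l' u)
    = (\<Sum>u\<in>stopping_class f l v. of_real (w u) * f u)"
  unfolding good_part_def
proof (rule sum_partition_average)
  have l': "0 < l'" using assms by simp
  fix y assume y: "y \<in> stopping_class f l v"
  show "stopping_class f l' y \<subseteq> stopping_class f l v"
    using stopping_class_antimono[OF assms, of y] stopping_class_eq[OF assms(1,2) y] by simp
  show "y \<in> stopping_class f l' y" by (rule stopping_class_self)
  show "sum w (stopping_class f l' y) \<noteq> 0" using stopping_class_pos by (simp add: less_imp_neq[symmetric])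
  show "u \<in> stopping_class f l' y \<Longrightarrow> stopping_class f l' u = stopping_class f l' y" for u
    by (rule stopping_class_eq[OF assms(1) l'])
qed (rule finite_stopping_class)

text \<open>
  The stopping classes for the height \<open>2 l\<close> that meet a class for the height \<open>l\<close> partition it. So
  both good parts have the same integral over it as \<open>f\<close>.
\<close>

lemma sum_layer:
  assumes "vanishing f" "0 < l"
  shows "(\<Sum>u\<in>stopping_class f l v. of_real (w u) * layer f l u) = 0"
  using sum_good_part[OF assms, of "2 * l" v] sum_good_part[OF assms, of l v] assms(2)
  by (simp add: layer_def algebra_simps sum_subtractf)

lemma nn_integral_average:
  assumes "vanishing f" "0 < l"
  shows "(\<integral>\<^sup>+v. (\<Sum>x\<in>stopping_class f l v. ennreal (w x) * h x) / ennreal (sum w (stopping_class f l v)) \<partial>M)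
    = (\<integral>\<^sup>+x. h x \<partial>M)"
proof -
  let ?P = "stopping_class f l"
  let ?k = "\<lambda>v x. ennreal (w x) * h x * ennreal (w v / sum w (?P v))"
  have sym: "x \<in> ?P v \<longleftrightarrow> v \<in> ?P x" for x v
    using stopping_class_eq[OF assms] stopping_class_self by metis
  have "(\<integral>\<^sup>+v. (\<Sum>x\<in>?P v. ennreal (w x) * h x) / ennreal (sum w (?P v)) \<partial>M)
    = (\<integral>\<^sup>+v. (\<integral>\<^sup>+x. ?k v x * indicator (?P v) x \<partial>count_space UNIV) \<partial>count_space UNIV)"
    unfolding nn_integral_M
  proof (rule nn_integral_cong)
    fix v
    have "(\<integral>\<^sup>+x. ?k v x * indicator (?P v) x \<partial>count_space UNIV)
        = (\<Sum>x\<in>?P v. ?k v x)"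
      by (subst nn_integral_count_space'[OF finite_stopping_class[of f l v]]) auto
    also have "\<dots> = ennreal (w v) * ((\<Sum>x\<in>?P v. ennreal (w x) * h x) / ennreal (sum w (?P v)))"
    proof -
      have "ennreal (w v / sum w (?P v)) = ennreal (w v) * inverse (ennreal (sum w (?P v)))"
        using stopping_class_pos[of f l v]
        by (simp add: divide_ennreal[symmetric] w_nonneg divide_ennreal_def)
      moreover have "(\<Sum>x\<in>?P v. ?k v x)
          = (\<Sum>x\<in>?P v. ennreal (w x) * h x) * ennreal (w v / sum w (?P v))"
        by (rule sum_distrib_right[symmetric])
      ultimately show ?thesis by (simp add: divide_ennreal_def mult_ac)
    qed
    finally show "ennreal (w v) * ((\<Sum>x\<in>?P v. ennreal (w x) * h x) / ennreal (sum w (?P v)))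
       = (\<integral>\<^sup>+x. ?k v x * indicator (?P v) x \<partial>count_space UNIV)" ..
  qed
  also have "\<dots> = (\<integral>\<^sup>+x. (\<integral>\<^sup>+v. ?k v x * indicator (?P v) x \<partial>count_space UNIV) \<partial>count_space UNIV)"
    by (rule nn_integral_count_space_nn_integral[OF countable_vertices]) simp
  also have "\<dots> = (\<integral>\<^sup>+x. ennreal (w x) * h x \<partial>count_space UNIV)"
  proof (rule nn_integral_cong)
    fix x
    have "(\<integral>\<^sup>+v. ?k v x * indicator (?P v) x \<partial>count_space UNIV)
        = (\<Sum>v\<in>?P x. ?k v x * indicator (?P v) x)"
      by (rule nn_integral_count_space'[OF finite_stopping_class[of f l x]]) (auto simp: sym)
    also have "\<dots> = (\<Sum>v\<in>?P x. ennreal (w x) * h x * ennreal (w v / sum w (?P x)))"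
      by (rule sum.cong[OF refl]) (use sym stopping_class_eq[OF assms] stopping_class_self in auto)
    also have "\<dots> = ennreal (w x) * h x * ennreal (sum w (?P x) / sum w (?P x))"
      unfolding sum_distrib_left[symmetric]
      by (subst sum_ennreal) (use stopping_class_pos[of f l x] w_nonneg in \<open>auto simp: sum_divide_distrib[symmetric]\<close>)
    finally show "(\<integral>\<^sup>+v. ?k v x * indicator (?P v) x \<partial>count_space UNIV)
      = ennreal (w x) * h x" using stopping_class_pos[of f l x] by simp
  qed
  finally show ?thesis unfolding nn_integral_M .
qed

text \<open>
  On a stopping class with mean above \<open>l\<close>, the values of at most \<open>l / 2\<close> contribute at most half of
  the mean.
\<close>

lemma exceedance_weak_type:
  assumes "vanishing f" "0 < l"
  shows "(\<integral>\<^sup>+v. indicator (exceedance f l) v \<partial>M)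
    \<le> (\<integral>\<^sup>+x. ennreal (2 / l * cmod (f x)) * indicator {x. l < 2 * cmod (f x)} x \<partial>M)"
proof -
  let ?P = "stopping_class f l"
  let ?h = "\<lambda>x. 2 / l * cmod (f x) * indicator {x. l < 2 * cmod (f x)} x"
  have h: "0 \<le> ?h x" for x using assms by simp
  have "(\<integral>\<^sup>+v. indicator (exceedance f l) v \<partial>M) \<le>
     (\<integral>\<^sup>+v. (\<Sum>x\<in>?P v. ennreal (w x) * ennreal (?h x)) / ennreal (sum w (?P v)) \<partial>M)"
  proof (rule nn_integral_mono)
    fix v
    show "indicator (exceedance f l) v \<le> (\<Sum>x\<in>?P v. ennreal (w x) * ennreal (?h x)) / ennreal (sum w (?P v))"
    proof (cases "v \<in> exceedance f l")
      case True
      have "l * sum w (?P v) < (\<Sum>x\<in>?P v. w x * cmod (f x))"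
        using True stopping_class_pos[of f l v] unfolding exceedance_iff[OF assms]
        by (simp add: mean_abs_def stopping_class_def less_divide_eq)
      also have "\<dots> \<le> (\<Sum>x\<in>?P v. w x * (l / 2 * ?h x + l / 2))"
        by (rule sum_mono, rule mult_left_mono) (use assms w_nonneg in \<open>auto simp: indicator_def\<close>)
      also have "\<dots> = l / 2 * (\<Sum>x\<in>?P v. w x * ?h x) + l / 2 * sum w (?P v)"
        by (simp only: sum_distrib_left sum.distrib distrib_left mult_ac)
      finally have "l / 2 * sum w (?P v) \<le> l / 2 * (\<Sum>x\<in>?P v. w x * ?h x)" by simp
      then have "sum w (?P v) \<le> (\<Sum>x\<in>?P v. w x * ?h x)"
        using assms(2) by (subst (asm) mult_le_cancel_left_pos) auto
      then have "1 \<le> (\<Sum>x\<in>?P v. w x * ?h x) / sum w (?P v)" using stopping_class_pos[of f l v] by simp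
      then have "1 \<le> ennreal ((\<Sum>x\<in>?P v. w x * ?h x) / sum w (?P v))"
        using ennreal_leI[of 1] by simp
      also have "ennreal ((\<Sum>x\<in>?P v. w x * ?h x) / sum w (?P v))
          = ennreal (\<Sum>x\<in>?P v. w x * ?h x) / ennreal (sum w (?P v))"
        by (rule divide_ennreal[symmetric, OF sum_nonneg[OF mult_nonneg_nonneg[OF w_nonneg h]] stopping_class_pos])
      also have "ennreal (\<Sum>x\<in>?P v. w x * ?h x) = (\<Sum>x\<in>?P v. ennreal (w x) * ennreal (?h x))"
      proof -
        have "ennreal (\<Sum>x\<in>?P v. w x * ?h x) = (\<Sum>x\<in>?P v. ennreal (w x * ?h x))"
          by (rule sum_ennreal[symmetric], rule mult_nonneg_nonneg[OF w_nonneg h])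
        also have "\<dots> = (\<Sum>x\<in>?P v. ennreal (w x) * ennreal (?h x))"
          by (rule sum.cong[OF refl], rule ennreal_mult[OF w_nonneg h])
        finally show ?thesis .
      qed
      finally show ?thesis using True by (simp only: indicator_simps)
    qed simp
  qed
  also have "\<dots> = (\<integral>\<^sup>+x. ennreal (?h x) \<partial>M)" by (rule nn_integral_average[OF assms])
  also have "\<dots> = (\<integral>\<^sup>+x. ennreal (2 / l * cmod (f x)) * indicator {x. l < 2 * cmod (f x)} x \<partial>M)"
    by (rule nn_integral_cong) (auto simp: indicator_def)
  finally show ?thesis .
qed

lemma good_part_eventually:
  assumes "vanishing f" "0 < l" shows "\<exists>n. good_part f (l * 2 ^ n) v = f v \<and> (\<forall>i\<ge>n. v \<notin> exceedance f (l * 2 ^ i))"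
proof -
  have "Bseq (\<lambda>t. mean_abs f t v)"
    using assms(1) unfolding vanishing_def by (intro convergent_imp_Bseq) (auto simp: convergent_def)
  then obtain B where B: "\<And>t. \<bar>mean_abs f t v\<bar> \<le> B" by (auto simp: Bseq_def)
  obtain n where n: "B / l < 2 ^ n" using real_arch_pow[of 2 "B / l"] by auto
  have "v \<notin> exceedance f (l * 2 ^ i)" if "i \<ge> n" for i
  proof -
    have "B < l * 2 ^ n" using n assms by (simp add: divide_less_eq mult.commute)
    also have "\<dots> \<le> l * 2 ^ i" using assms that by (intro mult_left_mono power_increasing) auto
    finally have "mean_abs f t v \<le> l * 2 ^ i" for t using B[of t] by linarith
    then show ?thesis by (auto simp: exceedance_def not_less)
  qed
  then show ?thesis using good_part_stop_0[OF stopping_time_outside] by blast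
qed

lemma sum_layers: "(\<Sum>i<n. layer f (l * 2 ^ i) v) = good_part f (l * 2 ^ n) v - good_part f l v"
  by (induction n) (auto simp: layer_def mult_ac)

end

section \<open>Functions in \<open>L\<^sup>r\<close> belong to the interpolation space\<close>

text \<open>With an optimal choice of \<open>\<epsilon>\<close> this replaces Hoelder's inequality up to a factor \<open>2\<close>.\<close>

lemma le_split_powr:
  fixes y \<epsilon> r :: real
  assumes "0 \<le> y" "0 < \<epsilon>" "1 \<le> r" shows "y \<le> \<epsilon> + \<epsilon> powr (1 - r) * y powr r"
proof (cases "y \<le> \<epsilon>")
  case False
  then have "y = y powr (1 - r) * y powr r" using assms by (simp add: powr_add[symmetric])
  also have "\<dots> \<le> \<epsilon> powr (1 - r) * y powr r"
    using False assms by (intro mult_right_mono powr_mono2') auto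
  finally show ?thesis using assms by linarith
qed (use assms in \<open>simp add: add_increasing2\<close>)

context dyadic_filtration
begin

text \<open>
  The bad part is the sum of its layers, each of which has integral zero on every stopping class for
  its own height.
  A layer is decomposed into its restrictions to the classes. Indexing them by all vertices \<open>v\<close>
  of the class with weight \<open>w v / sum w (stopping_class f l v)\<close> avoids a choice of representatives.
\<close>

lemma H1_bad_part_layers:
  assumes f: "vanishing f" and l: "0 < l"
  shows "H1_norm M \<R> (\<lambda>x. f x - good_part f l x)
    \<le> (\<Sum>i. ennreal (3 * C\<^sup>2 * (l * 2 ^ i)) * (\<integral>\<^sup>+v. indicator (exceedance f (l * 2 ^ i)) v \<partial>M))"
proof -
  define L where "L = (\<lambda>i::nat. l * 2 ^ i)"
  have L: "0 < L i" for i using l by (simp add: L_def)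
  define P where "P = (\<lambda>i. stopping_class f (L i))"
  define E where "E = (\<lambda>i. exceedance f (L i))"
  define B where "B = (\<lambda>i. 3 * C * L i)"
  have C0: "0 < C" using C_ge_1 by simp
  have B: "0 < B i" for i using L C0 by (simp add: B_def)
  have "\<exists>R. R \<in> \<R> \<and> P i v \<subseteq> R \<and> sum w R \<le> C * sum w (P i v)" for i v
    unfolding P_def stopping_class_def using Q_enlarge by blast
  then obtain R where R: "\<And>i v. R i v \<in> \<R>" "\<And>i v. P i v \<subseteq> R i v"
      "\<And>i v. sum w (R i v) \<le> C * sum w (P i v)" by metis
  have R_pos: "0 < sum w (R i v)" for i v using R(1) finite_sets nonempty_sets sum_w_pos by blast
  have P_pos: "0 < sum w (P i v)" for i v unfolding P_def by (rule stopping_class_pos)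
  have P_sym: "x \<in> P i v \<longleftrightarrow> v \<in> P i x" for i x v
    unfolding P_def using stopping_class_eq[OF f L] stopping_class_self by metis
  have P_eq: "x \<in> P i v \<Longrightarrow> P i x = P i v" for i x v
    unfolding P_def by (rule stopping_class_eq[OF f L])
  have E_iff: "x \<in> P i v \<Longrightarrow> x \<in> E i \<longleftrightarrow> v \<in> E i" for i x v
    unfolding P_def E_def by (rule exceedance_stopping_class[OF f L])
  define c where "c = (\<lambda>(i, v). if v \<in> E i then w v / sum w (P i v) * (B i * sum w (R i v)) else 0)"
  define a where "a = (\<lambda>(i, v) x. if v \<in> E i \<and> x \<in> P i v
      then layer f (L i) x / of_real (B i * sum w (R i v)) else 0)"
  obtain n where n: "\<And>x. good_part f (L (n x)) x = f x" "\<And>x i. n x \<le> i \<Longrightarrow> x \<notin> E i"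
    using good_part_eventually[OF f l] unfolding L_def E_def by metis
  define S where "S = (\<lambda>x. Sigma {..<n x} (\<lambda>i. P i x))"
  have atoms: "atom M \<R> (a p)" for p
  proof -
    obtain i v where p: "p = (i, v)" by (cases p)
    have fin: "finite (R i v)" using R(1) finite_sets by blast
    have supp: "\<forall>x. x \<notin> R i v \<longrightarrow> a p x = 0" using R(2)[of i v] by (auto simp: p a_def)
    have bound: "cmod (a p x) \<le> 1 / measure M (R i v)" for x
    proof (cases "v \<in> E i \<and> x \<in> P i v")
      case True
      have "cmod (a p x) = cmod (layer f (L i) x) / (B i * sum w (R i v))"
        using True B[of i] R_pos[of i v] by (simp add: p a_def norm_divide norm_mult del: of_real_sum)
      also have "\<dots> \<le> B i / (B i * sum w (R i v))"
        using layer_bound[OF f L, of i x] B[of i] R_pos[of i v]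
        by (intro divide_right_mono) (auto simp: B_def)
      finally show ?thesis using B[of i] by (simp add: measure_M[OF fin])
    next
      case False
      then show ?thesis by (auto simp: p a_def)
    qed
    have "(\<integral>x. a p x \<partial>M) = (\<Sum>x\<in>P i v. of_real (w x) * a p x)"
      by (rule integral_M_finite) (auto simp: p a_def P_def finite_stopping_class)
    also have "\<dots> = (if v \<in> E i then (\<Sum>x\<in>P i v. of_real (w x) * layer f (L i) x) / of_real (B i * sum w (R i v)) else 0)"
      by (auto simp: p a_def sum_divide_distrib simp del: of_real_sum of_real_mult)
    also have "\<dots> = 0" using sum_layer[OF f L, of i v] by (simp add: P_def)
    finally show ?thesis unfolding atom_def AE_M using R(1) supp bound by blast
  qed
  have c_nonneg: "0 \<le> c p" for p
    using B R_pos P_pos w_nonneg by (cases p) (auto simp: c_def less_imp_le)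
  have "H1_norm M \<R> (\<lambda>x. f x - good_part f l x) \<le> (\<integral>\<^sup>+p. ennreal (c p) \<partial>count_space UNIV)"
  proof (rule H1_norm_atomic_sum[where a = a and S = S])
    show "countable (UNIV :: (nat \<times> 'v) set)"
      using countable_vertices by (metis UNIV_Times_UNIV countable_SIGMA countableI_type)
    show "infinite (UNIV :: (nat \<times> 'v) set)"
      by (simp add: finite_prod infinite_UNIV_nat)
    show "finite (S x)" for x unfolding S_def P_def using finite_stopping_class by blast
    show "c p = 0 \<or> a p x = 0" if "p \<notin> S x" for x p
    proof -
      obtain i v where p: "p = (i, v)" by (cases p)
      have "\<not> (v \<in> E i \<and> x \<in> P i v)"
        using that n(2)[of x i] E_iff[of x i v] P_sym[of x i v] by (auto simp: p S_def not_less)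
      then show ?thesis by (auto simp: p a_def)
    qed
    fix x
    have inner: "(\<Sum>v\<in>P i x. of_real (c (i, v)) * a (i, v) x) = layer f (L i) x" for i
    proof (cases "x \<in> E i")
      case True
      have "(\<Sum>v\<in>P i x. of_real (c (i, v)) * a (i, v) x)
          = (\<Sum>v\<in>P i x. of_real (w v / sum w (P i x)) * layer f (L i) x)"
      proof (rule sum.cong[OF refl])
        fix v assume v: "v \<in> P i x"
        then have "v \<in> E i" "x \<in> P i v" "P i v = P i x" using True E_iff[OF v] P_sym[of x i v] P_eq[OF v] by auto
        then show "of_real (c (i, v)) * a (i, v) x = of_real (w v / sum w (P i x)) * layer f (L i) x"
          using B[of i] R_pos[of i v] by (simp add: c_def a_def del: of_real_sum)
      qed
      also have "\<dots> = of_real (sum w (P i x) / sum w (P i x)) * layer f (L i) x"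
        by (simp only: sum_distrib_right[symmetric] of_real_sum[symmetric] sum_divide_distrib[symmetric])
      finally show ?thesis using P_pos[of i x] by simp
    next
      case False
      then have "c (i, v) = 0" if "v \<in> P i x" for v using that E_iff by (auto simp: c_def)
      then show ?thesis using False layer_outside[OF L] by (simp add: E_def)
    qed
    have "f x - good_part f l x = (\<Sum>i<n x. layer f (L i) x)"
      using sum_layers[of f l x "n x"] n(1)[of x] by (simp add: L_def)
    also have "\<dots> = (\<Sum>i<n x. \<Sum>v\<in>P i x. of_real (c (i, v)) * a (i, v) x)" by (simp add: inner)
    also have "\<dots> = (\<Sum>p\<in>S x. of_real (c p) * a p x)"
      unfolding S_def by (subst sum.Sigma) (auto simp: P_def finite_stopping_class)
    finally show "f x - good_part f l x = (\<Sum>p\<in>S x. of_real (c p) * a p x)" .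
  qed (use atoms c_nonneg in auto)
  also have "\<dots> = (\<Sum>i. \<integral>\<^sup>+v. ennreal (c (i, v)) \<partial>count_space UNIV)"
    unfolding nn_integral_fst_count_space[symmetric] nn_integral_count_space_nat ..
  also have "\<dots> \<le> (\<Sum>i. ennreal (3 * C\<^sup>2 * L i) * (\<integral>\<^sup>+v. indicator (E i) v \<partial>M))"
  proof (rule suminf_le)
    fix i
    have "ennreal (c (i, v)) \<le> ennreal (3 * C\<^sup>2 * L i) * (ennreal (w v) * indicator (E i) v)" for v
    proof (cases "v \<in> E i")
      case True
      have "w v / sum w (P i v) * (B i * sum w (R i v)) \<le> w v / sum w (P i v) * (B i * (C * sum w (P i v)))"
        by (intro mult_left_mono R(3)) (use B[of i] P_pos[of i v] w_nonneg[of v] in auto)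
      also have "\<dots> = 3 * C\<^sup>2 * L i * w v"
        using P_pos[of i v] by (simp add: B_def power2_eq_square)
      finally show ?thesis
        using True L[of i] C0 w_nonneg[of v]
        by (simp add: c_def ennreal_mult[symmetric] ennreal_leI)
    qed (simp add: c_def)
    then have "(\<integral>\<^sup>+v. ennreal (c (i, v)) \<partial>count_space UNIV)
        \<le> (\<integral>\<^sup>+v. ennreal (3 * C\<^sup>2 * L i) * (ennreal (w v) * indicator (E i) v) \<partial>count_space UNIV)"
      by (rule nn_integral_mono)
    also have "\<dots> = ennreal (3 * C\<^sup>2 * L i) * (\<integral>\<^sup>+v. indicator (E i) v \<partial>M)"
      unfolding nn_integral_M by (rule nn_integral_cmult) simp
    finally show "(\<integral>\<^sup>+v. ennreal (c (i, v)) \<partial>count_space UNIV)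
        \<le> ennreal (3 * C\<^sup>2 * L i) * (\<integral>\<^sup>+v. indicator (E i) v \<partial>M)" .
  qed auto
  finally show ?thesis unfolding E_def L_def .
qed

text \<open>
  The number of terms is logarithmic in \<open>u / l\<close>; a small power is easier to integrate against.
\<close>

lemma card_dyadic_below:
  assumes "0 < l" "0 < \<epsilon>" "0 \<le> u"
  shows "finite {i::nat. l * 2 ^ i < u}"
    and "real (card {i::nat. l * 2 ^ i < u}) \<le> (u / l) powr \<epsilon> / (1 - 2 powr - \<epsilon>)"
proof -
  let ?S = "{i::nat. l * 2 ^ i < u}"
  obtain k where k: "u / l < 2 ^ k" using real_arch_pow[of 2 "u / l"] by auto
  have "?S \<subseteq> {..<k}"
  proof
    fix i assume "i \<in> ?S"
    then have "2 ^ i < u / l" using assms by (simp add: less_divide_eq mult.commute)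
    then have "(2::real) ^ i < 2 ^ k" using k by linarith
    then show "i \<in> {..<k}" by (simp add: power_less_imp_less_exp)
  qed
  then show fin: "finite ?S" by (rule finite_subset) simp
  have pos: "0 < 1 - 2 powr - \<epsilon>" using assms powr_less_mono[of "- \<epsilon>" 0 2] by simp
  show "real (card ?S) \<le> (u / l) powr \<epsilon> / (1 - 2 powr - \<epsilon>)"
  proof (cases "?S = {}")
    case True
    then have "card ?S = 0" by (simp only: card.empty)
    then show ?thesis using pos by simp
  next
    case False
    have "real (card ?S) = (\<Sum>i\<in>?S. 1)" by simp
    also have "\<dots> \<le> (\<Sum>i\<in>?S. (1 * 2 ^ i) powr \<epsilon>)"
      by (rule sum_mono) (use assms in \<open>simp add: ge_one_powr_ge_zero\<close>)
    also have "\<dots> \<le> (1 * 2 ^ Max ?S) powr \<epsilon> / (1 - 2 powr - \<epsilon>)"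
      by (rule geometric_sum_powr) (use assms fin False in auto)
    also have "\<dots> \<le> (u / l) powr \<epsilon> / (1 - 2 powr - \<epsilon>)"
    proof (intro divide_right_mono powr_mono2)
      have "Max ?S \<in> ?S" using fin False by (rule Max_in)
      then show "1 * 2 ^ Max ?S \<le> u / l" using assms by (simp add: le_divide_eq mult.commute less_imp_le)
    qed (use pos assms in auto)
    finally show ?thesis .
  qed
qed

text \<open>
  A common bound, up to constants, for the \<open>p\<close>-th power of the \<open>L\<^sup>p\<close> norm of \<open>f\<close> truncated from below
  at height \<open>l\<close> and, when \<open>p = 1\<close>, for the \<open>H\<^sup>1\<close> norm of the sum of the layers above \<open>l\<close>.
\<close>

definition tail_integral :: "real \<Rightarrow> real \<Rightarrow> ('v \<Rightarrow> complex) \<Rightarrow> real \<Rightarrow> ennreal" where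
  "tail_integral p \<epsilon> f l = (\<integral>\<^sup>+x. ennreal (cmod (f x) powr (p + \<epsilon>) * l powr - \<epsilon>) *
     indicator {x. l < 2 * cmod (f x)} x \<partial>M)"

text \<open>
  The layer at height \<open>l 2\<^sup>i\<close> costs a multiple of \<open>\<integral> |f|\<close> over the set where \<open>2 |f| > l 2\<^sup>i\<close>. In the sum
  over all \<open>i\<close> the value of \<open>|f|\<close> at a vertex is thus multiplied by the number of the layers that it
  contributes to, which is estimated by \<open>card_dyadic_below\<close>.
\<close>

lemma H1_bad_part:
  assumes f: "vanishing f" and l: "0 < l" and \<epsilon>: "0 < \<epsilon>"
  shows "H1_norm M \<R> (\<lambda>x. f x - good_part f l x)
    \<le> ennreal (6 * C\<^sup>2 * 2 powr \<epsilon> / (1 - 2 powr - \<epsilon>)) * tail_integral 1 \<epsilon> f l"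
proof -
  let ?ind = "\<lambda>i x. indicator {x. l * 2 ^ i < 2 * cmod (f x)} x"
  let ?g = "\<lambda>i x. ennreal (6 * C\<^sup>2 * cmod (f x)) * ?ind i x"
  let ?i = "\<lambda>l. \<integral>\<^sup>+v. indicator (exceedance f l) v \<partial>M"
  define A where "A = 1 - 2 powr - \<epsilon>"
  have A: "0 < A" using \<epsilon> powr_less_mono[of "- \<epsilon>" 0 2] by (simp add: A_def)
  have "ennreal (3 * C\<^sup>2 * (l * 2 ^ i)) * ?i (l * 2 ^ i)
     \<le> (\<integral>\<^sup>+x. ?g i x \<partial>M)" for i
  proof -
    have "ennreal (3 * C\<^sup>2 * (l * 2 ^ i)) * ?i (l * 2 ^ i)
      \<le> ennreal (3 * C\<^sup>2 * (l * 2 ^ i)) * (\<integral>\<^sup>+x. ennreal (2 / (l * 2 ^ i) * cmod (f x)) * ?ind i x \<partial>M)"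
      by (intro mult_left_mono exceedance_weak_type f) (use l in auto)
    also have "\<dots> = (\<integral>\<^sup>+x. ennreal (3 * C\<^sup>2 * (l * 2 ^ i)) * (ennreal (2 / (l * 2 ^ i) * cmod (f x)) * ?ind i x) \<partial>M)"
      by (rule nn_integral_cmult[symmetric]) simp
    also have "\<dots> = (\<integral>\<^sup>+x. ?g i x \<partial>M)"
    proof (rule nn_integral_cong)
      fix x
      have "ennreal (3 * C\<^sup>2 * (l * 2 ^ i)) * ennreal (2 / (l * 2 ^ i) * cmod (f x)) = ennreal (6 * C\<^sup>2 * cmod (f x))"
        using l by (subst ennreal_mult[symmetric]) auto
      then show "ennreal (3 * C\<^sup>2 * (l * 2 ^ i)) * (ennreal (2 / (l * 2 ^ i) * cmod (f x)) * ?ind i x)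
        = ?g i x"
        by (simp only: mult.assoc[symmetric])
    qed
    finally show ?thesis .
  qed
  then have "H1_norm M \<R> (\<lambda>x. f x - good_part f l x)
    \<le> (\<Sum>i. \<integral>\<^sup>+x. ?g i x \<partial>M)"
    by (intro order_trans[OF H1_bad_part_layers[OF f l]] suminf_le) auto
  also have "\<dots> = (\<integral>\<^sup>+x. (\<Sum>i. ?g i x) \<partial>M)"
    by (rule nn_integral_suminf[symmetric]) simp
  also have "\<dots> \<le> (\<integral>\<^sup>+x. ennreal (6 * C\<^sup>2 * 2 powr \<epsilon> / A) * (ennreal (cmod (f x) powr (1 + \<epsilon>) * l powr - \<epsilon>) *
     indicator {x. l < 2 * cmod (f x)} x) \<partial>M)"
  proof (rule nn_integral_mono)
    fix x
    let ?S = "{i::nat. l * 2 ^ i < 2 * cmod (f x)}"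
    have fin: "finite ?S" by (rule card_dyadic_below(1)[OF l \<epsilon>]) simp
    have "(\<Sum>i. ?g i x)
      = (\<Sum>i\<in>?S. ?g i x)"
      by (rule suminf_finite[OF fin]) auto
    also have "\<dots> = (\<Sum>i\<in>?S. ennreal (6 * C\<^sup>2 * cmod (f x)))" by (rule sum.cong) auto
    also have "\<dots> = ennreal (real (card ?S) * (6 * C\<^sup>2 * cmod (f x)))"
      by (simp add: ennreal_mult ennreal_of_nat_eq_real_of_nat)
    finally have sum: "(\<Sum>i. ?g i x)
      = ennreal (real (card ?S) * (6 * C\<^sup>2 * cmod (f x)))" .
    show "(\<Sum>i. ?g i x)
      \<le> ennreal (6 * C\<^sup>2 * 2 powr \<epsilon> / A) * (ennreal (cmod (f x) powr (1 + \<epsilon>) * l powr - \<epsilon>) *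
     indicator {x. l < 2 * cmod (f x)} x)"
    proof (cases "l < 2 * cmod (f x)")
      case True
      then have fx: "0 < cmod (f x)" using l by linarith
      have "real (card ?S) * (6 * C\<^sup>2 * cmod (f x)) \<le> (2 * cmod (f x) / l) powr \<epsilon> / A * (6 * C\<^sup>2 * cmod (f x))"
        unfolding A_def by (intro mult_right_mono card_dyadic_below(2) l \<epsilon>) auto
      also have "\<dots> = 6 * C\<^sup>2 * 2 powr \<epsilon> / A * (cmod (f x) powr (1 + \<epsilon>) * l powr - \<epsilon>)"
        using l fx by (simp add: powr_divide powr_mult powr_add powr_minus field_simps)
      finally show ?thesis
        unfolding sum using True A by (simp add: ennreal_mult[symmetric] ennreal_leI)
    next
      case False
      have "?S = {}"
      proof -
        have "l \<le> l * 2 ^ i" for i using l by simp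
        then show ?thesis using False by (auto simp: not_less) (meson order_trans less_le_not_le)
      qed
      then show ?thesis unfolding sum by simp
    qed
  qed
  also have "\<dots> = ennreal (6 * C\<^sup>2 * 2 powr \<epsilon> / A) * tail_integral 1 \<epsilon> f l"
    unfolding tail_integral_def by (rule nn_integral_cmult) simp
  finally show ?thesis unfolding A_def .
qed

text \<open>
  The part of \<open>|f|\<close> below \<open>\<epsilon>\<close> has mean at most \<open>\<epsilon>\<close>; the rest is integrable, and the masses of the
  classes tend to infinity.
\<close>

lemma Lp_vanishing:
  assumes r: "1 \<le> r" and fin: "(\<integral>\<^sup>+x. ennreal (cmod (f x) powr r) \<partial>M) < \<infinity>"
  shows "vanishing f"
  unfolding vanishing_def
proof
  fix v
  obtain J where J: "(\<integral>\<^sup>+x. ennreal (cmod (f x) powr r) \<partial>M) = ennreal J" "0 \<le> J"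
    using fin by (cases "\<integral>\<^sup>+x. ennreal (cmod (f x) powr r) \<partial>M") auto
  have J_sum: "(\<Sum>x\<in>A. w x * cmod (f x) powr r) \<le> J" if "finite A" for A
  proof -
    have "ennreal (\<Sum>x\<in>A. w x * cmod (f x) powr r) = (\<integral>\<^sup>+x\<in>A. ennreal (cmod (f x) powr r) \<partial>M)"
      unfolding set_nn_integral_M_finite[OF that] by (simp add: ennreal_mult[symmetric] w_nonneg)
    also have "\<dots> \<le> ennreal J"
      unfolding J(1)[symmetric] by (rule nn_integral_mono) (auto simp: indicator_def)
    finally show ?thesis using J(2) by simp
  qed
  have le: "mean_abs f t v \<le> \<epsilon> + \<epsilon> powr (1 - r) * J / sum w (Q t v)" if "0 < \<epsilon>" for \<epsilon> t
  proof -
    have "(\<Sum>u\<in>Q t v. w u * cmod (f u)) \<le> (\<Sum>u\<in>Q t v. w u * (\<epsilon> + \<epsilon> powr (1 - r) * cmod (f u) powr r))"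
      by (intro sum_mono mult_left_mono le_split_powr) (use that r w_nonneg in auto)
    also have "\<dots> = \<epsilon> * sum w (Q t v) + \<epsilon> powr (1 - r) * (\<Sum>u\<in>Q t v. w u * cmod (f u) powr r)"
      by (simp add: sum.distrib sum_distrib_left algebra_simps)
    also have "\<dots> \<le> \<epsilon> * sum w (Q t v) + \<epsilon> powr (1 - r) * J"
      using J_sum[OF finite_Q[of t v]] by (simp add: mult_left_mono)
    finally show ?thesis using Q_pos[of t v] by (simp add: mean_abs_def field_simps)
  qed
  show "(\<lambda>t. mean_abs f t v) \<longlonglongrightarrow> 0"
  proof (rule order_tendstoI)
    fix e :: real assume e: "e < 0"
    have "0 \<le> mean_abs f t v" for t
      using Q_pos[of t v] w_nonneg by (simp add: mean_abs_def sum_nonneg)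
    then show "eventually (\<lambda>t. e < mean_abs f t v) sequentially"
      using e by (intro always_eventually allI) (meson less_le_trans)
  next
    fix e :: real assume e: "0 < e"
    have "(\<lambda>t. (e / 2) powr (1 - r) * J / sum w (Q t v)) \<longlonglongrightarrow> 0"
      by (rule tendsto_divide_0[OF tendsto_const])
         (rule filterlim_at_top_imp_at_infinity[OF Q_unbounded])
    then have "eventually (\<lambda>t. (e / 2) powr (1 - r) * J / sum w (Q t v) < e / 2) sequentially"
      by (rule order_tendstoD) (use e in simp)
    then show "eventually (\<lambda>t. mean_abs f t v < e) sequentially"
    proof (rule eventually_mono)
      fix t assume "(e / 2) powr (1 - r) * J / sum w (Q t v) < e / 2"
      then show "mean_abs f t v < e" using le[of "e / 2" t] e by linarith
    qed
  qed
qed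

lemma tail_integral_measurable: "(\<lambda>l. tail_integral p \<epsilon> f l) \<in> borel_measurable borel"
proof -
  have "sigma_finite_measure (count_space (UNIV :: 'v set))"
    by (rule sigma_finite_measure_count_space_countable[OF countable_vertices])
  then interpret cs: sigma_finite_measure "count_space (UNIV :: 'v set)" .
  have "(\<lambda>z. ennreal (w (snd z)) * (ennreal (cmod (f (snd z)) powr (p + \<epsilon>) * fst z powr - \<epsilon>) *
      indicator {x. fst z < 2 * cmod (f x)} (snd z))) \<in> borel_measurable (borel \<Otimes>\<^sub>M count_space UNIV)"
    (is "?g \<in> _")
  proof (subst measurable_pair_swap_iff, rule measurable_pair_measure_countable1[OF countable_vertices])
    fix y
    have "(\<lambda>l. ennreal (w y) * (ennreal (cmod (f y) powr (p + \<epsilon>) * l powr - \<epsilon>) *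
      indicator {..<2 * cmod (f y)} l)) \<in> borel_measurable borel" by measurable
    then show "(\<lambda>l. (case (y, l) of (x, l) \<Rightarrow> ?g (l, x))) \<in> borel_measurable borel"
      by (rule measurable_cong[THEN iffD1, rotated]) (auto simp: indicator_def)
  qed
  then show ?thesis unfolding tail_integral_def nn_integral_M
    by (intro cs.borel_measurable_nn_integral) (simp add: case_prod_beta')
qed

lemma tail_integral_finite:
  assumes fin: "(\<integral>\<^sup>+x. ennreal (cmod (f x) powr r) \<partial>M) < \<infinity>" and l: "0 < l" and p: "p + \<epsilon> \<le> r"
  shows "tail_integral p \<epsilon> f l < \<infinity>"
proof -
  let ?A = "(l / 2) powr (p + \<epsilon> - r) * l powr - \<epsilon>"
  have "tail_integral p \<epsilon> f l \<le> (\<integral>\<^sup>+x. ennreal ?A * ennreal (cmod (f x) powr r) \<partial>M)"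
    unfolding tail_integral_def
  proof (rule nn_integral_mono)
    fix x
    show "ennreal (cmod (f x) powr (p + \<epsilon>) * l powr - \<epsilon>) * indicator {x. l < 2 * cmod (f x)} x
      \<le> ennreal ?A * ennreal (cmod (f x) powr r)"
    proof (cases "l < 2 * cmod (f x)")
      case True
      then have "cmod (f x) powr (p + \<epsilon>) = cmod (f x) powr (p + \<epsilon> - r) * cmod (f x) powr r"
        using l by (simp add: powr_add[symmetric])
      also have "\<dots> \<le> (l / 2) powr (p + \<epsilon> - r) * cmod (f x) powr r"
        using True l p by (intro mult_right_mono powr_mono2') auto
      finally have "cmod (f x) powr (p + \<epsilon>) * l powr - \<epsilon> \<le> (l / 2) powr (p + \<epsilon> - r) * cmod (f x) powr r * l powr - \<epsilon>"
        by (rule mult_right_mono) simp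
      then have "cmod (f x) powr (p + \<epsilon>) * l powr - \<epsilon> \<le> ?A * cmod (f x) powr r"
        by (simp add: mult_ac)
      then show ?thesis using True by (simp add: ennreal_mult[symmetric] ennreal_leI)
    qed simp
  qed
  also have "\<dots> = ennreal ?A * (\<integral>\<^sup>+x. ennreal (cmod (f x) powr r) \<partial>M)" by (rule nn_integral_cmult) simp
  also have "\<dots> < \<infinity>" using fin by (simp add: ennreal_mult_less_top)
  finally show ?thesis .
qed

lemma integral_tail_integral:
  assumes p: "0 < \<epsilon>" "r = p + 2 * \<epsilon>"
  shows "(\<integral>\<^sup>+l\<in>{0<..}. ennreal (l powr (r - 1 - p)) * tail_integral p \<epsilon> f l \<partial>lborel)
    = ennreal (2 powr \<epsilon> / \<epsilon>) * (\<integral>\<^sup>+x. ennreal (cmod (f x) powr r) \<partial>M)"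
proof -
  let ?k = "\<lambda>x l. ennreal (w x) * (ennreal (cmod (f x) powr (p + \<epsilon>)) *
    (ennreal (l powr (\<epsilon> - 1)) * indicator {0<..<2 * cmod (f x)} l))"
  have "(\<integral>\<^sup>+l\<in>{0<..}. ennreal (l powr (r - 1 - p)) * tail_integral p \<epsilon> f l \<partial>lborel)
    = (\<integral>\<^sup>+l. (\<integral>\<^sup>+x. ?k x l \<partial>count_space UNIV) \<partial>lborel)"
  proof (rule nn_integral_cong)
    fix l :: real
    show "ennreal (l powr (r - 1 - p)) * tail_integral p \<epsilon> f l * indicator {0<..} l
      = (\<integral>\<^sup>+x. ?k x l \<partial>count_space UNIV)"
    proof (cases "0 < l")
      case True
      have e: "l powr (r - 1 - p) * l powr - \<epsilon> = l powr (\<epsilon> - 1)"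
        using p True by (simp add: powr_add[symmetric])
      have "ennreal (l powr (r - 1 - p)) * tail_integral p \<epsilon> f l
        = (\<integral>\<^sup>+x. ennreal (l powr (r - 1 - p)) * (ennreal (w x) * (ennreal (cmod (f x) powr (p + \<epsilon>) * l powr - \<epsilon>) *
           indicator {x. l < 2 * cmod (f x)} x)) \<partial>count_space UNIV)"
        unfolding tail_integral_def nn_integral_M by (rule nn_integral_cmult[symmetric]) simp
      also have "\<dots> = (\<integral>\<^sup>+x. ?k x l \<partial>count_space UNIV)"
        by (rule nn_integral_cong)
           (use True in \<open>auto simp: indicator_def e[symmetric] ennreal_mult mult_ac\<close>)
      finally show ?thesis using True by simp
    qed simp
  qed
  also have "\<dots> = (\<integral>\<^sup>+x. (\<integral>\<^sup>+l. ?k x l \<partial>lborel) \<partial>count_space UNIV)"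
    by (rule nn_integral_count_space_nn_integral[OF countable_vertices]) measurable
  also have "\<dots> = (\<integral>\<^sup>+x. ennreal (2 powr \<epsilon> / \<epsilon>) * (ennreal (w x) * ennreal (cmod (f x) powr r)) \<partial>count_space UNIV)"
  proof (rule nn_integral_cong)
    fix x
    have "(\<integral>\<^sup>+l. ?k x l \<partial>lborel)
      = ennreal (w x) * (ennreal (cmod (f x) powr (p + \<epsilon>)) *
        (\<integral>\<^sup>+l\<in>{0<..<2 * cmod (f x)}. ennreal (l powr (\<epsilon> - 1)) \<partial>lborel))"
      by (simp add: nn_integral_cmult)
    also have "(\<integral>\<^sup>+l\<in>{0<..<2 * cmod (f x)}. ennreal (l powr (\<epsilon> - 1)) \<partial>lborel)
        = ennreal ((2 * cmod (f x)) powr \<epsilon> / \<epsilon>)" by (rule nn_integral_powr_Ioo) (use p in auto)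
    also have "ennreal (w x) * (ennreal (cmod (f x) powr (p + \<epsilon>)) * ennreal ((2 * cmod (f x)) powr \<epsilon> / \<epsilon>))
        = ennreal (2 powr \<epsilon> / \<epsilon>) * (ennreal (w x) * ennreal (cmod (f x) powr r))"
    proof -
      have "cmod (f x) powr r = cmod (f x) powr (p + \<epsilon>) * cmod (f x) powr \<epsilon>"
        using p by (simp add: powr_add[symmetric] algebra_simps)
      then show ?thesis using p(1) w_nonneg[of x] by (simp add: ennreal_mult[symmetric] powr_mult mult_ac)
    qed
    finally show "(\<integral>\<^sup>+l. ?k x l \<partial>lborel)
      = ennreal (2 powr \<epsilon> / \<epsilon>) * (ennreal (w x) * ennreal (cmod (f x) powr r))" .
  qed
  also have "\<dots> = ennreal (2 powr \<epsilon> / \<epsilon>) * (\<integral>\<^sup>+x. ennreal (cmod (f x) powr r) \<partial>M)"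
    unfolding nn_integral_M by (rule nn_integral_cmult) simp
  finally show ?thesis .
qed

end

lemma ennreal_le_mult_INF:
  fixes f :: "'a \<Rightarrow> ennreal"
  assumes "0 < B" "\<And>a. a \<in> A \<Longrightarrow> X \<le> ennreal B * f a"
  shows "X \<le> ennreal B * (INF a\<in>A. f a)"
proof -
  have "ennreal (1 / B) * X \<le> (INF a\<in>A. f a)"
  proof (rule INF_greatest)
    fix a assume "a \<in> A"
    then have "ennreal (1 / B) * X \<le> ennreal (1 / B) * (ennreal B * f a)"
      by (intro mult_left_mono assms(2)) auto
    also have "\<dots> = f a" using assms(1) by (simp add: mult.assoc[symmetric] ennreal_mult[symmetric])
    finally show "ennreal (1 / B) * X \<le> f a" .
  qed
  then have "ennreal B * (ennreal (1 / B) * X) \<le> ennreal B * (INF a\<in>A. f a)" by (rule mult_left_mono) simp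
  then show ?thesis using assms(1) by (simp add: mult.assoc[symmetric] ennreal_mult[symmetric])
qed

lemma ennreal_le_mult_INF_add:
  fixes f :: "'a \<Rightarrow> ennreal"
  assumes "0 < B" "\<And>a. a \<in> A \<Longrightarrow> X \<le> ennreal B * f a + y"
  shows "X \<le> ennreal B * (INF a\<in>A. f a) + y"
proof (cases "y = top")
  case False
  have "X - y \<le> ennreal B * (INF a\<in>A. f a)"
  proof (rule ennreal_le_mult_INF[OF assms(1)])
    fix a assume "a \<in> A"
    then have "X \<le> y + ennreal B * f a" using assms(2) by (simp add: add.commute)
    then show "X - y \<le> ennreal B * f a" using False by (simp add: ennreal_minus_le_iff)
  qed
  then have "X \<le> y + ennreal B * (INF a\<in>A. f a)" using False by (simp add: ennreal_minus_le_iff)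
  then show ?thesis by (simp add: add.commute)
qed simp

lemma mod_const_le: "mod_const N (abs_fun_mod_const f) \<le> N f"
  unfolding mod_const_def by (rule INF_lower) simp

lemma abs_fun_mod_const_eq_iff:
  "abs_fun_mod_const f = abs_fun_mod_const g \<longleftrightarrow> (\<exists>c. \<forall>x. f x = g x + c)"
  by (rule fun_mod_const.abs_eq_iff)

text \<open>
  The norm of a class is an infimum over its representatives, so a lower bound for the
  \<open>K\<close>-functional need only be checked on decompositions into functions.
\<close>

lemma le_K_functional_mod_const:
  assumes "0 < a" "0 < t"
    and "\<And>f0 f1. F = abs_fun_mod_const (\<lambda>x. f0 x + f1 x) \<Longrightarrow> X \<le> ennreal a * (N0 f0 + ennreal t * N1 f1)"
  shows "X \<le> ennreal a * K_functional (mod_const N0) (mod_const N1) t F"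
  unfolding K_functional_def
proof (rule ennreal_le_mult_INF[OF assms(1)], clarify)
  fix F0 F1 :: "'a fun_mod_const" assume F: "F = F0 + F1"
  have at: "ennreal a * ennreal t = ennreal (a * t)" "0 < a * t"
    using assms by (auto simp: ennreal_mult)
  have *: "X \<le> ennreal a * N0 f0 + ennreal (a * t) * N1 f1"
    if "abs_fun_mod_const f0 = F0" "abs_fun_mod_const f1 = F1" for f0 f1
  proof -
    have "X \<le> ennreal a * (N0 f0 + ennreal t * N1 f1)"
      by (rule assms(3)) (simp add: F that[symmetric] plus_fun_mod_const.abs_eq)
    then show ?thesis by (simp only: distrib_left mult.assoc[symmetric] at(1))
  qed
  have **: "X \<le> ennreal a * mod_const N0 F0 + ennreal (a * t) * N1 f1" if "abs_fun_mod_const f1 = F1" for f1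
    unfolding mod_const_def by (rule ennreal_le_mult_INF_add[OF assms(1)]) (use * that in blast)
  have "X \<le> ennreal (a * t) * mod_const N1 F1 + ennreal a * mod_const N0 F0"
    unfolding mod_const_def[of N1]
  proof (rule ennreal_le_mult_INF_add[OF at(2)])
    fix f1 assume "f1 \<in> {f. abs_fun_mod_const f = F1}"
    then show "X \<le> ennreal (a * t) * N1 f1 + ennreal a * mod_const N0 F0"
      using **[of f1] by (simp only: mem_Collect_eq add.commute)
  qed
  then show "X \<le> ennreal a * (mod_const N0 F0 + ennreal t * mod_const N1 F1)"
    by (simp only: distrib_left mult.assoc[symmetric] at(1) add.commute)
qed

context dyadic_filtration
begin

lemma interpolation_norm_le_Lp:
  assumes r1: "0 < r\<^sub>1" "1 \<le> r" "r\<^sub>1 = r * (1 - \<theta>)" and \<epsilon>: "0 < \<epsilon>" "r = r\<^sub>1 + 2 * \<epsilon>"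
    and A: "0 \<le> A" "0 \<le> C'"
    and fin: "(\<integral>\<^sup>+x. ennreal (cmod (f x) powr r) \<partial>M) < \<infinity>"
    and decomp: "\<And>l. 0 < l \<Longrightarrow> \<exists>g. N0 (\<lambda>x. f x - g x) \<le> ennpowr (ennreal A * tail_integral r\<^sub>1 \<epsilon> f l) (1 / r\<^sub>1)
      \<and> N1 g \<le> ennreal (C' * l)"
  shows "interpolation_norm (mod_const N0) (mod_const N1) \<theta> r (abs_fun_mod_const f)
    \<le> ennreal (((C' + 1) powr r * r / r\<^sub>1 * (A * (2 powr \<epsilon> / \<epsilon>))) powr (1 / r)) * Lp_norm M r f"
proof -
  let ?J = "\<integral>\<^sup>+x. ennreal (cmod (f x) powr r) \<partial>M" and ?k = "(C' + 1) powr r * r / r\<^sub>1" and ?e = "2 powr \<epsilon> / \<epsilon>"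
  have le: "interpolation_norm (mod_const N0) (mod_const N1) \<theta> r (abs_fun_mod_const f)
    \<le> ennpowr (ennreal ?k * (\<integral>\<^sup>+l\<in>{0<..}. ennreal (l powr (r - 1 - r\<^sub>1)) *
        (ennreal A * tail_integral r\<^sub>1 \<epsilon> f l) \<partial>lborel)) (1 / r)"
  proof (rule interpolation_norm_upper)
    show "(\<lambda>l. ennreal A * tail_integral r\<^sub>1 \<epsilon> f l) \<in> borel_measurable borel"
      using tail_integral_measurable by measurable
    show "ennreal A * tail_integral r\<^sub>1 \<epsilon> f l < \<infinity>" if "0 < l" for l
      using tail_integral_finite[OF fin that, of r\<^sub>1 \<epsilon>] \<epsilon> by (simp add: ennreal_mult_less_top)
    fix l :: real assume "0 < l"
    then obtain g where g: "N0 (\<lambda>x. f x - g x) \<le> ennpowr (ennreal A * tail_integral r\<^sub>1 \<epsilon> f l) (1 / r\<^sub>1)"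
      "N1 g \<le> ennreal (C' * l)" using decomp by blast
    show "\<exists>F0 F1. abs_fun_mod_const f = F0 + F1 \<and>
        mod_const N0 F0 \<le> ennpowr (ennreal A * tail_integral r\<^sub>1 \<epsilon> f l) (1 / r\<^sub>1) \<and> mod_const N1 F1 \<le> ennreal (C' * l)"
    proof (intro exI conjI)
      show "abs_fun_mod_const f = abs_fun_mod_const (\<lambda>x. f x - g x) + abs_fun_mod_const g"
        by (simp add: plus_fun_mod_const.abs_eq)
      show "mod_const N0 (abs_fun_mod_const (\<lambda>x. f x - g x)) \<le> ennpowr (ennreal A * tail_integral r\<^sub>1 \<epsilon> f l) (1 / r\<^sub>1)"
        using mod_const_le[of N0 "\<lambda>x. f x - g x"] g(1) by (rule order_trans)
      show "mod_const N1 (abs_fun_mod_const g) \<le> ennreal (C' * l)"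
        using mod_const_le[of N1 g] g(2) by (rule order_trans)
    qed
  qed (use r1 A in auto)
  have "(\<integral>\<^sup>+l\<in>{0<..}. ennreal (l powr (r - 1 - r\<^sub>1)) * (ennreal A * tail_integral r\<^sub>1 \<epsilon> f l) \<partial>lborel)
    = ennreal A * (\<integral>\<^sup>+l\<in>{0<..}. ennreal (l powr (r - 1 - r\<^sub>1)) * tail_integral r\<^sub>1 \<epsilon> f l \<partial>lborel)"
    using tail_integral_measurable by (subst nn_integral_cmult[symmetric]) (auto simp: mult_ac)
  also have "\<dots> = ennreal A * (ennreal ?e * ?J)"
    by (subst integral_tail_integral[OF \<epsilon>]) simp
  finally have Y: "(\<integral>\<^sup>+l\<in>{0<..}. ennreal (l powr (r - 1 - r\<^sub>1)) * (ennreal A * tail_integral r\<^sub>1 \<epsilon> f l) \<partial>lborel)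
    = ennreal A * (ennreal ?e * ?J)" .
  have k: "ennreal ?k * (ennreal A * (ennreal ?e * ?J))
    = ennreal (?k * (A * ?e)) * ?J"
  proof -
    have "0 \<le> ?k" "0 \<le> 2 powr \<epsilon> / \<epsilon>" using r1(1,2) A(2) \<epsilon>(1) by auto
    then have "ennreal (?k * (A * ?e))
        = ennreal ?k * (ennreal A * ennreal ?e)"
      using A(1) by (simp only: ennreal_mult mult_nonneg_nonneg)
    then show ?thesis by (simp add: mult.assoc)
  qed
  have "ennpowr (ennreal (?k * (A * ?e)) * ?J) (1 / r) = ennreal ((?k * (A * ?e)) powr (1 / r)) * Lp_norm M r f"
    unfolding Lp_norm_def by (rule ennpowr_mult) (use r1(1,2) A \<epsilon>(1) in auto)
  then show ?thesis using le unfolding Y k by (simp only:)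
qed

lemma Lp_norm_finite: "0 < r \<Longrightarrow> Lp_norm M r f < \<infinity> \<Longrightarrow> (\<integral>\<^sup>+x. ennreal (cmod (f x) powr r) \<partial>M) < \<infinity>"
  unfolding Lp_norm_def by (cases "(\<integral>\<^sup>+x. ennreal (cmod (f x) powr r) \<partial>M) = \<infinity>") (auto simp: less_top)

lemma le_mod_const_Lp:
  assumes "0 < B" "0 < r"
    and "\<And>f. (\<integral>\<^sup>+x. ennreal (cmod (f x) powr r) \<partial>M) < \<infinity> \<Longrightarrow> N (abs_fun_mod_const f) \<le> ennreal B * Lp_norm M r f"
  shows "N F \<le> ennreal B * mod_const (Lp_norm M r) F"
  unfolding mod_const_def
proof (rule ennreal_le_mult_INF[OF assms(1)], clarify)
  fix f :: "'v \<Rightarrow> complex"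
  show "N (abs_fun_mod_const f) \<le> ennreal B * Lp_norm M r f"
  proof (cases "Lp_norm M r f < \<infinity>")
    case True
    then show ?thesis using assms(3) Lp_norm_finite[OF assms(2)] by blast
  next
    case False
    then have "Lp_norm M r f = top" by (metis infinity_ennreal_def top.not_eq_extremum)
    then show ?thesis using assms(1) by (simp add: ennreal_mult_top)
  qed
qed

text \<open>The function is truncated at height \<open>l\<close>; the bounded part has BMO norm at most \<open>2 l\<close>.\<close>

lemma Lr_subset_interpolation_Lp:
  assumes "1 \<le> r\<^sub>1" "r\<^sub>1 < r" "r\<^sub>1 = r * (1 - \<theta>)"
  shows "\<exists>B>0. \<forall>F. interpolation_norm (mod_const (Lp_norm M r\<^sub>1)) (mod_const (BMO_norm M \<R>)) \<theta> r F
    \<le> ennreal B * mod_const (Lp_norm M r) F"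
proof -
  define \<epsilon> where "\<epsilon> = (r - r\<^sub>1) / 2"
  have \<epsilon>: "0 < \<epsilon>" "r = r\<^sub>1 + 2 * \<epsilon>" using assms(2) by (auto simp: \<epsilon>_def field_simps)
  define B where "B = ((2 + 1) powr r * r / r\<^sub>1 * (1 * (2 powr \<epsilon> / \<epsilon>))) powr (1 / r)"
  have "0 < (2 + 1) powr r * r / r\<^sub>1 * (1 * (2 powr \<epsilon> / \<epsilon>))" using assms(1,2) \<epsilon>(1) by simp
  then have B: "0 < B" unfolding B_def by (simp only: powr_gt_zero)
  have "interpolation_norm (mod_const (Lp_norm M r\<^sub>1)) (mod_const (BMO_norm M \<R>)) \<theta> r (abs_fun_mod_const f)
      \<le> ennreal B * Lp_norm M r f" if fin: "(\<integral>\<^sup>+x. ennreal (cmod (f x) powr r) \<partial>M) < \<infinity>" for f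
    unfolding B_def
  proof (rule interpolation_norm_le_Lp[OF _ _ _ \<epsilon> _ _ fin])
    fix l :: real assume l: "0 < l"
    define g where "g = (\<lambda>x. if cmod (f x) \<le> l then f x else 0)"
    have "(\<integral>\<^sup>+x. ennreal (cmod (f x - g x) powr r\<^sub>1) \<partial>M) \<le> ennreal 1 * tail_integral r\<^sub>1 \<epsilon> f l"
      unfolding tail_integral_def ennreal_1 mult_1
    proof (rule nn_integral_mono)
      fix x
      show "ennreal (cmod (f x - g x) powr r\<^sub>1) \<le> ennreal (cmod (f x) powr (r\<^sub>1 + \<epsilon>) * l powr - \<epsilon>) * indicator {x. l < 2 * cmod (f x)} x"
      proof (cases "cmod (f x) \<le> l")
        case False
        then have "1 \<le> (cmod (f x) / l) powr \<epsilon>" using l \<epsilon>(1) by (intro ge_one_powr_ge_zero) auto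
        then have "cmod (f x) powr r\<^sub>1 * 1 \<le> cmod (f x) powr r\<^sub>1 * (cmod (f x) / l) powr \<epsilon>"
          by (rule mult_left_mono) simp
        also have "\<dots> = cmod (f x) powr (r\<^sub>1 + \<epsilon>) * l powr - \<epsilon>"
          using l by (simp add: powr_divide powr_add powr_minus field_simps)
        finally show ?thesis using False l by (simp add: g_def ennreal_leI)
      qed (simp add: g_def)
    qed
    then have "Lp_norm M r\<^sub>1 (\<lambda>x. f x - g x) \<le> ennpowr (ennreal 1 * tail_integral r\<^sub>1 \<epsilon> f l) (1 / r\<^sub>1)"
      unfolding Lp_norm_def using assms(1) by (intro ennpowr_mono) auto
    moreover have "BMO_norm M \<R> g \<le> ennreal (2 * l)"
      by (rule BMO_norm_bounded) (use l in \<open>auto simp: g_def\<close>)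
    ultimately show "\<exists>g. Lp_norm M r\<^sub>1 (\<lambda>x. f x - g x) \<le> ennpowr (ennreal 1 * tail_integral r\<^sub>1 \<epsilon> f l) (1 / r\<^sub>1) \<and>
        BMO_norm M \<R> g \<le> ennreal (2 * l)" by blast
  qed (use assms in auto)
  then have "interpolation_norm (mod_const (Lp_norm M r\<^sub>1)) (mod_const (BMO_norm M \<R>)) \<theta> r F
    \<le> ennreal B * mod_const (Lp_norm M r) F" for F
    by (intro le_mod_const_Lp[OF B]) (use assms(1,2) in auto)
  then show ?thesis using B by blast
qed

text \<open>
  The good part at height \<open>l\<close> has BMO norm at most \<open>2 C l\<close>, and the bad part is estimated in \<open>H\<^sup>1\<close> by
  the tail integral.
\<close>

lemma Lr_subset_interpolation_H1:
  assumes "1 < r" "1 = r * (1 - \<theta>)"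
  shows "\<exists>B>0. \<forall>F. interpolation_norm (mod_const (H1_norm M \<R>)) (mod_const (BMO_norm M \<R>)) \<theta> r F
    \<le> ennreal B * mod_const (Lp_norm M r) F"
proof -
  define \<epsilon> where "\<epsilon> = (r - 1) / 2"
  have \<epsilon>: "0 < \<epsilon>" "r = 1 + 2 * \<epsilon>" using assms(1) by (auto simp: \<epsilon>_def field_simps)
  define A where "A = 6 * C\<^sup>2 * 2 powr \<epsilon> / (1 - 2 powr - \<epsilon>)"
  have A: "0 < A" using C_ge_1 powr_less_mono[of "- \<epsilon>" 0 2] \<epsilon>(1) unfolding A_def by simp
  define B where "B = ((2 * C + 1) powr r * r / 1 * (A * (2 powr \<epsilon> / \<epsilon>))) powr (1 / r)"
  have "0 < (2 * C + 1) powr r * r / 1 * (A * (2 powr \<epsilon> / \<epsilon>))" using assms(1) \<epsilon>(1) A C_ge_1 by simp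
  then have B: "0 < B" unfolding B_def by (simp only: powr_gt_zero)
  have "interpolation_norm (mod_const (H1_norm M \<R>)) (mod_const (BMO_norm M \<R>)) \<theta> r (abs_fun_mod_const f)
      \<le> ennreal B * Lp_norm M r f" if fin: "(\<integral>\<^sup>+x. ennreal (cmod (f x) powr r) \<partial>M) < \<infinity>" for f
    unfolding B_def
  proof (rule interpolation_norm_le_Lp[OF _ _ _ \<epsilon> _ _ fin])
    fix l :: real assume l: "0 < l"
    have f: "vanishing f" by (rule Lp_vanishing[OF _ fin]) (use assms in simp)
    have "ennpowr y (1 / 1) = y" for y by (cases y) (auto simp: ennpowr_def)
    then have "H1_norm M \<R> (\<lambda>x. f x - good_part f l x) \<le> ennpowr (ennreal A * tail_integral 1 \<epsilon> f l) (1 / 1)"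
      using H1_bad_part[OF f l \<epsilon>(1)] unfolding A_def by simp
    moreover have "BMO_norm M \<R> (good_part f l) \<le> ennreal (2 * C * l)"
      using BMO_norm_bounded[OF good_part_bound[OF f l]] by (simp add: mult.assoc)
    ultimately show "\<exists>g. H1_norm M \<R> (\<lambda>x. f x - g x) \<le> ennpowr (ennreal A * tail_integral 1 \<epsilon> f l) (1 / 1) \<and>
        BMO_norm M \<R> g \<le> ennreal (2 * C * l)" by blast
  qed (use assms A C_ge_1 in auto)
  then have "interpolation_norm (mod_const (H1_norm M \<R>)) (mod_const (BMO_norm M \<R>)) \<theta> r F
    \<le> ennreal B * mod_const (Lp_norm M r) F" for F
    by (intro le_mod_const_Lp[OF B]) (use assms(1) in auto)
  then show ?thesis using B by blast
qed

end

section \<open>The interpolation space is contained in \<open>L\<^sup>r\<close>\<close>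

context dyadic_filtration
begin

text \<open>
  On a stopping class the layer has integral zero, so a constant may be subtracted from \<open>h\<close>
  before the layer is replaced by its upper bound and the class by a larger set of the family.
\<close>

lemma layer_pairing_BMO:
  assumes f: "vanishing f" "0 < l" and E: "finite (exceedance f l)" and \<beta>: "0 \<le> \<beta>"
    and osc: "\<And>R. R \<in> \<R> \<Longrightarrow> \<exists>c. (\<Sum>x\<in>R. w x * cmod (h x - c)) \<le> \<beta> * sum w R"
  shows "cmod (\<Sum>v\<in>exceedance f l. of_real (w v) * h v * layer f l v) \<le> 3 * C\<^sup>2 * l * \<beta> * sum w (exceedance f l)"
proof -
  let ?P = "stopping_class f l" and ?E = "exceedance f l"
  let ?G = "\<lambda>x. of_real (w x) * h x * layer f l x"
  have C0: "0 \<le> C" using C_ge_1 by simp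
  have on_class: "cmod (sum ?G (?P v)) \<le> 3 * C\<^sup>2 * l * \<beta> * sum w (?P v)" for v
  proof -
    obtain R where R: "R \<in> \<R>" "?P v \<subseteq> R" "sum w R \<le> C * sum w (?P v)"
      using Q_enlarge unfolding stopping_class_def by blast
    obtain c where c: "(\<Sum>x\<in>R. w x * cmod (h x - c)) \<le> \<beta> * sum w R" using osc[OF R(1)] by blast
    have "sum ?G (?P v) = (\<Sum>x\<in>?P v. of_real (w x) * (h x - c) * layer f l x)
        + c * (\<Sum>x\<in>?P v. of_real (w x) * layer f l x)"
      by (simp add: sum_distrib_left sum.distrib[symmetric] algebra_simps)
    also have "\<dots> = (\<Sum>x\<in>?P v. of_real (w x) * (h x - c) * layer f l x)"
      by (simp add: sum_layer[OF f])
    finally have "cmod (sum ?G (?P v)) \<le> (\<Sum>x\<in>?P v. w x * cmod (h x - c) * (3 * C * l))"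
      using layer_bound[OF f] w_nonneg
      by (auto simp: norm_mult intro!: sum_norm_le mult_left_mono)
    also have "\<dots> = (3 * C * l) * (\<Sum>x\<in>?P v. w x * cmod (h x - c))"
      by (simp add: sum_distrib_left mult_ac)
    also have "\<dots> \<le> (3 * C * l) * (\<Sum>x\<in>R. w x * cmod (h x - c))"
      by (intro mult_left_mono sum_mono2) (use R(1,2) finite_sets w_nonneg C0 f(2) in auto)
    also have "\<dots> \<le> (3 * C * l) * (\<beta> * (C * sum w (?P v)))"
    proof (rule mult_left_mono)
      show "(\<Sum>x\<in>R. w x * cmod (h x - c)) \<le> \<beta> * (C * sum w (?P v))"
        using c mult_left_mono[OF R(3) \<beta>] by linarith
    qed (use C0 f(2) in simp)
    finally show ?thesis by (simp add: power2_eq_square mult_ac)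
  qed
  have "sum ?G ?E = (\<Sum>v\<in>?E. of_real (w v) * (sum ?G (?P v) / of_real (sum w (?P v))))"
  proof (rule sum_partition_average[symmetric, OF E])
    fix v assume v: "v \<in> ?E"
    show "?P v \<subseteq> ?E" using exceedance_stopping_class[OF f] v by blast
    show "v \<in> ?P v" by (rule stopping_class_self)
    show "u \<in> ?P v \<Longrightarrow> ?P u = ?P v" for u by (rule stopping_class_eq[OF f])
    show "sum w (?P v) \<noteq> 0" using stopping_class_pos by (simp add: less_imp_neq[symmetric])
  qed
  then have "cmod (sum ?G ?E) \<le> (\<Sum>v\<in>?E. w v * (3 * C\<^sup>2 * l * \<beta>))"
  proof (simp only:, intro sum_norm_le)
    fix v
    have "cmod (sum ?G (?P v)) / sum w (?P v) \<le> 3 * C\<^sup>2 * l * \<beta>"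
      using on_class[of v] stopping_class_pos[of f l v] by (simp add: divide_le_eq)
    then have "w v * (cmod (sum ?G (?P v)) / sum w (?P v)) \<le> w v * (3 * C\<^sup>2 * l * \<beta>)"
      by (rule mult_left_mono[OF _ w_nonneg])
    then show "cmod (of_real (w v) * (sum ?G (?P v) / of_real (sum w (?P v)))) \<le> w v * (3 * C\<^sup>2 * l * \<beta>)"
      using stopping_class_pos[of f l v] w_nonneg[of v] by (simp add: norm_mult norm_divide del: of_real_sum)
  qed
  then show ?thesis by (simp add: sum_distrib_left sum_distrib_right mult_ac)
qed

end

context weighted_sets
begin

text \<open>Hoelder's inequality up to a constant, from a pointwise splitting at the optimal height.\<close>

lemma sum_le_Lp_norm:
  assumes r: "1 \<le> r" and E: "finite E" "sum w E \<le> s" "0 < s"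
    and \<alpha>: "0 \<le> \<alpha>" "Lp_norm M r h \<le> ennreal \<alpha>"
  shows "(\<Sum>x\<in>E. w x * cmod (h x)) \<le> 2 * \<alpha> * s / s powr (1 / r)"
proof -
  have "(\<integral>\<^sup>+x. ennreal (cmod (h x) powr r) \<partial>M) \<le> ennreal (\<alpha> powr r)"
    using ennpowr_mono[OF _ \<alpha>(2), of r] r \<alpha>(1) unfolding Lp_norm_def
    by (simp add: ennpowr_inverse' ennpowr_ennreal)
  moreover have "ennreal (\<Sum>x\<in>E. w x * cmod (h x) powr r) = (\<integral>\<^sup>+x\<in>E. ennreal (cmod (h x) powr r) \<partial>M)"
    unfolding set_nn_integral_M_finite[OF E(1)] by (simp add: ennreal_mult[symmetric] w_nonneg)
  moreover have "(\<integral>\<^sup>+x\<in>E. ennreal (cmod (h x) powr r) \<partial>M) \<le> (\<integral>\<^sup>+x. ennreal (cmod (h x) powr r) \<partial>M)"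
    by (rule nn_integral_mono) (auto simp: indicator_def)
  ultimately have "ennreal (\<Sum>x\<in>E. w x * cmod (h x) powr r) \<le> ennreal (\<alpha> powr r)" by simp
  then have sum: "(\<Sum>x\<in>E. w x * cmod (h x) powr r) \<le> \<alpha> powr r" by (subst (asm) ennreal_le_iff) auto
  show ?thesis
  proof (cases "\<alpha> = 0")
    case True
    then have "(\<Sum>x\<in>E. w x * cmod (h x) powr r) = 0"
      using sum by (intro antisym sum_nonneg) (auto simp: w_nonneg)
    then have "\<forall>x\<in>E. w x * cmod (h x) powr r = 0"
      using E(1) by (subst (asm) sum_nonneg_eq_0_iff) (auto simp: w_nonneg)
    then have "(\<Sum>x\<in>E. w x * cmod (h x)) = 0" by (intro sum.neutral) auto
    then show ?thesis using True by simp
  next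
    case False
    define \<sigma> where "\<sigma> = \<alpha> / s powr (1 / r)"
    have \<sigma>: "0 < \<sigma>" using False \<alpha>(1) E(3) by (simp add: \<sigma>_def)
    have "\<alpha> powr r = \<sigma> powr r * s"
      using E(3) \<alpha>(1) r by (simp add: \<sigma>_def powr_divide powr_powr)
    then have opt: "\<sigma> powr (1 - r) * \<alpha> powr r = \<sigma> * s"
      using \<sigma> by (simp add: powr_add[symmetric] mult.assoc[symmetric])
    have "(\<Sum>x\<in>E. w x * cmod (h x)) \<le> (\<Sum>x\<in>E. w x * (\<sigma> + \<sigma> powr (1 - r) * cmod (h x) powr r))"
      by (intro sum_mono mult_left_mono le_split_powr) (use \<sigma> r w_nonneg in auto)
    also have "\<dots> = \<sigma> * sum w E + \<sigma> powr (1 - r) * (\<Sum>x\<in>E. w x * cmod (h x) powr r)"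
      by (simp add: sum.distrib sum_distrib_left algebra_simps)
    also have "\<dots> \<le> \<sigma> * s + \<sigma> powr (1 - r) * \<alpha> powr r"
      by (intro add_mono mult_left_mono E(2) sum) (use \<sigma> in auto)
    also have "\<dots> = 2 * \<alpha> * s / s powr (1 / r)" unfolding opt by (simp add: \<sigma>_def)
    finally show ?thesis .
  qed
qed

end

context dyadic_filtration
begin

text \<open>
  The summand in \<open>L\<^bsup>r\<^sub>1\<^esup>\<close> is paired using that the layer is bounded by \<open>3 C l\<close> and lives on a set of mass
  at most \<open>s\<close>, the summand in BMO using the previous lemma. The two bounds are proportional to
  \<open>s\<^bsup>1 - 1/r\<^sub>1\<^esup>\<close> and \<open>s\<close>, which singles out \<open>t = s\<^bsup>1/r\<^sub>1\<^esup>\<close> as the argument of the \<open>K\<close>-functional.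
\<close>

lemma layer_pairing:
  assumes \<phi>: "vanishing \<phi>" "0 < l" and E: "finite (exceedance \<phi> l)" "sum w (exceedance \<phi> l) \<le> s" "0 < s"
    and r1: "1 \<le> r\<^sub>1"
  shows "ennreal (cmod (\<Sum>v\<in>exceedance \<phi> l. of_real (w v) * f v * layer \<phi> l v))
    \<le> ennreal (6 * C\<^sup>2 * (l * s / s powr (1 / r\<^sub>1))) *
      K_functional (mod_const (Lp_norm M r\<^sub>1)) (mod_const (BMO_norm M \<R>)) (s powr (1 / r\<^sub>1)) (abs_fun_mod_const f)"
proof (rule le_K_functional_mod_const)
  let ?E = "exceedance \<phi> l" and ?t = "s powr (1 / r\<^sub>1)"
  let ?a = "6 * C\<^sup>2 * (l * s / ?t)" and ?g = "\<lambda>h v. of_real (w v) * h v * layer \<phi> l v"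
  have t: "0 < ?t" using E(3) by simp
  show "0 < s powr (1 / r\<^sub>1)" by (rule t)
  show a: "0 < ?a" using E(3) \<phi>(2) C_ge_1 by simp
  fix f0 f1 assume "abs_fun_mod_const f = abs_fun_mod_const (\<lambda>x. f0 x + f1 x)"
  then obtain c where c: "\<And>x. f x = f0 x + f1 x + c" by (auto simp: abs_fun_mod_const_eq_iff)
  show "ennreal (cmod (\<Sum>v\<in>?E. ?g f v)) \<le>
      ennreal (?a) * (Lp_norm M r\<^sub>1 f0 + ennreal ?t * BMO_norm M \<R> f1)"
  proof (cases "Lp_norm M r\<^sub>1 f0 < \<infinity> \<and> BMO_norm M \<R> f1 < \<infinity>")
    case True
    then obtain \<alpha> \<beta> where \<alpha>: "Lp_norm M r\<^sub>1 f0 = ennreal \<alpha>" "0 \<le> \<alpha>" and \<beta>: "BMO_norm M \<R> f1 = ennreal \<beta>" "0 \<le> \<beta>"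
      by (cases "Lp_norm M r\<^sub>1 f0"; cases "BMO_norm M \<R> f1") auto
    have split: "(\<Sum>v\<in>?E. ?g f v)
      = (\<Sum>v\<in>?E. ?g f0 v) + (\<Sum>v\<in>?E. of_real (w v) * (f1 v + c) * layer \<phi> l v)"
      by (simp add: c sum.distrib[symmetric] algebra_simps)
    have "cmod (\<Sum>v\<in>?E. ?g f0 v) \<le> (\<Sum>v\<in>?E. w v * cmod (f0 v) * (3 * C * l))"
      using layer_bound[OF \<phi>] w_nonneg by (auto simp: norm_mult intro!: sum_norm_le mult_left_mono)
    also have "\<dots> = 3 * C * l * (\<Sum>v\<in>?E. w v * cmod (f0 v))" by (simp add: sum_distrib_left mult_ac)
    also have "\<dots> \<le> 3 * C * l * (2 * \<alpha> * s / ?t)"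
      by (intro mult_left_mono sum_le_Lp_norm[OF r1 E]) (use \<alpha> C_ge_1 \<phi>(2) in auto)
    also have "\<dots> \<le> 3 * C\<^sup>2 * l * (2 * \<alpha> * s / ?t)"
      using C_ge_1 \<phi>(2) \<alpha>(2) E(3) by (intro mult_right_mono) (auto simp: power2_eq_square)
    finally have 1: "cmod (\<Sum>v\<in>?E. ?g f0 v) \<le> ?a * \<alpha>"
      by (simp add: mult_ac)
    have "cmod (\<Sum>v\<in>?E. of_real (w v) * (f1 v + c) * layer \<phi> l v) \<le> 3 * C\<^sup>2 * l * \<beta> * sum w ?E"
    proof (rule layer_pairing_BMO[OF \<phi> E(1) \<beta>(2)])
      fix R assume R: "R \<in> \<R>"
      show "\<exists>d. (\<Sum>x\<in>R. w x * cmod (f1 x + c - d)) \<le> \<beta> * sum w R"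
        using BMO_norm_oscillation[OF R, of f1 \<beta>] \<beta> by (intro exI[of _ "mean_on M R f1 + c"]) simp
    qed
    also have "\<dots> \<le> 6 * C\<^sup>2 * l * \<beta> * s"
      using E(2,3) C_ge_1 \<phi>(2) \<beta>(2) w_nonneg by (intro mult_mono) (auto simp: sum_nonneg)
    also have "\<dots> = ?a * (?t * \<beta>)" using t by simp
    finally have "cmod (\<Sum>v\<in>?E. ?g f v)
        \<le> ?a * \<alpha> + ?a * (?t * \<beta>)"
      using 1 norm_triangle_ineq[of "\<Sum>v\<in>?E. ?g f0 v"
          "\<Sum>v\<in>?E. of_real (w v) * (f1 v + c) * layer \<phi> l v"] unfolding split by linarith
    then have "ennreal (cmod (\<Sum>v\<in>?E. ?g f v))
        \<le> ennreal (?a * (\<alpha> + ?t * \<beta>))"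
      by (intro ennreal_leI) (simp only: distrib_left)
    also have "\<dots> = ennreal (?a) * (ennreal \<alpha> + ennreal ?t * ennreal \<beta>)"
      using a \<alpha>(2) \<beta>(2) t by (simp add: ennreal_mult[symmetric] ennreal_plus[symmetric] del: ennreal_plus)
    finally show ?thesis unfolding \<alpha>(1) \<beta>(1) .
  next
    case False
    have top: "Lp_norm M r\<^sub>1 f0 + ennreal ?t * BMO_norm M \<R> f1 = top"
    proof -
      have "Lp_norm M r\<^sub>1 f0 = top \<or> BMO_norm M \<R> f1 = top"
        using False by (metis infinity_ennreal_def top.not_eq_extremum)
      then show ?thesis using t E(3) by (auto simp: ennreal_mult_top)
    qed
    have "ennreal (?a) \<noteq> 0" using a by (simp only: ennreal_eq_0_iff not_le)
    then show ?thesis unfolding top by (simp only: ennreal_mult_top if_False top_greatest)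
  qed
qed

end

context dyadic_filtration
begin

text \<open>
  A function of integral zero with finite support is the sum of finitely many layers: its good part
  vanishes at low heights and is the whole function at large heights. The numbers \<open>s i\<close> are the
  bounds for the masses of the supports that the weak type estimate provides, and the sum of the
  \<open>r'\<close>-th powers of the heights, weighted with them, is at most a multiple of \<open>\<integral> |\<phi>|\<^bsup>r'\<^esup>\<close>.
\<close>

lemma pairing_estimate:
  fixes f \<phi> :: "'v \<Rightarrow> complex"
  assumes r: "1 \<le> r\<^sub>1" "1 < r" "r\<^sub>1 = r * (1 - \<theta>)" and r': "1 / r + 1 / r' = 1" "1 < r'"
    and S: "finite S" "S \<subseteq> Q t\<^sub>0 v\<^sub>0" and \<phi>: "\<And>x. x \<notin> S \<Longrightarrow> \<phi> x = 0" "(\<Sum>x\<in>S. of_real (w x) * \<phi> x) = 0"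
  defines "I \<equiv> interpolation_integral (mod_const (Lp_norm M r\<^sub>1)) (mod_const (BMO_norm M \<R>)) \<theta> r (abs_fun_mod_const f)"
  shows "ennreal (cmod (\<Sum>x\<in>S. of_real (w x) * f x * \<phi> x)) \<le> ennreal (6 * C\<^sup>2) *
    (ennreal r\<^sub>1 * I + ennreal (2 powr r' * (2 powr r' / (1 - 2 powr (1 - r'))) * (\<Sum>x\<in>S. w x * cmod (\<phi> x) powr r')))"
proof (cases "\<forall>x. \<phi> x = 0")
  case False
  then obtain x0 where x0: "x0 \<in> S" "\<phi> x0 \<noteq> 0" using \<phi>(1) by blast
  define x where "x = mean_abs \<phi> t\<^sub>0 v\<^sub>0 / 2"
  have "0 < (\<Sum>u\<in>Q t\<^sub>0 v\<^sub>0. w u * cmod (\<phi> u))"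
    using x0 S(2) finite_Q w_pos w_nonneg by (intro sum_pos2[of _ x0]) auto
  then have "0 < mean_abs \<phi> t\<^sub>0 v\<^sub>0" using Q_pos by (simp add: mean_abs_def)
  then have x: "0 < x" "x < mean_abs \<phi> t\<^sub>0 v\<^sub>0" by (auto simp: x_def)
  define L where "L = (\<lambda>i::nat. x * 2 ^ i)"
  have L: "0 < L i" for i using x by (simp add: L_def)
  have "(\<integral>\<^sup>+y. ennreal (cmod (\<phi> y) powr 1) \<partial>M) = (\<Sum>y\<in>S. ennreal (w y) * ennreal (cmod (\<phi> y) powr 1))"
    by (rule nn_integral_M_finite[OF S(1)]) (simp add: \<phi>(1))
  also have "\<dots> < \<infinity>" by (simp add: ennreal_mult[symmetric] w_nonneg)
  finally have van: "vanishing \<phi>" by (rule Lp_vanishing[rotated]) simp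
  \<comment> \<open>Below the mean over \<open>Q t\<^sub>0 v\<^sub>0\<close> every stopping class that meets the support contains it.\<close>
  have good_x: "good_part \<phi> x v = 0" for v
  proof -
    let ?P = "stopping_class \<phi> x v"
    have "(\<Sum>u\<in>?P. of_real (w u) * \<phi> u) = 0"
    proof (cases "?P \<inter> S = {}")
      case True
      then show ?thesis using \<phi>(1) by (intro sum.neutral) auto
    next
      case False
      then obtain u where u: "u \<in> ?P" "u \<in> S" by blast
      have "u \<in> Q t\<^sub>0 v\<^sub>0" using u S(2) by blast
      then have "x < mean_abs \<phi> t\<^sub>0 u" using x(2) mean_abs_cong[of u t\<^sub>0 v\<^sub>0 t\<^sub>0] by simp
      then have "t\<^sub>0 \<le> stopping_time \<phi> x u" by (rule le_stopping_time[OF van x(1)])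
      then have "Q t\<^sub>0 u \<subseteq> stopping_class \<phi> x u" unfolding stopping_class_def by (rule Q_mono)
      then have sub: "S \<subseteq> ?P"
        using S(2) Q_eq[OF \<open>u \<in> Q t\<^sub>0 v\<^sub>0\<close>] stopping_class_eq[OF van x(1) u(1)] by simp
      have "(\<Sum>u\<in>?P. of_real (w u) * \<phi> u) = (\<Sum>u\<in>S. of_real (w u) * \<phi> u)"
        by (rule sum.mono_neutral_right[OF finite_stopping_class sub]) (simp add: \<phi>(1))
      then show ?thesis using \<phi>(2) by simp
    qed
    then show ?thesis by (simp add: good_part_def)
  qed
  define B where "B = (\<Sum>u\<in>S. cmod (\<phi> u))"
  have "cmod (\<phi> u) \<le> B" for u
    using member_le_sum[of u S "\<lambda>u. cmod (\<phi> u)"] S(1) \<phi>(1)[of u] by (cases "u \<in> S") (auto simp: B_def sum_nonneg)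
  then have "(\<Sum>u\<in>Q t v. w u * cmod (\<phi> u)) \<le> sum w (Q t v) * B" for t v
    unfolding sum_distrib_right by (intro sum_mono mult_left_mono) (auto simp: w_nonneg)
  then have mean_B: "mean_abs \<phi> t v \<le> B" for t v
    using Q_pos[of t v] by (simp add: mean_abs_def divide_le_eq mult.commute)
  obtain n where n: "B / x < 2 ^ n" using real_arch_pow[of 2 "B / x"] by auto
  then have "B < L n" using x by (simp add: L_def divide_less_eq mult.commute)
  then have "v \<notin> exceedance \<phi> (L n)" for v
    using mean_B[of _ v] unfolding exceedance_def by (auto simp: not_less intro: order_trans less_imp_le)
  then have good_n: "good_part \<phi> (L n) v = \<phi> v" for v
    by (intro good_part_stop_0 stopping_time_outside)
  have decomp: "\<phi> v = (\<Sum>i<n. layer \<phi> (L i) v)" for v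
    using sum_layers[of \<phi> x v n] good_n[of v] good_x[of v] by (simp add: L_def)
  define E where "E = (\<lambda>i. exceedance \<phi> (L i))"
  have fin_E: "finite (E i)" for i
  proof -
    have "E i \<subseteq> (\<Union>u\<in>S. stopping_class \<phi> (L i) u)"
    proof
      fix v assume "v \<in> E i"
      then have "L i < mean_abs \<phi> (stopping_time \<phi> (L i) v) v"
        unfolding E_def by (simp add: exceedance_iff[OF van L])
      then have "mean_abs \<phi> (stopping_time \<phi> (L i) v) v \<noteq> 0" using L[of i] by linarith
      then have "(\<Sum>u\<in>stopping_class \<phi> (L i) v. w u * cmod (\<phi> u)) \<noteq> 0"
        unfolding mean_abs_def stopping_class_def by auto
      then obtain u where "u \<in> stopping_class \<phi> (L i) v" "w u * cmod (\<phi> u) \<noteq> 0"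
        by (meson sum.neutral)
      then have "u \<in> stopping_class \<phi> (L i) v" "u \<in> S" using \<phi>(1)[of u] by auto
      then show "v \<in> (\<Union>u\<in>S. stopping_class \<phi> (L i) u)"
        using stopping_class_eq[OF van L, of u i v] stopping_class_self[of v \<phi> "L i"] by auto
    qed
    then show ?thesis by (rule finite_subset) (use S(1) finite_stopping_class in auto)
  qed
  let ?S = "\<lambda>i. {u\<in>S. L i < 2 * cmod (\<phi> u)}" and ?m = "\<lambda>i u. w u * (2 / L i * cmod (\<phi> u))"
  define s where "s = (\<lambda>i. \<Sum>u\<in>?S i. ?m i u)"
  have s0: "0 \<le> s i" for i using L[of i] w_nonneg by (auto simp: s_def intro!: sum_nonneg)
  have E_s: "sum w (E i) \<le> s i" for i
  proof -
    have "ennreal (sum w (E i)) = (\<integral>\<^sup>+v. indicator (E i) v \<partial>M)"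
      by (simp add: emeasure_M[OF fin_E])
    also have "\<dots> \<le> (\<integral>\<^sup>+u. ennreal (2 / L i * cmod (\<phi> u)) * indicator {u. L i < 2 * cmod (\<phi> u)} u \<partial>M)"
      unfolding E_def by (rule exceedance_weak_type[OF van L])
    also have "\<dots> = (\<Sum>u\<in>?S i. ennreal (w u) *
        (ennreal (2 / L i * cmod (\<phi> u)) * indicator {u. L i < 2 * cmod (\<phi> u)} u))"
      by (rule nn_integral_M_finite) (use S(1) \<phi>(1) L in auto)
    also have "\<dots> = (\<Sum>u\<in>?S i. ennreal (?m i u))"
      by (rule sum.cong[OF refl]) (use L[of i] w_nonneg in \<open>auto simp: ennreal_mult[symmetric]\<close>)
    also have "\<dots> = ennreal (s i)"
      unfolding s_def by (rule sum_ennreal) (use L[of i] w_nonneg in auto)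
    finally show ?thesis using s0 by simp
  qed
  define G where "G = (\<lambda>i. \<Sum>v\<in>E i. of_real (w v) * f v * layer \<phi> (L i) v)"
  have total: "(\<Sum>v\<in>S. of_real (w v) * f v * \<phi> v) = (\<Sum>i<n. G i)"
  proof -
    define V where "V = S \<union> (\<Union>i<n. E i)"
    have V: "finite V" "S \<subseteq> V" "\<And>i. i < n \<Longrightarrow> E i \<subseteq> V" using S(1) fin_E by (auto simp: V_def)
    have "(\<Sum>v\<in>S. of_real (w v) * f v * \<phi> v) = (\<Sum>v\<in>V. of_real (w v) * f v * \<phi> v)"
      by (rule sum.mono_neutral_left[OF V(1,2)]) (simp add: \<phi>(1))
    also have "\<dots> = (\<Sum>v\<in>V. \<Sum>i<n. of_real (w v) * f v * layer \<phi> (L i) v)"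
      by (subst decomp) (simp add: sum_distrib_left)
    also have "\<dots> = (\<Sum>i<n. \<Sum>v\<in>V. of_real (w v) * f v * layer \<phi> (L i) v)" by (rule sum.swap)
    also have "\<dots> = (\<Sum>i<n. G i)"
    proof (rule sum.cong[OF refl])
      fix i assume "i \<in> {..<n}"
      then show "(\<Sum>v\<in>V. of_real (w v) * f v * layer \<phi> (L i) v) = G i"
        unfolding G_def using V layer_outside[OF L, of _ \<phi> i]
        by (intro sum.mono_neutral_right) (auto simp: E_def)
    qed
    finally show ?thesis .
  qed
  let ?K = "\<lambda>t. K_functional (mod_const (Lp_norm M r\<^sub>1)) (mod_const (BMO_norm M \<R>)) t (abs_fun_mod_const f)"
  let ?k = "\<lambda>i. ennreal (x * 2 ^ i * s i / s i powr (1 / r\<^sub>1)) * ?K (s i powr (1 / r\<^sub>1))"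
    and ?Z = "2 powr r' * (2 powr r' / (1 - 2 powr (1 - r'))) * (\<Sum>x\<in>S. w x * cmod (\<phi> x) powr r')"
    and ?n = "\<lambda>i u. if L i < 2 * cmod (\<phi> u) then w u * (2 * cmod (\<phi> u) * L i powr (r' - 1)) else 0"
  have G_le: "ennreal (cmod (G i)) \<le> ennreal (6 * C\<^sup>2) * ?k i" for i
  proof (cases "s i = 0")
    case True
    then have "sum w (E i) = 0" using E_s[of i] by (intro antisym sum_nonneg) (auto simp: w_nonneg)
    then have "E i = {}" using sum_w_pos[OF fin_E, of i] by force
    then show ?thesis by (simp add: G_def)
  next
    case False
    then have s_pos: "0 < s i" using s0[of i] by simp
    have "ennreal (cmod (G i)) \<le> ennreal (6 * C\<^sup>2 * (L i * s i / s i powr (1 / r\<^sub>1))) * ?K (s i powr (1 / r\<^sub>1))"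
      unfolding G_def E_def
      by (rule layer_pairing[OF van L fin_E[unfolded E_def] E_s[unfolded E_def] s_pos r(1)])
    also have "ennreal (6 * C\<^sup>2 * (L i * s i / s i powr (1 / r\<^sub>1))) = ennreal (6 * C\<^sup>2) * ennreal (x * 2 ^ i * s i / s i powr (1 / r\<^sub>1))"
      unfolding L_def by (rule ennreal_mult) (use x(1) s_pos in auto)
    finally show ?thesis by (simp only: mult.assoc)
  qed
  have "ennreal (cmod (\<Sum>v\<in>S. of_real (w v) * f v * \<phi> v)) \<le> (\<Sum>i<n. ennreal (cmod (G i)))"
    unfolding total using norm_sum[of G "{..<n}"] by (simp add: ennreal_leI)
  also have "\<dots> \<le> (\<Sum>i<n. ennreal (6 * C\<^sup>2) * ?k i)"
    by (rule sum_mono) (rule G_le)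
  also have "\<dots> = ennreal (6 * C\<^sup>2) * (\<Sum>i<n. ?k i)"
    by (rule sum_distrib_left[symmetric])
  also have "\<dots> \<le> ennreal (6 * C\<^sup>2) * (ennreal r\<^sub>1 * I + ennreal ?Z)"
  proof (rule mult_left_mono)
    have "(\<Sum>i<n. ?k i)
      \<le> ennreal r\<^sub>1 * I + ennreal (2 powr r') * (\<Sum>i<n. ennreal ((x * 2 ^ i) powr r' * s i))"
      unfolding I_def by (rule dyadic_sum_K_functional) (use r r' s0 x(1) in auto)
    moreover have "ennreal (2 powr r') * (\<Sum>i<n. ennreal ((x * 2 ^ i) powr r' * s i))
      \<le> ennreal ?Z"
    proof -
      define c where "c = 1 - 2 powr - (r' - 1)"
      have c: "0 < c" unfolding c_def using r'(2) powr_less_mono[of "- (r' - 1)" 0 2] by simp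
      have layers: "2 * cmod (\<phi> u) * (\<Sum>i\<in>{i\<in>{..<n}. L i < 2 * cmod (\<phi> u)}. L i powr (r' - 1)) \<le> 2 powr r' / c * cmod (\<phi> u) powr r'"
        (is "_ * sum _ ?A \<le> _") for u
      proof (cases "?A = {}")
        case True
        then show ?thesis using c by (simp only: sum.empty) simp
      next
        case False
        have "Max ?A \<in> ?A" using False by (intro Max_in) auto
        then have M: "L (Max ?A) \<le> 2 * cmod (\<phi> u)" "0 < cmod (\<phi> u)" using L[of "Max ?A"] by auto
        have "(\<Sum>i\<in>?A. L i powr (r' - 1)) \<le> L (Max ?A) powr (r' - 1) / c"
          unfolding L_def c_def by (rule geometric_sum_powr) (use r'(2) x(1) False in \<open>auto simp: L_def\<close>)
        also have "\<dots> \<le> (2 * cmod (\<phi> u)) powr (r' - 1) / c"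
          using M L[of "Max ?A"] c r'(2) by (intro divide_right_mono powr_mono2) auto
        finally have "2 * cmod (\<phi> u) * (\<Sum>i\<in>?A. L i powr (r' - 1)) \<le> 2 * cmod (\<phi> u) * ((2 * cmod (\<phi> u)) powr (r' - 1) / c)"
          by (rule mult_left_mono) simp
        also have "\<dots> = (2 * cmod (\<phi> u)) powr r' / c" using M(2) by (simp add: powr_diff)
        finally show ?thesis by (simp add: powr_mult)
      qed
      have "(\<Sum>i<n. L i powr r' * s i) = (\<Sum>i<n. \<Sum>u\<in>S. ?n i u)"
      proof (rule sum.cong[OF refl])
        fix i
        have "L i powr r' * s i = (\<Sum>u\<in>?S i. w u * (2 * cmod (\<phi> u) * L i powr (r' - 1)))"
          unfolding s_def sum_distrib_left using L[of i] by (intro sum.cong refl) (simp add: powr_diff field_simps)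
        then show "L i powr r' * s i = (\<Sum>u\<in>S. ?n i u)"
          using S(1) by (simp add: sum.inter_filter)
      qed
      also have "\<dots> = (\<Sum>u\<in>S. \<Sum>i<n. ?n i u)"
        by (rule sum.swap)
      also have "\<dots> = (\<Sum>u\<in>S. w u * (2 * cmod (\<phi> u) * (\<Sum>i\<in>{i\<in>{..<n}. L i < 2 * cmod (\<phi> u)}. L i powr (r' - 1))))"
        by (rule sum.cong[OF refl]) (subst sum.inter_filter[symmetric], simp_all add: sum_distrib_left)
      also have "\<dots> \<le> (\<Sum>u\<in>S. w u * (2 powr r' / c * cmod (\<phi> u) powr r'))"
        by (intro sum_mono mult_left_mono layers w_nonneg)
      also have "\<dots> = 2 powr r' / c * (\<Sum>u\<in>S. w u * cmod (\<phi> u) powr r')"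
        by (simp add: sum_distrib_left mult_ac)
      finally have le: "(\<Sum>i<n. L i powr r' * s i) \<le> 2 powr r' / c * (\<Sum>u\<in>S. w u * cmod (\<phi> u) powr r')" .
      have "ennreal (2 powr r') * (\<Sum>i<n. ennreal ((x * 2 ^ i) powr r' * s i)) = ennreal (2 powr r' * (\<Sum>i<n. L i powr r' * s i))"
        using s0 by (subst sum_ennreal) (auto simp: L_def ennreal_mult sum_nonneg)
      also have "\<dots> \<le> ennreal (2 powr r' * (2 powr r' / c * (\<Sum>u\<in>S. w u * cmod (\<phi> u) powr r')))"
        by (intro ennreal_leI mult_left_mono le) auto
      finally show ?thesis by (simp only: c_def minus_diff_eq mult.assoc)
    qed
    ultimately show "(\<Sum>i<n. ?k i)
      \<le> ennreal r\<^sub>1 * I + ennreal ?Z"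
      by (meson add_left_mono order_trans)
  qed simp
  finally show ?thesis .
qed simp

end

context weighted_sets
begin

text \<open>
  The function \<open>f\<close> is tested against \<open>\<epsilon> cnj h |h|\<^bsup>r - 2\<^esup>\<close>, where \<open>h = f - f y\<close>. This does not have integral zero,
  which is corrected at \<open>y\<close>. There \<open>h\<close> vanishes, and a correction at a vertex of large weight
  has controlled norm. The sum on the right of the hypothesis scales with the power \<open>r' > 1\<close> of \<open>\<epsilon>\<close> and
  the pairing only linearly, so for a suitable small \<open>\<epsilon>\<close> that sum can be absorbed.
\<close>

lemma Lr_norm_finite_from_pairing:
  fixes f :: "'v \<Rightarrow> complex"
  assumes r: "1 < r" "1 / r + 1 / r' = 1" "1 < r'" and a: "0 < a" "0 \<le> I"
    and pair: "\<And>S \<phi>. finite S \<Longrightarrow> (\<And>x. x \<notin> S \<Longrightarrow> \<phi> x = 0) \<Longrightarrow> (\<Sum>x\<in>S. of_real (w x) * \<phi> x) = 0 \<Longrightarrow>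
      cmod (\<Sum>x\<in>S. of_real (w x) * f x * \<phi> x) \<le> a * (I + (\<Sum>x\<in>S. w x * cmod (\<phi> x) powr r'))"
    and T: "finite T" "sum w T \<le> w y"
  shows "(\<Sum>x\<in>T. w x * cmod (f x - f y) powr r) \<le> 2 * a * (2 * a * (1 + 2 powr r')) powr (1 / (r' - 1)) * I"
proof -
  define b where "b = 2 * a * (1 + 2 powr r')"
  have b: "0 < b" using a(1) by (auto simp: b_def intro!: mult_pos_pos add_pos_nonneg)
  \<comment> \<open>the choice for which \<open>a (1 + 2\<^bsup>r'\<^esup>) \<epsilon>\<^bsup>r'\<^esup> = \<epsilon> / 2\<close>\<close>
  define \<epsilon> where "\<epsilon> = b powr (- 1 / (r' - 1))"
  have \<epsilon>: "0 < \<epsilon>" using b by (simp add: \<epsilon>_def)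
  have \<epsilon>_b: "\<epsilon> powr (r' - 1) = 1 / b"
  proof -
    have "- 1 / (r' - 1) * (r' - 1) = - 1" using r(3) by simp
    then have "\<epsilon> powr (r' - 1) = b powr - 1" by (simp only: \<epsilon>_def powr_powr)
    then show ?thesis using b by (simp add: powr_minus_divide)
  qed
  have absorb: "a * ((1 + 2 powr r') * \<epsilon> powr r') = \<epsilon> / 2"
  proof -
    have "\<epsilon> powr r' = \<epsilon> * \<epsilon> powr (r' - 1)" using \<epsilon> by (simp add: powr_diff)
    then have "\<epsilon> powr r' = \<epsilon> * (1 / b)" by (simp only: \<epsilon>_b)
    moreover have "a * (1 + 2 powr r') = b / 2" by (simp add: b_def)
    ultimately have "a * ((1 + 2 powr r') * \<epsilon> powr r') = (b / 2) * (\<epsilon> * (1 / b))"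
      by (simp only: mult.assoc[symmetric])
    then show ?thesis using b by simp
  qed
  have rr: "(r - 1) * r' = r" using r by (simp add: field_simps)
  define h where "h = (\<lambda>x. f x - f y)"
  define U where "U = T - {y}"
  have U: "finite U" "y \<notin> U" "sum w U \<le> w y"
    using T sum_mono2[of T U w] w_nonneg by (auto simp: U_def intro: order_trans)
  define X where "X = (\<Sum>x\<in>U. w x * cmod (h x) powr r)"
  have TX: "(\<Sum>x\<in>T. w x * cmod (f x - f y) powr r) = X"
    unfolding X_def h_def using T(1) by (intro sum.mono_neutral_right) (auto simp: U_def)
  have X0: "0 \<le> X" by (auto simp: X_def w_nonneg intro!: sum_nonneg)
  define \<psi> where "\<psi> = (\<lambda>x. of_real (\<epsilon> * cmod (h x) powr (r - 2)) * cnj (h x))"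
  have \<psi>_norm: "cmod (\<psi> x) = \<epsilon> * cmod (h x) powr (r - 1)" for x
  proof -
    have "cmod (\<psi> x) = \<epsilon> * (cmod (h x) powr (r - 2) * cmod (h x))"
      using \<epsilon> by (simp add: \<psi>_def norm_mult)
    also have "cmod (h x) powr (r - 2) * cmod (h x) = cmod (h x) powr (r - 1)"
      by (cases "h x = 0") (simp_all add: powr_diff power2_eq_square)
    finally show ?thesis .
  qed
  have \<psi>_pair: "h x * \<psi> x = of_real (\<epsilon> * cmod (h x) powr r)" for x
  proof (cases "h x = 0")
    case False
    have "h x * \<psi> x = of_real (\<epsilon> * cmod (h x) powr (r - 2)) * (h x * cnj (h x))" by (simp add: \<psi>_def mult_ac)
    also have "h x * cnj (h x) = of_real ((cmod (h x))\<^sup>2)" by (rule complex_norm_square[symmetric])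
    also have "of_real (\<epsilon> * cmod (h x) powr (r - 2)) * complex_of_real ((cmod (h x))\<^sup>2)
        = of_real (\<epsilon> * (cmod (h x) powr (r - 2) * (cmod (h x))\<^sup>2))" by simp
    also have "cmod (h x) powr (r - 2) * (cmod (h x))\<^sup>2 = cmod (h x) powr r"
      using False by (simp add: powr_diff)
    finally show ?thesis .
  qed (simp add: \<psi>_def)
  have \<psi>_r': "cmod (\<psi> x) powr r' = \<epsilon> powr r' * cmod (h x) powr r" for x
    unfolding \<psi>_norm using \<epsilon> by (simp add: powr_mult powr_powr rr)
  define Y where "Y = (\<Sum>x\<in>U. w x * cmod (\<psi> x) powr r')"
  have Y: "Y = \<epsilon> powr r' * X" unfolding Y_def X_def \<psi>_r' by (simp add: sum_distrib_left mult_ac)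
  define z where "z = - (\<Sum>x\<in>U. of_real (w x) * \<psi> x) / of_real (w y)"
  define \<phi> where "\<phi> = (\<lambda>x. if x \<in> U then \<psi> x else if x = y then z else 0)"
  have sum_insert: "(\<Sum>x\<in>insert y U. g x) = g y + (\<Sum>x\<in>U. g x)" for g :: "'v \<Rightarrow> 'z::comm_monoid_add"
    using U by simp
  have \<phi>_U: "x \<in> U \<Longrightarrow> \<phi> x = \<psi> x" and \<phi>_y: "\<phi> y = z" for x using U(2) by (auto simp: \<phi>_def)
  have mean: "(\<Sum>x\<in>insert y U. of_real (w x) * \<phi> x) = 0"
    unfolding sum_insert \<phi>_y using w_pos[of y] by (simp add: \<phi>_U z_def)
  have lhs: "(\<Sum>x\<in>insert y U. of_real (w x) * f x * \<phi> x) = of_real (\<epsilon> * X)"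
  proof -
    have "(\<Sum>x\<in>insert y U. of_real (w x) * f x * \<phi> x)
      = (\<Sum>x\<in>insert y U. of_real (w x) * h x * \<phi> x) + f y * (\<Sum>x\<in>insert y U. of_real (w x) * \<phi> x)"
      unfolding sum_distrib_left sum.distrib[symmetric]
      by (rule sum.cong[OF refl]) (simp add: h_def algebra_simps)
    also have "\<dots> = (\<Sum>x\<in>U. of_real (w x) * (h x * \<psi> x))"
      unfolding mean sum_insert by (simp add: \<phi>_U h_def mult.assoc)
    also have "\<dots> = of_real (\<Sum>x\<in>U. w x * (\<epsilon> * cmod (h x) powr r))" unfolding \<psi>_pair by simp
    also have "(\<Sum>x\<in>U. w x * (\<epsilon> * cmod (h x) powr r)) = \<epsilon> * X"
      by (simp add: X_def sum_distrib_left mult_ac)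
    finally show ?thesis .
  qed
  have corr: "w y * cmod z powr r' \<le> 2 powr r' * Y"
  proof -
    have wy: "0 < w y" by (rule w_pos)
    have Y0: "0 \<le> Y" by (auto simp: Y_def w_nonneg intro!: sum_nonneg)
    define \<alpha> where "\<alpha> = Y powr (1 / r')"
    have "cmod (\<Sum>x\<in>U. of_real (w x) * \<psi> x) \<le> (\<Sum>x\<in>U. w x * cmod (\<psi> x))"
      by (rule sum_norm_le) (simp add: norm_mult w_nonneg)
    also have "\<dots> = (\<Sum>x\<in>U. w x * cmod (if x \<in> U then \<psi> x else 0))" by (rule sum.cong) auto
    also have "\<dots> \<le> 2 * \<alpha> * w y / w y powr (1 / r')"
    proof (rule sum_le_Lp_norm)
      have "(\<integral>\<^sup>+x. ennreal (cmod (if x \<in> U then \<psi> x else 0) powr r') \<partial>M) = (\<Sum>x\<in>U. ennreal (w x) * ennreal (cmod (if x \<in> U then \<psi> x else 0) powr r'))"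
        by (rule nn_integral_M_finite[OF U(1)]) simp
      also have "\<dots> = (\<Sum>x\<in>U. ennreal (w x * cmod (\<psi> x) powr r'))"
        by (rule sum.cong[OF refl]) (simp add: ennreal_mult w_nonneg)
      also have "\<dots> = ennreal Y" unfolding Y_def by (rule sum_ennreal) (simp add: w_nonneg)
      finally show "Lp_norm M r' (\<lambda>x. if x \<in> U then \<psi> x else 0) \<le> ennreal \<alpha>"
        unfolding Lp_norm_def \<alpha>_def by (simp add: ennpowr_ennreal Y0)
    qed (use r U wy in \<open>auto simp: \<alpha>_def\<close>)
    finally have "cmod z \<le> 2 * \<alpha> / w y powr (1 / r')"
      using wy by (simp add: z_def norm_divide divide_le_eq mult_ac)
    then have "cmod z powr r' \<le> (2 * \<alpha> / w y powr (1 / r')) powr r'"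
      using r(3) by (intro powr_mono2) auto
    also have "\<dots> = 2 powr r' * Y / w y"
      using r(3) wy Y0 by (simp add: \<alpha>_def powr_mult powr_divide powr_powr)
    finally show ?thesis using wy by (simp add: le_divide_eq mult.commute)
  qed
  have "(\<Sum>x\<in>insert y U. w x * cmod (\<phi> x) powr r') \<le> (1 + 2 powr r') * (\<epsilon> powr r' * X)"
    unfolding sum_insert \<phi>_y using corr unfolding Y[symmetric] by (simp add: \<phi>_U Y_def algebra_simps)
  then have "a * (I + (\<Sum>x\<in>insert y U. w x * cmod (\<phi> x) powr r')) \<le> a * (I + (1 + 2 powr r') * (\<epsilon> powr r' * X))"
    using a(1) by (intro mult_left_mono) auto
  moreover have "cmod (\<Sum>x\<in>insert y U. of_real (w x) * f x * \<phi> x) \<le> a * (I + (\<Sum>x\<in>insert y U. w x * cmod (\<phi> x) powr r'))"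
    by (rule pair[OF _ _ mean]) (use U in \<open>auto simp: \<phi>_def\<close>)
  moreover have "cmod (\<Sum>x\<in>insert y U. of_real (w x) * f x * \<phi> x) = \<epsilon> * X"
    unfolding lhs norm_of_real using \<epsilon> X0 by simp
  moreover have "a * (I + (1 + 2 powr r') * (\<epsilon> powr r' * X)) = a * I + a * ((1 + 2 powr r') * \<epsilon> powr r') * X"
    by (simp add: algebra_simps)
  ultimately have "\<epsilon> * X \<le> a * I + \<epsilon> / 2 * X" unfolding absorb by linarith
  then have "\<epsilon> * X \<le> 2 * a * I" by linarith
  then have "X \<le> 2 * a * I / \<epsilon>" using \<epsilon> by (simp add: le_divide_eq mult.commute)
  also have "\<dots> = 2 * a * b powr (1 / (r' - 1)) * I"
    by (simp add: \<epsilon>_def powr_minus_divide)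
  finally show ?thesis unfolding TX b_def .
qed

text \<open>
  The constant is a limit point of the values of \<open>f\<close> at vertices whose weights tend to infinity.
\<close>

lemma Lr_norm_from_pairing:
  fixes f :: "'v \<Rightarrow> complex" and y :: "nat \<Rightarrow> 'v"
  assumes r: "0 < r" and y: "filterlim (\<lambda>n. w (y n)) at_top sequentially"
    and le: "\<And>T n. finite T \<Longrightarrow> sum w T \<le> w (y n) \<Longrightarrow> (\<Sum>x\<in>T. w x * cmod (f x - f (y n)) powr r) \<le> J"
  shows "\<exists>c. (\<integral>\<^sup>+x. ennreal (cmod (f x - c) powr r) \<partial>M) \<le> ennreal J"
proof -
  have ev: "eventually (\<lambda>n. (\<Sum>x\<in>T. w x * cmod (f x - f (y n)) powr r) \<le> J) sequentially" if "finite T" for T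
    using filterlim_at_top_ge[THEN iffD1, OF y] y le[OF that]
    by (metis (mono_tags, lifting) eventually_mono filterlim_at_top)
  obtain N where N: "\<And>n. n \<ge> N \<Longrightarrow> (\<Sum>x\<in>{y 0}. w x * cmod (f x - f (y n)) powr r) \<le> J"
    using ev[of "{y 0}"] by (auto simp: eventually_sequentially)
  have "bounded (range (\<lambda>n. f (y (n + N))))"
  proof -
    have "cmod (f (y (n + N))) \<le> cmod (f (y 0)) + (J / w (y 0)) powr (1 / r)" for n
    proof -
      have "w (y 0) * cmod (f (y 0) - f (y (n + N))) powr r \<le> J" using N[of "n + N"] by simp
      then have "cmod (f (y 0) - f (y (n + N))) powr r \<le> J / w (y 0)"
        using w_pos[of "y 0"] by (simp add: le_divide_eq mult.commute)
      then have "(cmod (f (y 0) - f (y (n + N))) powr r) powr (1 / r) \<le> (J / w (y 0)) powr (1 / r)"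
        using r by (intro powr_mono2) auto
      then have "cmod (f (y 0) - f (y (n + N))) \<le> (J / w (y 0)) powr (1 / r)"
        using r by (simp add: powr_powr)
      then show ?thesis using norm_triangle_ineq2[of "f (y (n + N))" "f (y 0)"] by (simp add: norm_minus_commute)
    qed
    then show ?thesis by (auto simp: bounded_iff)
  qed
  then obtain c k where k: "strict_mono k" and c: "((\<lambda>n. f (y (n + N))) \<circ> k) \<longlonglongrightarrow> c"
    using bounded_imp_convergent_subsequence by blast
  have sums: "(\<Sum>x\<in>T. w x * cmod (f x - c) powr r) \<le> J" if "finite T" for T
  proof (rule tendsto_upperbound)
    show "((\<lambda>n. \<Sum>x\<in>T. w x * cmod (f x - f (y (k n + N))) powr r) \<longlongrightarrow> (\<Sum>x\<in>T. w x * cmod (f x - c) powr r)) sequentially"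
      using c r by (intro tendsto_sum tendsto_mult tendsto_const tendsto_powr' tendsto_norm tendsto_diff) (auto simp: comp_def)
    have "filterlim (\<lambda>n. k n + N) at_top sequentially"
      using filterlim_compose[OF filterlim_add_const_nat_at_top filterlim_subseq[OF k]] .
    then show "eventually (\<lambda>n. (\<Sum>x\<in>T. w x * cmod (f x - f (y (k n + N))) powr r) \<le> J) sequentially"
      by (rule eventually_compose_filterlim[OF ev[OF that]])
  qed simp
  have inf: "infinite (UNIV :: 'v set)"
  proof
    assume "finite (UNIV :: 'v set)"
    then have "w (y n) \<le> sum w UNIV" for n by (intro member_le_sum) (auto simp: w_nonneg)
    moreover obtain n where "sum w UNIV + 1 \<le> w (y n)"
      using y by (auto simp: filterlim_at_top eventually_sequentially)
    ultimately show False by (meson not_le less_add_one order_trans)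
  qed
  define e where "e = from_nat_into (UNIV :: 'v set)"
  have e: "bij e" unfolding e_def by (rule bij_betw_from_nat_into[OF countable_vertices inf])
  have "(\<integral>\<^sup>+x. ennreal (cmod (f x - c) powr r) \<partial>M) = (\<Sum>j. ennreal (w (e j) * cmod (f (e j) - c) powr r))"
    unfolding nn_integral_M nn_integral_bij_count_space[OF e, symmetric]
    by (simp add: nn_integral_count_space_nat ennreal_mult w_nonneg)
  also have "\<dots> \<le> ennreal J"
    unfolding suminf_eq_SUP
  proof (rule SUP_least)
    fix n
    have "(\<Sum>j<n. ennreal (w (e j) * cmod (f (e j) - c) powr r)) = ennreal (\<Sum>j<n. w (e j) * cmod (f (e j) - c) powr r)"
      by (rule sum_ennreal) (simp add: w_nonneg)
    also have "(\<Sum>j<n. w (e j) * cmod (f (e j) - c) powr r) = (\<Sum>x\<in>e ` {..<n}. w x * cmod (f x - c) powr r)"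
      using e by (subst sum.reindex) (auto simp: bij_def inj_on_def)
    finally show "(\<Sum>j<n. ennreal (w (e j) * cmod (f (e j) - c) powr r)) \<le> ennreal J"
      using sums[of "e ` {..<n}"] by (simp add: ennreal_leI)
  qed
  finally show ?thesis by blast
qed

end

section \<open>Identification of the interpolation spaces\<close>

lemma mod_const_mono: "(\<And>f. N f \<le> N' f) \<Longrightarrow> mod_const N F \<le> mod_const N' F"
  unfolding mod_const_def by (rule INF_mono) auto

lemma interpolation_norm_mono:
  assumes "\<And>G. N0 G \<le> N0' G" "0 < r"
  shows "interpolation_norm N0 N1 \<theta> r F \<le> interpolation_norm N0' N1 \<theta> r F"
proof -
  have K: "K_functional N0 N1 t F \<le> K_functional N0' N1 t F" for t
    unfolding K_functional_def by (rule INF_superset_mono) (auto intro!: add_right_mono assms(1))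
  show ?thesis unfolding interpolation_norm_def
    using assms(2) K
    by (intro ennpowr_mono nn_integral_mono mult_right_mono divide_right_mono_ennreal mult_left_mono) auto
qed

lemma equal_with_equivalent_normsI:
  assumes "A > 0" "\<And>F. N F \<le> ennreal A * N' F" "B > 0" "\<And>F. N' F \<le> ennreal B * N F"
  shows "equal_with_equivalent_norms N N'"
proof -
  have "N F < \<infinity> \<longleftrightarrow> N' F < \<infinity>" for F
  proof
    assume "N F < \<infinity>"
    then have "ennreal B * N F < \<infinity>" by (simp add: ennreal_mult_less_top)
    then show "N' F < \<infinity>" using assms(4)[of F] by (rule le_less_trans[rotated])
  next
    assume "N' F < \<infinity>"
    then have "ennreal A * N' F < \<infinity>" by (simp add: ennreal_mult_less_top)
    then show "N F < \<infinity>" using assms(2)[of F] by (rule le_less_trans[rotated])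
  qed
  then show ?thesis unfolding equal_with_equivalent_norms_def space_of_def using assms by blast
qed

context labelled_tree
begin

abbreviation "\<mu> \<equiv> tree_measure m E g N"
abbreviation "CZ \<equiv> CZ_sets E g N"

text \<open>
  The offset of the filtration has to be chosen according to the support of the test function, but
  the constants depend on the filtration through \<open>2 m\<^sup>2\<close> only.
\<close>

lemma interpolation_Lp_subset_Lr:
  assumes r: "1 \<le> r\<^sub>1" "1 < r" "r\<^sub>1 = r * (1 - \<theta>)"
  shows "\<exists>B>0. \<forall>F. mod_const (Lp_norm \<mu> r) F \<le>
    ennreal B * interpolation_norm (mod_const (Lp_norm \<mu> r\<^sub>1)) (mod_const (BMO_norm \<mu> CZ)) \<theta> r F"
proof -
  interpret weighted_sets weight CZ
    using dyadic_filtration_CZ[of 0] by (rule dyadic_filtration.axioms(1))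
  define r' where "r' = r / (r - 1)"
  have r': "1 / r + 1 / r' = 1" "1 < r'" using r(2) by (auto simp: r'_def field_simps)
  define K where "K = 6 * (2 * real m ^ 2)\<^sup>2"
  define c where "c = 2 powr r' * (2 powr r' / (1 - 2 powr (1 - r')))"
  define a where "a = K * (r\<^sub>1 + c)"
  define D where "D = 2 * a * (2 * a * (1 + 2 powr r')) powr (1 / (r' - 1))"
  have K: "0 < K" using m2 by (simp add: K_def)
  have c: "0 < c" using r'(2) powr_less_mono[of "1 - r'" 0 2] by (simp add: c_def)
  have a: "0 < a" using K c r(1) by (simp add: a_def)
  have "0 < 1 + 2 powr r'" by (rule add_pos_nonneg) auto
  then have D: "0 < D" using a by (simp add: D_def)
  have "mod_const (Lp_norm \<mu> r) F \<le> ennreal (D powr (1 / r)) *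
      interpolation_norm (mod_const (Lp_norm \<mu> r\<^sub>1)) (mod_const (BMO_norm \<mu> CZ)) \<theta> r F" (is "_ \<le> _ * ?N F") for F
  proof -
    obtain f where f: "F = abs_fun_mod_const f"
      using fun_mod_const.abs_induct[of "\<lambda>F. \<exists>f. F = abs_fun_mod_const f" F] by blast
    define J where "J = interpolation_integral (mod_const (Lp_norm \<mu> r\<^sub>1)) (mod_const (BMO_norm \<mu> CZ)) \<theta> r F"
    have N: "?N F = ennpowr J (1 / r)" by (simp add: interpolation_norm_def J_def)
    show ?thesis
    proof (cases J)
      case top
      have "ennreal (D powr (1 / r)) \<noteq> 0" using D by simp
      then show ?thesis unfolding N top by (simp add: ennreal_mult_top)
    next
      case (real I)
      note real = real(2,1)
      have pair: "cmod (\<Sum>x\<in>S. of_real (weight x) * f x * \<phi> x) \<le> a * (I + (\<Sum>x\<in>S. weight x * cmod (\<phi> x) powr r'))"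
        if S: "finite S" "\<And>x. x \<notin> S \<Longrightarrow> \<phi> x = 0" "(\<Sum>x\<in>S. of_real (weight x) * \<phi> x) = 0" for S \<phi>
      proof -
        obtain s t v where cover: "S \<subseteq> dyadic s t v" using finite_subset_dyadic[OF S(1)] by blast
        interpret dyadic_filtration weight CZ "dyadic s" "2 * real m ^ 2" by (rule dyadic_filtration_CZ)
        let ?Y = "\<Sum>x\<in>S. weight x * cmod (\<phi> x) powr r'"
        have Y: "0 \<le> ?Y" by (intro sum_nonneg) (simp add: w_nonneg)
        have "ennreal (cmod (\<Sum>x\<in>S. of_real (weight x) * f x * \<phi> x)) \<le> ennreal K * (ennreal r\<^sub>1 * J + ennreal (c * ?Y))"
          using pairing_estimate[OF r r' S(1) cover S(2,3), of f]
          unfolding J_def f K_def c_def tree_measure_eq by simp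
        also have "\<dots> = ennreal (K * (r\<^sub>1 * I + c * ?Y))"
          using K c r(1) real(2) Y unfolding real(1)
          by (simp add: ennreal_mult[symmetric] ennreal_plus[symmetric] del: ennreal_plus)
        finally have "cmod (\<Sum>x\<in>S. of_real (weight x) * f x * \<phi> x) \<le> K * (r\<^sub>1 * I + c * ?Y)"
          using K c r(1) real(2) Y by (subst (asm) ennreal_le_iff) auto
        also have "\<dots> \<le> K * ((r\<^sub>1 + c) * I + (r\<^sub>1 + c) * ?Y)"
          using K c r(1) real(2) Y by (intro mult_left_mono add_mono mult_right_mono) auto
        finally show ?thesis by (simp add: a_def algebra_simps)
      qed
      have "\<exists>d. (\<integral>\<^sup>+x. ennreal (cmod (f x - d) powr r) \<partial>M) \<le> ennreal (D * I)"
      proof (rule Lr_norm_from_pairing)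
        show "filterlim (\<lambda>n. weight ((parent ^^ n) undefined)) at_top sequentially" by (rule large_weights)
        show "(\<Sum>x\<in>T. weight x * cmod (f x - f ((parent ^^ n) undefined)) powr r) \<le> D * I"
          if "finite T" "sum weight T \<le> weight ((parent ^^ n) undefined)" for T n
          unfolding D_def by (rule Lr_norm_finite_from_pairing[OF r(2) r' a real(2) pair that])
      qed (use r in auto)
      then obtain d where d: "(\<integral>\<^sup>+x. ennreal (cmod (f x - d) powr r) \<partial>M) \<le> ennreal (D * I)" ..
      have "F = abs_fun_mod_const (\<lambda>x. f x - d)"
        unfolding f abs_fun_mod_const_eq_iff by (rule exI[of _ d]) simp
      then have "mod_const (Lp_norm \<mu> r) F \<le> Lp_norm M r (\<lambda>x. f x - d)"
        using mod_const_le[of "Lp_norm \<mu> r" "\<lambda>x. f x - d"] unfolding tree_measure_eq by simp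
      also have "\<dots> \<le> ennpowr (ennreal (D * I)) (1 / r)"
        unfolding Lp_norm_def using r(2) d by (intro ennpowr_mono) auto
      also have "\<dots> = ennreal (D powr (1 / r)) * ?N F"
        unfolding N real(1) using D real(2) r(2) by (simp add: ennreal_mult ennpowr_mult)
      finally show ?thesis .
    qed
  qed
  moreover have "0 < D powr (1 / r)" using D by simp
  ultimately show ?thesis by blast
qed

end

theorem corollary15:
  fixes m :: nat and E :: "'v \<Rightarrow> 'v \<Rightarrow> bool" and g\<^sub>0 :: "'v set" and N :: "'v \<Rightarrow> int"
  assumes "m \<ge> 2"
    and "homogeneous_tree m E"
    and "infinite_geodesic E g\<^sub>0"
    and "geodesic_labelling E g\<^sub>0 N"
  shows "let \<mu> = tree_measure m E g\<^sub>0 N;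
             L = (\<lambda>s. mod_const (Lp_norm \<mu> s));
             H1 = mod_const (H1_norm \<mu> (CZ_sets E g\<^sub>0 N));
             BMO = mod_const (BMO_norm \<mu> (CZ_sets E g\<^sub>0 N))
         in
           (\<forall>r\<^sub>1 r \<theta> :: real.
              1 \<le> r\<^sub>1 \<and> r\<^sub>1 < r \<and> 0 < \<theta> \<and> \<theta> < 1 \<and> 1 / r = (1 - \<theta>) / r\<^sub>1 \<longrightarrow>
              equal_with_equivalent_norms (interpolation_norm (L r\<^sub>1) BMO \<theta> r) (L r)) \<and>
           (\<forall>r \<theta> :: real.
              0 < \<theta> \<and> \<theta> < 1 \<and> 1 / r = 1 - \<theta> \<longrightarrow>
              equal_with_equivalent_norms (interpolation_norm H1 BMO \<theta> r) (L r))"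
proof -
  interpret labelled_tree m E g\<^sub>0 N by unfold_locales (fact assms)+
  interpret dyadic_filtration weight "CZ_sets E g\<^sub>0 N" "dyadic 0" "2 * real m ^ 2"
    by (rule dyadic_filtration_CZ)
  note M = tree_measure_eq
  have Lp: "equal_with_equivalent_norms (interpolation_norm (mod_const (Lp_norm \<mu> r\<^sub>1)) (mod_const (BMO_norm \<mu> CZ)) \<theta> r)
      (mod_const (Lp_norm \<mu> r))"
    if r: "1 \<le> r\<^sub>1" "r\<^sub>1 < r" "1 / r = (1 - \<theta>) / r\<^sub>1" for r\<^sub>1 r \<theta> :: real
  proof -
    have r1: "r\<^sub>1 = r * (1 - \<theta>)" using r by (simp add: field_simps)
    obtain A where "A > 0" "\<And>F. interpolation_norm (mod_const (Lp_norm \<mu> r\<^sub>1)) (mod_const (BMO_norm \<mu> CZ)) \<theta> r F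
        \<le> ennreal A * mod_const (Lp_norm \<mu> r) F"
      using Lr_subset_interpolation_Lp[OF r(1,2) r1] unfolding M by blast
    moreover obtain B where "B > 0" "\<And>F. mod_const (Lp_norm \<mu> r) F \<le>
        ennreal B * interpolation_norm (mod_const (Lp_norm \<mu> r\<^sub>1)) (mod_const (BMO_norm \<mu> CZ)) \<theta> r F"
      using interpolation_Lp_subset_Lr[OF r(1) _ r1] r by auto
    ultimately show ?thesis by (rule equal_with_equivalent_normsI)
  qed
  have H1: "equal_with_equivalent_norms (interpolation_norm (mod_const (H1_norm \<mu> CZ)) (mod_const (BMO_norm \<mu> CZ)) \<theta> r)
      (mod_const (Lp_norm \<mu> r))"
    if r: "0 < \<theta>" "\<theta> < 1" "1 / r = 1 - \<theta>" for r \<theta> :: real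
  proof -
    have r0: "0 < r" using r(2,3) by (metis diff_gt_0_iff_gt zero_less_divide_1_iff)
    have r1: "1 = r * (1 - \<theta>)" using r(3) r0 by (simp add: field_simps)
    have "1 < r" using mult_pos_pos[OF r(1) r0] r1 by (simp add: algebra_simps)
    obtain A where "A > 0" "\<And>F. interpolation_norm (mod_const (H1_norm \<mu> CZ)) (mod_const (BMO_norm \<mu> CZ)) \<theta> r F
        \<le> ennreal A * mod_const (Lp_norm \<mu> r) F"
      using Lr_subset_interpolation_H1[OF \<open>1 < r\<close> r1] unfolding M by blast
    moreover obtain B where B: "B > 0" "\<And>F. mod_const (Lp_norm \<mu> r) F \<le>
        ennreal B * interpolation_norm (mod_const (Lp_norm \<mu> 1)) (mod_const (BMO_norm \<mu> CZ)) \<theta> r F"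
      using interpolation_Lp_subset_Lr[OF _ \<open>1 < r\<close> r1] by auto
    moreover have "mod_const (Lp_norm \<mu> r) F \<le>
        ennreal B * interpolation_norm (mod_const (H1_norm \<mu> CZ)) (mod_const (BMO_norm \<mu> CZ)) \<theta> r F" for F
    proof -
      have "interpolation_norm (mod_const (Lp_norm \<mu> 1)) (mod_const (BMO_norm \<mu> CZ)) \<theta> r F
          \<le> interpolation_norm (mod_const (H1_norm \<mu> CZ)) (mod_const (BMO_norm \<mu> CZ)) \<theta> r F"
        using L1_le_H1 unfolding M by (intro interpolation_norm_mono mod_const_mono r0)
      then have "ennreal B * interpolation_norm (mod_const (Lp_norm \<mu> 1)) (mod_const (BMO_norm \<mu> CZ)) \<theta> r F
          \<le> ennreal B * interpolation_norm (mod_const (H1_norm \<mu> CZ)) (mod_const (BMO_norm \<mu> CZ)) \<theta> r F"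
        by (rule mult_left_mono) simp
      then show ?thesis using B(2)[of F] by (rule order_trans[rotated])
    qed
    ultimately show ?thesis by (intro equal_with_equivalent_normsI)
  qed
  show ?thesis unfolding Let_def using Lp H1 by blast
qed

end
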